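(* Let $\Upsilon$ be a tree. If $\mathscr{C}_0(\Upsilon)$ admits a G\^{a}teaux smooth lattice norm, then $\Upsilon\preccurlyeq Y$ (that is, there exists a strictly increasing map from $\Upsilon$ to $Y$) and, consequently, $\mathscr{C}_0(\Upsilon)$ admits a lattice norm whose dual norm is strictly convex.
   Context: Trees. A tree is a partially ordered set $(\Upsilon,\preccurlyeq)$ such that for each $t\in\Upsilon$ the set of predecessors $(0,t]=\{s\in\Upsilon : s\preccurlyeq t\}$ is well-ordered; here $0$ is only a notational device, not an element of $\Upsilon$. The interval topology on $\Upsilon$ is the coarsest topology for which all sets $(0,t]$, $t\in\Upsilon$, are both open and closed; it is scattered and locally compact. Throughout, all trees are assumed to have the property that every non-empty linearly ordered subset has at most one minimal upper bound, which makes the interval topology Hausdorff. $\mathscr{C}_0(\Upsilon)$ is the Banach space of continuous real-valued functions on $\Upsilon$ (with the interval topology) vanishing at infinity, with canonical norm the supremum norm. Norms. A norm on a Banach space $X$ always means a norm equivalent to the canonical one. A norm $\|\cdot\|$ is G\^{a}teaux smooth if for every $x\in X\setminus\{0\}$ there is a functional $\|x\|'\in X^*$ with $\lim_{\lambda\to 0}\frac{\|x+\lambda h\|-\|x\|}{\lambda}=\|x\|'(h)$ for all $h\in X$. A norm is strictly convex if $\|x\|=\frac12\|x+y\|=\|y\|$ implies $x=y$. A norm on $\mathscr{C}_0(\Upsilon)$ is a lattice norm if $\|f\|\leq\|g\|$ whenever $|f|\leq|g|$ pointwise. Embeddability. A map $\rho:P\to Q$ between partial orders is strictly increasing if $\rho(s)\prec\rho(t)$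 whenever $s\prec t$. For a partial order $P$ and a linear order $Q$, $P\preccurlyeq Q$ means that there exists a strictly increasing map from $P$ to $Q$. The order $Y$. Let $\omega_1$ be the first uncountable ordinal. $Y$ is the set of all strictly increasing, continuous transfinite sequences $x=(x_\xi)_{\xi\leq\beta}$ of real numbers, where $0\leq\beta<\omega_1$, linearly ordered by: $x<y$ if and only if either $y$ strictly extends $x$, or there is an ordinal $\alpha$ such that $x_\xi=y_\xi$ for $\xi<\alpha$ and $y_\alpha<x_\alpha$. *)

theory Defs
  imports "HOL-Analysis.Analysis"
begin

section \<open>Trees\<close>

text \<open>A tree is a subset \<open>T\<close> of an ordered type, with the inherited order; this includes the
  empty tree.\<close>

definition initial_segment :: "'a::order set \<Rightarrow> 'a \<Rightarrow> 'a set" where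
  "initial_segment T t = {s \<in> T. s \<le> t}"

definition minimal_upper_bound :: "'a::order set \<Rightarrow> 'a set \<Rightarrow> 'a \<Rightarrow> bool" where
  "minimal_upper_bound T C u \<longleftrightarrow>
     u \<in> T \<and> (\<forall>c\<in>C. c \<le> u) \<and> \<not> (\<exists>v\<in>T. (\<forall>c\<in>C. c \<le> v) \<and> v < u)"

text \<open>The second conjunct is the standing assumption that makes the interval topology Hausdorff.\<close>

definition tree :: "'a::order set \<Rightarrow> bool" where
  "tree T \<longleftrightarrow>
     (\<forall>t\<in>T. well_order_on (initial_segment T t)
               (Restr {(x, y). x \<le> y} (initial_segment T t))) \<and>
     (\<forall>C\<subseteq>T. C \<noteq> {} \<longrightarrow> Complete_Partial_Order.chain (\<le>) C \<longrightarrow>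
        (\<forall>u v. minimal_upper_bound T C u \<longrightarrow> minimal_upper_bound T C v \<longrightarrow> u = v))"

definition interval_topology :: "'a::order set \<Rightarrow> 'a topology" where
  "interval_topology T = topology_generated_by
     ((\<lambda>t. initial_segment T t) ` T \<union> (\<lambda>t. T - initial_segment T t) ` T)"


section \<open>Norms on spaces of real functions\<close>

text \<open>A vector space is a set \<open>V\<close> of real functions on a type, with pointwise operations.  The
  dual space is again of this form: a functional on \<open>V\<close> is a function that is \<open>0\<close> off \<open>V\<close>.\<close>

definition norm_on :: "('i \<Rightarrow> real) set \<Rightarrow> (('i \<Rightarrow> real) \<Rightarrow> real) \<Rightarrow> bool" where
  "norm_on V N \<longleftrightarrow>
     (\<forall>x\<in>V. 0 \<le> N x \<and> (N x = 0 \<longrightarrow> x = (\<lambda>_. 0))) \<and>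
     (\<forall>x\<in>V. \<forall>c. N (\<lambda>i. c * x i) = \<bar>c\<bar> * N x) \<and>
     (\<forall>x\<in>V. \<forall>y\<in>V. N (\<lambda>i. x i + y i) \<le> N x + N y)"

definition equivalent_norm_on ::
    "('i \<Rightarrow> real) set \<Rightarrow> (('i \<Rightarrow> real) \<Rightarrow> real) \<Rightarrow> (('i \<Rightarrow> real) \<Rightarrow> real) \<Rightarrow> bool" where
  "equivalent_norm_on V M N \<longleftrightarrow>
     norm_on V N \<and> (\<exists>a>0. \<exists>b>0. \<forall>x\<in>V. a * M x \<le> N x \<and> N x \<le> b * M x)"

definition dual_space ::
    "('i \<Rightarrow> real) set \<Rightarrow> (('i \<Rightarrow> real) \<Rightarrow> real) \<Rightarrow> (('i \<Rightarrow> real) \<Rightarrow> real) set" where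
  "dual_space V N = {\<phi>.
     (\<forall>x\<in>V. \<forall>y\<in>V. \<phi> (\<lambda>i. x i + y i) = \<phi> x + \<phi> y) \<and>
     (\<forall>x\<in>V. \<forall>c. \<phi> (\<lambda>i. c * x i) = c * \<phi> x) \<and>
     (\<exists>K. \<forall>x\<in>V. \<bar>\<phi> x\<bar> \<le> K * N x) \<and>
     (\<forall>x. x \<notin> V \<longrightarrow> \<phi> x = 0)}"

definition dual_norm ::
    "('i \<Rightarrow> real) set \<Rightarrow> (('i \<Rightarrow> real) \<Rightarrow> real) \<Rightarrow> (('i \<Rightarrow> real) \<Rightarrow> real) \<Rightarrow> real" where
  "dual_norm V N \<phi> = (SUP x\<in>{x \<in> V. N x \<le> 1}. \<bar>\<phi> x\<bar>)"

definition gateaux_smooth :: "('i \<Rightarrow> real) set \<Rightarrow> (('i \<Rightarrow> real) \<Rightarrow> real) \<Rightarrow> bool" where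
  "gateaux_smooth V N \<longleftrightarrow>
     (\<forall>x\<in>V. x \<noteq> (\<lambda>_. 0) \<longrightarrow>
        (\<exists>\<phi>\<in>dual_space V N. \<forall>h\<in>V.
           ((\<lambda>l. (N (\<lambda>i. x i + l * h i) - N x) / l) \<longlongrightarrow> \<phi> h) (at 0)))"

definition strictly_convex :: "('i \<Rightarrow> real) set \<Rightarrow> (('i \<Rightarrow> real) \<Rightarrow> real) \<Rightarrow> bool" where
  "strictly_convex V N \<longleftrightarrow>
     (\<forall>x\<in>V. \<forall>y\<in>V. N x = N (\<lambda>i. x i + y i) / 2 \<and> N (\<lambda>i. x i + y i) / 2 = N y \<longrightarrow> x = y)"

definition lattice_norm :: "('i \<Rightarrow> real) set \<Rightarrow> (('i \<Rightarrow> real) \<Rightarrow> real) \<Rightarrow> bool" where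
  "lattice_norm V N \<longleftrightarrow>
     (\<forall>f\<in>V. \<forall>g\<in>V. (\<forall>i. \<bar>f i\<bar> \<le> \<bar>g i\<bar>) \<longrightarrow> N f \<le> N g)"


section \<open>Continuous functions vanishing at infinity on a tree\<close>

text \<open>Functions on \<open>T\<close> are extended by \<open>0\<close> to the whole type, so the supremum over the whole
  type in \<open>sup_norm\<close> is the one over \<open>T\<close> (and is \<open>0\<close> when \<open>T\<close> is empty).\<close>

definition C0 :: "'a::order set \<Rightarrow> ('a \<Rightarrow> real) set" where
  "C0 T = {f. continuous_map (interval_topology T) euclideanreal f \<and>
              (\<forall>e>0. compactin (interval_topology T) {t \<in> T. e \<le> \<bar>f t\<bar>}) \<and>
              (\<forall>t. t \<notin> T \<longrightarrow> f t = 0)}"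

definition sup_norm :: "('a \<Rightarrow> real) \<Rightarrow> real" where
  "sup_norm f = (SUP t. \<bar>f t\<bar>)"


section \<open>The countable ordinals\<close>

text \<open>\<open>cardSuc natLeq\<close> is a well-order of type \<open>\<omega>\<^sub>1\<close>.\<close>

typedef omega1 = "Field (cardSuc natLeq)"
proof -
  have "infinite (Field (cardSuc natLeq))"
    using cardSuc_finite[OF natLeq_Card_order] by (simp add: Field_natLeq)
  then show ?thesis
    using infinite_imp_nonempty by blast
qed

lemma Well_order_cardSuc_natLeq: "Well_order (cardSuc natLeq)"
  by (simp add: cardSuc_Card_order card_order_on_well_order_on natLeq_Card_order)

instantiation omega1 :: linorder
begin

definition less_eq_omega1 :: "omega1 \<Rightarrow> omega1 \<Rightarrow> bool" where
  "a \<le> b \<longleftrightarrow> (Rep_omega1 a, Rep_omega1 b) \<in> cardSuc natLeq"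

definition less_omega1 :: "omega1 \<Rightarrow> omega1 \<Rightarrow> bool" where
  "a < b \<longleftrightarrow> a \<le> b \<and> a \<noteq> (b::omega1)"

instance
proof
  note W = Well_order_cardSuc_natLeq[unfolded order_on_defs]
  fix a b c :: omega1
  show refl: "a \<le> a"
    using W Rep_omega1[of a] by (auto simp: less_eq_omega1_def refl_on_def)
  show "a \<le> b \<Longrightarrow> b \<le> c \<Longrightarrow> a \<le> c"
    using W unfolding less_eq_omega1_def by (meson transD)
  show anti: "a \<le> b \<Longrightarrow> b \<le> a \<Longrightarrow> a = b"
    using W unfolding less_eq_omega1_def by (meson Rep_omega1_inject antisymD)
  show "a < b \<longleftrightarrow> a \<le> b \<and> \<not> b \<le> a"
    using anti refl by (auto simp: less_omega1_def)
  show "a \<le> b \<or> b \<le> a"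
  proof (cases "a = b")
    case False
    then show ?thesis
      using W Rep_omega1[of a] Rep_omega1[of b]
      by (auto simp: less_eq_omega1_def total_on_def Rep_omega1_inject)
  qed (use refl in simp)
qed

end

instance omega1 :: wellorder
proof
  fix P :: "omega1 \<Rightarrow> bool" and a
  assume step: "\<And>x. (\<And>y. y < x \<Longrightarrow> P y) \<Longrightarrow> P x"
  have "wf (cardSuc natLeq - Id)"
    using Well_order_cardSuc_natLeq by (simp add: well_order_on_def)
  then have "wf (inv_image (cardSuc natLeq - Id) Rep_omega1)"
    by (rule wf_inv_image)
  then show "P a"
  proof (induction a)
    case (less x)
    show ?case
    proof (rule step)
      fix y assume "y < x"
      then show "P y"
        by (intro less) (auto simp: less_omega1_def less_eq_omega1_def Rep_omega1_inject)
    qed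
  qed
qed

instantiation omega1 :: linorder_topology
begin

definition open_omega1 :: "omega1 set \<Rightarrow> bool" where
  "open_omega1 = generate_topology (range (\<lambda>a. {..<a}) \<union> range (\<lambda>a. {a<..}))"

instance
  by standard (rule open_omega1_def)

end


section \<open>The linear order of transfinite sequences\<close>

text \<open>The sequence \<open>(x\<^sub>\<xi>)\<close>, \<open>\<xi> \<le> \<beta>\<close>, is a partial map with domain \<open>{..\<beta>}\<close>.\<close>

typedef Y = "{x :: omega1 \<rightharpoonup> real. \<exists>\<beta>. dom x = {..\<beta>} \<and>
    strict_mono_on {..\<beta>} (\<lambda>\<xi>. the (x \<xi>)) \<and> continuous_on {..\<beta>} (\<lambda>\<xi>. the (x \<xi>))}"
proof -
  define b :: omega1 where "b = (LEAST b. True)"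
  have b: "b \<le> c" for c
    unfolding b_def by (rule Least_le) simp
  have "{..b} = {b}"
    using b by (auto intro: antisym)
  then show ?thesis
    by (intro exI[of _ "[b \<mapsto> 0]"]) (auto intro!: exI[of _ b] simp: strict_mono_on_def)
qed

instantiation Y :: linorder
begin

definition less_Y :: "Y \<Rightarrow> Y \<Rightarrow> bool" where
  "x < y \<longleftrightarrow>
     (Rep_Y x \<subseteq>\<^sub>m Rep_Y y \<and> Rep_Y x \<noteq> Rep_Y y) \<or>
     (\<exists>\<alpha> \<in> dom (Rep_Y x) \<inter> dom (Rep_Y y).
        (\<forall>\<xi><\<alpha>. Rep_Y x \<xi> = Rep_Y y \<xi>) \<and> the (Rep_Y y \<alpha>) < the (Rep_Y x \<alpha>))"

definition less_eq_Y :: "Y \<Rightarrow> Y \<Rightarrow> bool" where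
  "x \<le> y \<longleftrightarrow> x < y \<or> x = (y::Y)"

instance
proof
  have initial: "\<xi> \<in> dom (Rep_Y x)" if "\<alpha> \<in> dom (Rep_Y x)" "\<xi> \<le> \<alpha>" for x \<alpha> \<xi>
  proof -
    obtain \<beta> where "dom (Rep_Y x) = {..\<beta>}" using Rep_Y[of x] by blast
    then show ?thesis using that by simp
  qed
  \<comment> \<open>the order is governed by the first place where the two sequences differ\<close>
  have char: "x < y \<longleftrightarrow> (\<exists>\<alpha>. (\<forall>\<xi><\<alpha>. Rep_Y x \<xi> = Rep_Y y \<xi>) \<and> \<alpha> \<in> dom (Rep_Y y) \<and>
      (\<alpha> \<in> dom (Rep_Y x) \<longrightarrow> the (Rep_Y y \<alpha>) < the (Rep_Y x \<alpha>)))" (is "_ \<longleftrightarrow> (\<exists>\<alpha>. ?P \<alpha>)") for x y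
  proof
    assume "x < y"
    then consider
        (ext) "Rep_Y x \<subseteq>\<^sub>m Rep_Y y" "Rep_Y x \<noteq> Rep_Y y"
      | (diff) \<alpha> where "\<alpha> \<in> dom (Rep_Y x) \<inter> dom (Rep_Y y)"
          "\<forall>\<xi><\<alpha>. Rep_Y x \<xi> = Rep_Y y \<xi>" "the (Rep_Y y \<alpha>) < the (Rep_Y x \<alpha>)"
      unfolding less_Y_def by blast
    then show "\<exists>\<alpha>. ?P \<alpha>"
    proof cases
      case ext
      then have ex: "\<exists>\<alpha>. Rep_Y x \<alpha> \<noteq> Rep_Y y \<alpha>" by blast
      define \<alpha> where "\<alpha> = (LEAST \<alpha>. Rep_Y x \<alpha> \<noteq> Rep_Y y \<alpha>)"
      have ne: "Rep_Y x \<alpha> \<noteq> Rep_Y y \<alpha>"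
        unfolding \<alpha>_def by (rule LeastI_ex[OF ex])
      have "\<forall>\<xi><\<alpha>. Rep_Y x \<xi> = Rep_Y y \<xi>"
        using not_less_Least \<alpha>_def by blast
      moreover have "\<alpha> \<notin> dom (Rep_Y x)"
        using ext(1) ne unfolding map_le_def by blast
      moreover have "\<alpha> \<in> dom (Rep_Y y)"
        using ne calculation(2) by (metis domIff)
      ultimately show ?thesis by blast
    qed blast
  next
    assume "\<exists>\<alpha>. ?P \<alpha>"
    then obtain \<alpha> where \<alpha>: "?P \<alpha>" by blast
    show "x < y"
    proof (cases "\<alpha> \<in> dom (Rep_Y x)")
      case True
      then show ?thesis using \<alpha> unfolding less_Y_def by blast
    next
      case False
      have "\<xi> < \<alpha>" if "\<xi> \<in> dom (Rep_Y x)" for \<xi>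
        using initial[OF that, of \<alpha>] False by (meson linorder_not_le)
      then have "Rep_Y x \<subseteq>\<^sub>m Rep_Y y"
        using \<alpha> unfolding map_le_def by blast
      moreover have "Rep_Y x \<noteq> Rep_Y y"
        using \<alpha> False by metis
      ultimately show ?thesis unfolding less_Y_def by blast
    qed
  qed
  have irrefl: "\<not> x < x" for x :: Y
    unfolding less_Y_def by simp
  have trans: "x < z" if xy: "x < y" and yz: "y < z" for x y z :: Y
  proof -
    obtain a where a: "\<forall>\<xi><a. Rep_Y x \<xi> = Rep_Y y \<xi>" "a \<in> dom (Rep_Y y)"
        "a \<in> dom (Rep_Y x) \<longrightarrow> the (Rep_Y y a) < the (Rep_Y x a)"
      using xy unfolding char by blast
    obtain b where b: "\<forall>\<xi><b. Rep_Y y \<xi> = Rep_Y z \<xi>" "b \<in> dom (Rep_Y z)"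
        "b \<in> dom (Rep_Y y) \<longrightarrow> the (Rep_Y z b) < the (Rep_Y y b)"
      using yz unfolding char by blast
    consider "a < b" | "b < a" | "a = b" by fastforce
    then show "x < z"
    proof cases
      case 1
      have "Rep_Y y a = Rep_Y z a" using b(1) 1 by blast
      moreover have "\<forall>\<xi><a. Rep_Y x \<xi> = Rep_Y z \<xi>" using a(1) b(1) 1 by auto
      ultimately show ?thesis unfolding char using a(2,3) by (metis domD domI)
    next
      case 2
      have "Rep_Y x b = Rep_Y y b" using a(1) 2 by blast
      moreover have "\<forall>\<xi><b. Rep_Y x \<xi> = Rep_Y z \<xi>" using a(1) b(1) 2 by auto
      ultimately show ?thesis unfolding char using b(2,3) by (metis domD domI)
    next
      case 3
      have "\<forall>\<xi><a. Rep_Y x \<xi> = Rep_Y z \<xi>" using a(1) b(1) 3 by auto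
      then show ?thesis unfolding char using a b 3 by force
    qed
  qed
  fix x y z :: Y
  show "x < y \<longleftrightarrow> x \<le> y \<and> \<not> y \<le> x"
    using irrefl trans unfolding less_eq_Y_def by metis
  show "x \<le> x" unfolding less_eq_Y_def by blast
  show "x \<le> y \<Longrightarrow> y \<le> z \<Longrightarrow> x \<le> z"
    using trans unfolding less_eq_Y_def by metis
  show "x \<le> y \<Longrightarrow> y \<le> x \<Longrightarrow> x = y"
    using irrefl trans unfolding less_eq_Y_def by metis
  show "x \<le> y \<or> y \<le> x"
  proof (cases "x = y")
    case False
    then have ex: "\<exists>\<alpha>. Rep_Y x \<alpha> \<noteq> Rep_Y y \<alpha>" by (metis Rep_Y_inject ext)
    define \<alpha> where "\<alpha> = (LEAST \<alpha>. Rep_Y x \<alpha> \<noteq> Rep_Y y \<alpha>)"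
    have ne: "Rep_Y x \<alpha> \<noteq> Rep_Y y \<alpha>"
      unfolding \<alpha>_def by (rule LeastI_ex[OF ex])
    have eq: "\<forall>\<xi><\<alpha>. Rep_Y x \<xi> = Rep_Y y \<xi>"
      using not_less_Least \<alpha>_def by blast
    have "x < y \<or> y < x"
    proof (cases "Rep_Y x \<alpha>"; cases "Rep_Y y \<alpha>")
      fix u v assume uv: "Rep_Y x \<alpha> = Some u" "Rep_Y y \<alpha> = Some v"
      then have "u < v \<or> v < u" using ne by auto
      then show ?thesis
        unfolding char using eq uv by (metis domI option.sel)
    qed (use ne eq in \<open>unfold char; metis domD domI option.distinct(1)\<close>)+
    then show ?thesis unfolding less_eq_Y_def by blast
  qed (simp add: less_eq_Y_def)
qed

end

end

theory Submission
  imports Defs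
begin

text \<open>
  Let \<open>N\<close> be a smooth lattice norm and \<open>t\<close> a node.  Going up the segment below \<open>t\<close> we build a
  nondecreasing continuous function \<open>f\<^sub>t\<close> whose initial pieces, continued by their last value \<open>y\<close> up to
  \<open>t\<close>, have norm \<open>sqrt y\<close>; its value is raised, as far as possible, whenever the piece built so far has
  this norm already without continuation.  In that situation the lattice property makes \<open>N\<close> constant on
  a segment, so the Gateaux derivative in the direction of the continuation is \<open>0\<close> and the value really
  rises.  Replacing \<open>t\<close> by a larger node makes the norms larger and hence the rises smaller.  So the
  range of \<open>f\<^sub>t\<close>, a compact well-ordered set of reals that we read as an element of \<open>Y\<close>, is a strictly
  increasing function of \<open>t\<close>.

  For the second assertion, the dual of \<open>C\<^sub>0\<close> consists of atomic measures \<open>\<mu>\<close>.  If \<open>R\<close> is open and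
  the \<open>P\<close> are disjoint with each \<open>R \<union> P\<close> open, then \<open>\<bar>\<mu>\<bar>(R) + (\<Sum>\<bar>\<mu>\<bar>(P)\<^sup>2)\<^sup>1\<^sup>/\<^sup>2\<close> is
  the dual of a lattice seminorm, and an \<open>\<ell>\<^sub>2\<close>-combination of countably many of these is the dual
  norm of a gauge.  Equality in the triangle inequality for it forces the values \<open>\<bar>\<mu>\<bar>(P)\<close> to agree.
  The families are obtained from the truncations at rational heights of the sets attached to the nodes:
  the regions of constancy of a truncation split into disjoint open cells, and the points where it jumps
  after being constant are isolated in a closed set.  All other points are separated by the cells.
\<close>

section \<open>Trees and their interval topology\<close>

text \<open>The second assertion asks for a norm whose dual norm is strictly convex; a strictly
  convex norm on the dual that is no dual norm would not do. So each seminorm on the dual is a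
  supremum of integrals of lower semicontinuous functions against |mu|: such integrals are
  approximated by values of the functional at continuous functions, which makes the supremum the
  dual norm of a gauge. The mass of a non-open set P, for instance an exit point, is not of this
  kind. The mass of the open set R \<union> P is, and the contribution of R can be subtracted
  because R alone is also one of the families. Strictness is the parallelogram identity: equality in
  the norm gives equal values and additivity on every set of every family. Cells for finite sets of
  indices are closed under intersection, so equality on cells passes to the single atoms that they
  separate. Additivity of the total mass then matches the signs. Both assertions use the same
  nonempty compact well-ordered sets \<open>profile t\<close>; the order \<open>Y\<close> enters
  only through their increasing enumeration.\<close>

locale order_tree =
  fixes T :: "'a::order set"
  assumes tree: "tree T"
begin

abbreviation seg :: "'a \<Rightarrow> 'a set" where "seg \<equiv> initial_segment T"

text \<open>The sets \<open>seg t - A\<close> with \<open>A \<in> lowers t\<close> form a neighbourhood base at \<open>t\<close>; the empty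
  set plays the role of the segment below the notational device \<open>0\<close>.\<close>

definition lowers :: "'a \<Rightarrow> 'a set set" where
  "lowers t = insert {} (seg ` {s \<in> T. s < t})"

lemma mem_seg: "s \<in> seg t \<longleftrightarrow> s \<in> T \<and> s \<le> t"
  by (simp add: initial_segment_def)

lemma seg_subset: "seg t \<subseteq> T"
  by (auto simp: mem_seg)

lemma seg_mono: "s \<le> t \<Longrightarrow> seg s \<subseteq> seg t"
  by (auto simp: mem_seg)

lemma well_order_seg: "t \<in> T \<Longrightarrow> well_order_on (seg t) (Restr {(x, y). x \<le> y} (seg t))"
  using tree by (simp add: tree_def)

lemma seg_linear:
  assumes "t \<in> T" "x \<in> seg t" "y \<in> seg t"
  shows "x \<le> y \<or> y \<le> x"
proof (cases "x = y")
  case False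
  have "total_on (seg t) (Restr {(x, y). x \<le> y} (seg t))"
    using well_order_seg[OF assms(1)] by (simp add: order_on_defs)
  then show ?thesis
    using False assms unfolding total_on_def by fast
qed simp

lemma seg_least:
  assumes "t \<in> T" "S \<subseteq> seg t" "S \<noteq> {}"
  obtains m where "m \<in> S" "\<And>x. x \<in> S \<Longrightarrow> m \<le> x"
proof -
  have "wf (Restr {(x, y). x \<le> y} (seg t) - Id)"
    using well_order_seg[OF assms(1)] by (simp add: order_on_defs)
  moreover obtain x where "x \<in> S" using assms(3) by blast
  ultimately obtain m where m: "m \<in> S" "\<And>y. (y, m) \<in> Restr {(x, y). x \<le> y} (seg t) - Id \<Longrightarrow> y \<notin> S"
    using wfE_min by metis
  have "m \<le> x" if "x \<in> S" for x
  proof (rule ccontr)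
    assume a: "\<not> m \<le> x"
    then have "x \<le> m" using seg_linear[OF assms(1)] m(1) that assms(2) by blast
    then have "(x, m) \<in> Restr {(x, y). x \<le> y} (seg t) - Id"
      using a m(1) that assms(2) by auto
    then show False using m(2) that by blast
  qed
  then show ?thesis using that m(1) by blast
qed

lemma wf_tree: "wf {(x, y). x \<in> T \<and> y \<in> T \<and> x < y}"
  unfolding wf_eq_minimal
proof (intro allI impI)
  fix Q and x :: 'a assume x: "x \<in> Q"
  show "\<exists>z\<in>Q. \<forall>y. (y, z) \<in> {(x, y). x \<in> T \<and> y \<in> T \<and> x < y} \<longrightarrow> y \<notin> Q"
  proof (cases "x \<in> T")
    case False
    then show ?thesis using x by auto
  next
    case True
    then have "Q \<inter> seg x \<noteq> {}" using x by (auto simp: mem_seg)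
    then obtain m where m: "m \<in> Q \<inter> seg x" "\<And>y. y \<in> Q \<inter> seg x \<Longrightarrow> m \<le> y"
      using seg_least[OF True, of "Q \<inter> seg x"] by blast
    have "y \<notin> Q" if "y \<in> T" "y < m" for y
    proof
      assume "y \<in> Q"
      moreover have "y \<le> x" using m(1) that(2) by (auto simp: mem_seg)
      ultimately have "m \<le> y" using m(2) that(1) by (simp add: mem_seg)
      then show False using that(2) by simp
    qed
    then show ?thesis using m(1) by blast
  qed
qed

lemma tree_induct [consumes 1, case_names less]:
  assumes "t \<in> T" and "\<And>t. t \<in> T \<Longrightarrow> (\<And>s. s \<in> T \<Longrightarrow> s < t \<Longrightarrow> P s) \<Longrightarrow> P t"
  shows "P t"
proof -
  have "t \<in> T \<longrightarrow> P t"
    using wf_tree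
  proof (induction t rule: wf_induct_rule)
    case (less t)
    then show ?case using assms(2)[of t] by simp
  qed
  then show ?thesis using assms(1) by blast
qed

text \<open>The standing assumption on minimal upper bounds is used only here: without it two segments
  could meet in a segment without largest element.\<close>

lemma seg_Int_seg:
  assumes "t \<in> T" "t' \<in> T" "seg t \<inter> seg t' \<noteq> {}"
  obtains r where "r \<in> T" "seg t \<inter> seg t' = seg r"
proof (cases "\<exists>r\<in>seg t \<inter> seg t'. \<forall>s\<in>seg t \<inter> seg t'. s \<le> r")
  case True
  then obtain r where r: "r \<in> seg t \<inter> seg t'" "\<And>s. s \<in> seg t \<inter> seg t' \<Longrightarrow> s \<le> r" by blast
  then have "seg t \<inter> seg t' = seg r"
    by (auto simp: mem_seg intro: order.trans)
  then show ?thesis using that r(1) by (auto simp: mem_seg)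
next
  case False
  let ?C = "seg t \<inter> seg t'"
  \<comment> \<open>Without a largest common element, the first element of either segment beyond the
    common part is a minimal upper bound of that part. Uniqueness identifies the two, and the
    resulting node would be common to both segments after all.\<close>
  have min: "\<exists>m. m \<in> seg u \<and> m \<notin> ?C \<and> minimal_upper_bound T ?C m"
    if u: "u \<in> T" "?C \<subseteq> seg u" for u
  proof -
    have "u \<notin> ?C" using False u(2) by (meson mem_seg subsetD)
    then have "seg u - ?C \<noteq> {}" using u by (auto simp: mem_seg)
    then obtain m where m: "m \<in> seg u - ?C" "\<And>x. x \<in> seg u - ?C \<Longrightarrow> m \<le> x"
      using seg_least[OF u(1), of "seg u - ?C"] by blast
    have ub: "c \<le> m" if "c \<in> ?C" for c
    proof (rule ccontr)
      assume "\<not> c \<le> m"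
      then have "m \<le> c" using seg_linear[OF u(1)] m(1) that u(2) by blast
      then show False using that m(1) by (auto simp: mem_seg)
    qed
    have "\<not> (\<exists>v\<in>T. (\<forall>c\<in>?C. c \<le> v) \<and> v < m)"
    proof
      assume "\<exists>v\<in>T. (\<forall>c\<in>?C. c \<le> v) \<and> v < m"
      then obtain v where v: "v \<in> T" "\<forall>c\<in>?C. c \<le> v" "v < m" by blast
      have "v \<in> seg u" using v m(1) by (auto simp: mem_seg)
      moreover have "v \<notin> ?C" using False v(2) by blast
      ultimately show False using m(2)[of v] v(3) by auto
    qed
    then show ?thesis using m(1) ub by (auto simp: minimal_upper_bound_def mem_seg)
  qed
  obtain m where m: "m \<in> seg t" "m \<notin> ?C" "minimal_upper_bound T ?C m" using min[of t] assms by blast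
  obtain m' where m': "m' \<in> seg t'" "minimal_upper_bound T ?C m'" using min[of t'] assms by blast
  have "Complete_Partial_Order.chain (\<le>) ?C"
    using seg_linear[OF assms(1)] by (auto simp: chain_def)
  moreover have "?C \<subseteq> T" using seg_subset by blast
  moreover have "\<forall>C\<subseteq>T. C \<noteq> {} \<longrightarrow> Complete_Partial_Order.chain (\<le>) C \<longrightarrow>
      (\<forall>u v. minimal_upper_bound T C u \<longrightarrow> minimal_upper_bound T C v \<longrightarrow> u = v)"
    using tree unfolding tree_def by (rule conjunct2)
  ultimately have "m = m'" using m(3) m'(2) assms(3) by simp
  then show ?thesis using m m' by blast
qed

lemma lowers_cases [consumes 1, case_names empty seg]:
  assumes "A \<in> lowers t"
  obtains "A = {}" | s where "s \<in> T" "s < t" "A = seg s"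
  using assms by (auto simp: lowers_def)

lemma empty_lowers [simp]: "{} \<in> lowers t"
  by (simp add: lowers_def)

lemma seg_lowers: "s \<in> T \<Longrightarrow> s < t \<Longrightarrow> seg s \<in> lowers t"
  by (auto simp: lowers_def)

lemma lowers_subset: "A \<in> lowers t \<Longrightarrow> A \<subseteq> seg t"
  by (auto simp: lowers_def mem_seg)

lemma not_mem_lowers: "A \<in> lowers t \<Longrightarrow> t \<notin> A"
  by (auto simp: lowers_def mem_seg)

lemma lowers_down: "A \<in> lowers t \<Longrightarrow> x \<in> A \<Longrightarrow> y \<in> T \<Longrightarrow> y \<le> x \<Longrightarrow> y \<in> A"
  by (auto simp: lowers_def mem_seg)

lemma lowers_trans: "A \<in> lowers s \<Longrightarrow> s \<le> t \<Longrightarrow> A \<in> lowers t"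
  by (auto simp: lowers_def)

lemma lowers_chain:
  assumes "t \<in> T" "A \<in> lowers t" "B \<in> lowers t"
  shows "A \<subseteq> B \<or> B \<subseteq> A"
  using assms(2)
proof (cases rule: lowers_cases)
  case (seg s)
  note s = seg
  from assms(3) show ?thesis
  proof (cases rule: lowers_cases)
    case (seg r)
    have "r \<le> s \<or> s \<le> r"
      using seg_linear[OF assms(1), of r s] s seg by (simp add: mem_seg less_imp_le)
    then show ?thesis using s seg seg_mono by blast
  qed simp
qed simp

lemma lowers_Un:
  assumes "t \<in> T" "A \<in> lowers t" "B \<in> lowers t"
  shows "A \<union> B \<in> lowers t"
  using lowers_chain[OF assms] assms by (metis sup.absorb1 sup.absorb2)

text \<open>This is what allows other branches to be removed from a neighbourhood of
  \<open>t\<close>: the set \<open>seg t - (seg t \<inter> seg t')\<close> is a basic neighbourhood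
  that misses \<open>seg t'\<close>.\<close>

lemma seg_Int_lowers:
  assumes "t \<in> T" "t' \<in> T" "\<not> t \<le> t'"
  shows "seg t \<inter> seg t' \<in> lowers t"
proof (cases "seg t \<inter> seg t' = {}")
  case False
  obtain r where r: "r \<in> T" "seg t \<inter> seg t' = seg r"
    by (rule seg_Int_seg[OF assms(1,2) False])
  have "r \<in> seg t \<inter> seg t'" unfolding r(2) using r(1) by (simp add: mem_seg)
  then have "r < t" using assms(3) by (auto simp: mem_seg less_le)
  then show ?thesis unfolding r(2) using r(1) seg_lowers by simp
qed simp

lemma topspace_interval [simp]: "topspace (interval_topology T) = T"
  by (auto simp: interval_topology_def mem_seg)

text \<open>The sets \<open>seg t - A\<close> are stable under finite intersection because
  \<open>lowers t\<close> is a chain, and a subbasic complement of a segment contains one of them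
  around each of its points by \<open>seg_Int_lowers\<close>.\<close>

lemma openin_interval_iff:
  "openin (interval_topology T) U \<longleftrightarrow> U \<subseteq> T \<and> (\<forall>t\<in>U. \<exists>A\<in>lowers t. seg t - A \<subseteq> U)" (is "_ \<longleftrightarrow> ?R U")
proof
  assume "openin (interval_topology T) U"
  then have "generate_topology_on (seg ` T \<union> (\<lambda>t. T - seg t) ` T) U"
    by (simp add: interval_topology_def openin_topology_generated_by_iff)
  then show "?R U"
  proof induction
    case (Int a b)
    have "\<exists>A\<in>lowers t. seg t - A \<subseteq> a \<inter> b" if t: "t \<in> a \<inter> b" for t
    proof -
      from t Int.IH obtain A B where A: "A \<in> lowers t" "seg t - A \<subseteq> a" "B \<in> lowers t" "seg t - B \<subseteq> b"
        by blast
      then have "A \<union> B \<in> lowers t" using lowers_Un Int.IH t by blast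
      then show ?thesis using A by (intro bexI[of _ "A \<union> B"]) auto
    qed
    then show ?case using Int.IH by auto
  next
    case (UN K)
    then show ?case by (meson Sup_least UnionE Union_upper subset_trans)
  next
    case (Basis s)
    then consider r where "r \<in> T" "s = seg r" | r where "r \<in> T" "s = T - seg r" by blast
    then show ?case
    proof cases
      case 1
      then have "seg t - {} \<subseteq> s" if "t \<in> s" for t using that by (auto simp: mem_seg)
      then show ?thesis using 1 seg_subset empty_lowers by blast
    next
      case 2
      have "\<exists>A\<in>lowers t. seg t - A \<subseteq> s" if "t \<in> s" for t
        using that 2 seg_Int_lowers[of t r] seg_subset[of t]
        by (intro bexI[of _ "seg t \<inter> seg r"]) (auto simp: mem_seg)
      then show ?thesis using 2 by auto
    qed
  qed simp
next
  assume R: "?R U"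
  have op: "openin (interval_topology T) (seg t)" "openin (interval_topology T) (T - seg t)" if "t \<in> T" for t
    using that unfolding interval_topology_def by (auto intro!: topology_generated_by_Basis)
  have op_diff: "openin (interval_topology T) (seg t - A)" if "t \<in> T" "A \<in> lowers t" for t A
    using that(2)
  proof (cases rule: lowers_cases)
    case (seg s)
    then have "seg t - A = seg t \<inter> (T - seg s)" using seg_subset by blast
    then show ?thesis using op(1)[OF that(1)] op(2)[OF seg(1)] by (simp add: openin_Int)
  qed (use that op in simp)
  have "\<exists>V. openin (interval_topology T) V \<and> t \<in> V \<and> V \<subseteq> U" if "t \<in> U" for t
  proof -
    obtain A where "A \<in> lowers t" "seg t - A \<subseteq> U" using R \<open>t \<in> U\<close> by blast
    moreover have "t \<in> T" using R \<open>t \<in> U\<close> by blast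
    ultimately show ?thesis
      using op_diff not_mem_lowers
      by (intro exI[of _ "seg t - A"]) (auto simp: mem_seg)
  qed
  then show "openin (interval_topology T) U"
    by (subst openin_subopen) blast
qed

text \<open>The member of the cover that contains \<open>t\<close> already covers everything beyond
  some \<open>A \<in> lowers t\<close>, and \<open>A\<close> is compact by induction.\<close>

lemma compactin_seg:
  assumes "t \<in> T"
  shows "compactin (interval_topology T) (seg t)"
  using assms
proof (induction t rule: tree_induct)
  case (less t)
  show ?case
    unfolding compactin_def
  proof (intro conjI allI impI)
    show "seg t \<subseteq> topspace (interval_topology T)" using seg_subset by simp
    fix \<U> assume U: "(\<forall>U\<in>\<U>. openin (interval_topology T) U) \<and> seg t \<subseteq> \<Union>\<U>"
    then obtain U where "U \<in> \<U>" "t \<in> U" using less.hyps by (auto simp: mem_seg)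
    then obtain A where A: "A \<in> lowers t" "seg t - A \<subseteq> U"
      using U openin_interval_iff by meson
    have "compactin (interval_topology T) A"
      using A(1) by (cases rule: lowers_cases) (use less in auto)
    moreover have "A \<subseteq> \<Union>\<U>" using U lowers_subset[OF A(1)] by blast
    ultimately obtain \<F> where "finite \<F>" "\<F> \<subseteq> \<U>" "A \<subseteq> \<Union>\<F>"
      using U unfolding compactin_def by metis
    then show "\<exists>\<F>. finite \<F> \<and> \<F> \<subseteq> \<U> \<and> seg t \<subseteq> \<Union>\<F>"
      using A(2) \<open>U \<in> \<U>\<close> by (intro exI[of _ "insert U \<F>"]) auto
  qed
qed

lemma compactin_imp_subset:
  assumes "compactin (interval_topology T) C"
  obtains F where "finite F" "F \<subseteq> T" "C \<subseteq> (\<Union>t\<in>F. seg t)"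
proof -
  have "openin (interval_topology T) (seg t)" for t
    by (auto simp: openin_interval_iff mem_seg intro!: bexI[of _ "{}"])
  moreover have "C \<subseteq> \<Union>(seg ` T)"
    using compactin_subset_topspace[OF assms] by (fastforce simp: mem_seg)
  ultimately obtain \<F> where "finite \<F>" "\<F> \<subseteq> seg ` T" "C \<subseteq> \<Union>\<F>"
    using assms unfolding compactin_def by (metis image_iff)
  then show ?thesis using that by (metis finite_subset_image)
qed

end

section \<open>Continuous functions vanishing at infinity, in terms of segments\<close>

abbreviation cutoff :: "'a set \<Rightarrow> ('a \<Rightarrow> real) \<Rightarrow> 'a \<Rightarrow> real" where
  "cutoff A f \<equiv> (\<lambda>s. if s \<in> A then f s else 0)"

context order_tree
begin

definition pieces :: "'a set set" where
  "pieces = insert {} (seg ` T)"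

lemma lowers_pieces: "A \<in> lowers t \<Longrightarrow> A \<in> pieces"
  by (auto simp: lowers_def pieces_def)

lemma seg_pieces: "t \<in> T \<Longrightarrow> seg t \<in> pieces"
  by (simp add: pieces_def)

definition locally_cont :: "('a \<Rightarrow> real) \<Rightarrow> bool" where
  "locally_cont f \<longleftrightarrow> (\<forall>t\<in>T. \<forall>e>0. \<exists>A\<in>lowers t. \<forall>s\<in>seg t - A. \<bar>f s - f t\<bar> < e)"

lemma continuous_map_iff_locally_cont:
  "continuous_map (interval_topology T) euclideanreal f \<longleftrightarrow> locally_cont f" (is "?L \<longleftrightarrow> ?R")
proof
  assume L: ?L
  show ?R
    unfolding locally_cont_def
  proof (intro ballI allI impI)
    fix t e assume t: "t \<in> T" "(0::real) < e"
    have "openin (interval_topology T) {x \<in> T. f x \<in> ball (f t) e}"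
      using L unfolding continuous_map_def by (auto simp: open_openin[symmetric])
    moreover have "t \<in> {x \<in> T. f x \<in> ball (f t) e}" using t by simp
    ultimately obtain A where A: "A \<in> lowers t" "seg t - A \<subseteq> {x \<in> T. f x \<in> ball (f t) e}"
      unfolding openin_interval_iff by blast
    have "\<bar>f s - f t\<bar> < e" if "s \<in> seg t - A" for s
    proof -
      have "f s \<in> ball (f t) e" using A(2) that by blast
      then show ?thesis by (simp add: dist_real_def abs_minus_commute)
    qed
    then show "\<exists>A\<in>lowers t. \<forall>s\<in>seg t - A. \<bar>f s - f t\<bar> < e"
      using A(1) by blast
  qed
next
  assume R: ?R
  have "openin (interval_topology T) {x \<in> T. f x \<in> U}" if "open U" for U
    unfolding openin_interval_iff
  proof (intro conjI ballI)
    fix t assume t: "t \<in> {x \<in> T. f x \<in> U}"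
    then have "f t \<in> U" by simp
    then obtain e where e: "e > 0" "ball (f t) e \<subseteq> U" by (rule openE[OF \<open>open U\<close>])
    then obtain A where A: "A \<in> lowers t" "\<And>s. s \<in> seg t - A \<Longrightarrow> \<bar>f s - f t\<bar> < e"
      using R t unfolding locally_cont_def by blast
    have "f s \<in> U" if "s \<in> seg t - A" for s
    proof -
      have "f s \<in> ball (f t) e" using A(2)[OF that] by (simp add: dist_real_def abs_minus_commute)
      then show ?thesis using e(2) by blast
    qed
    then show "\<exists>A\<in>lowers t. seg t - A \<subseteq> {x \<in> T. f x \<in> U}"
      using A(1) seg_subset by blast
  qed auto
  then show ?L by (auto simp: continuous_map_def)
qed

text \<open>Segments are open and compact. Hence a compact set lies in finitely many of them, and a
  closed set inside finitely many of them is compact; this turns vanishing at infinity into a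
  condition without topology.\<close>

lemma C0_iff:
  "f \<in> C0 T \<longleftrightarrow> locally_cont f \<and>
     (\<forall>e>0. \<exists>F. finite F \<and> F \<subseteq> T \<and> (\<forall>t. e \<le> \<bar>f t\<bar> \<longrightarrow> t \<in> (\<Union>u\<in>F. seg u))) \<and>
     (\<forall>t. t \<notin> T \<longrightarrow> f t = 0)" (is "_ \<longleftrightarrow> _ \<and> ?V \<and> ?Z")
proof -
  have *: "(\<forall>e>0. compactin (interval_topology T) {t \<in> T. e \<le> \<bar>f t\<bar>}) \<longleftrightarrow> ?V" if lc: "locally_cont f" and z: ?Z
  proof (intro iffI allI impI)
    fix e :: real assume c: "\<forall>e>0. compactin (interval_topology T) {t \<in> T. e \<le> \<bar>f t\<bar>}" "e > 0"
    then have "compactin (interval_topology T) {t \<in> T. e \<le> \<bar>f t\<bar>}" by blast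
    then obtain F where F: "finite F" "F \<subseteq> T" "{t \<in> T. e \<le> \<bar>f t\<bar>} \<subseteq> (\<Union>u\<in>F. seg u)"
      by (rule compactin_imp_subset)
    have "t \<in> (\<Union>u\<in>F. seg u)" if "e \<le> \<bar>f t\<bar>" for t
    proof -
      have "t \<in> T" using that z c(2) by force
      then show ?thesis using F(3) that by blast
    qed
    then show "\<exists>F. finite F \<and> F \<subseteq> T \<and> (\<forall>t. e \<le> \<bar>f t\<bar> \<longrightarrow> t \<in> (\<Union>u\<in>F. seg u))"
      using F by blast
  next
    fix e :: real assume V: ?V and e: "e > 0"
    from V[rule_format, OF e] obtain F
      where F: "finite F" "F \<subseteq> T" "\<forall>t. e \<le> \<bar>f t\<bar> \<longrightarrow> t \<in> (\<Union>u\<in>F. seg u)" by (elim exE conjE)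
    have "continuous_map (interval_topology T) euclideanreal f"
      using lc continuous_map_iff_locally_cont by blast
    moreover have "closed {x::real. e \<le> \<bar>x\<bar>}"
      by (intro closed_Collect_le continuous_intros)
    ultimately have "closedin (interval_topology T) {t \<in> topspace (interval_topology T). f t \<in> {x. e \<le> \<bar>x\<bar>}}"
      by (intro closedin_continuous_map_preimage) (auto simp: closed_closedin[symmetric])
    moreover have "compactin (interval_topology T) (\<Union>(seg ` F))"
      using F compactin_seg by (intro compactin_Union) auto
    ultimately show "compactin (interval_topology T) {t \<in> T. e \<le> \<bar>f t\<bar>}"
      by (rule_tac closed_compactin[of _ "\<Union>(seg ` F)"]) (use F in auto)
  qed
  show ?thesis
    unfolding C0_def mem_Collect_eq continuous_map_iff_locally_cont using * by (metis (no_types, lifting))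
qed

lemma C0_off: "f \<in> C0 T \<Longrightarrow> t \<notin> T \<Longrightarrow> f t = 0"
  by (simp add: C0_iff)

lemma C0_cont:
  assumes "f \<in> C0 T" "t \<in> T" "e > 0"
  obtains A where "A \<in> lowers t" "\<And>s. s \<in> seg t - A \<Longrightarrow> \<bar>f s - f t\<bar> < e"
  using assms unfolding C0_iff locally_cont_def by metis

lemma C0_vanish:
  assumes "f \<in> C0 T" "e > 0"
  obtains F where "finite F" "F \<subseteq> T" "\<And>t. t \<notin> (\<Union>u\<in>F. seg u) \<Longrightarrow> \<bar>f t\<bar> < e"
proof -
  from assms obtain F where "finite F" "F \<subseteq> T" "\<forall>t. e \<le> \<bar>f t\<bar> \<longrightarrow> t \<in> (\<Union>u\<in>F. seg u)"
    unfolding C0_iff by blast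
  then show ?thesis using that[of F] by (meson linorder_not_le)
qed

lemma zero_C0: "(\<lambda>_. 0) \<in> C0 T"
  unfolding C0_iff locally_cont_def by (auto intro!: bexI[of _ "{}"] exI[of _ "{}"])

text \<open>Continuity and vanishing are inherited from \<open>g\<close> up to the error
  \<open>e\<close> and a Lipschitz factor \<open>K\<close>, which may depend on \<open>e\<close>.
  Multiples and uniform limits are both instances.\<close>

lemma C0_approx:
  assumes "\<And>e::real. e > 0 \<Longrightarrow> \<exists>g\<in>C0 T. \<exists>K. \<forall>s t. \<bar>f s - f t\<bar> \<le> K * \<bar>g s - g t\<bar> + e \<and> \<bar>f t\<bar> \<le> K * \<bar>g t\<bar> + e"
    and z: "\<And>t. t \<notin> T \<Longrightarrow> f t = 0"
  shows "f \<in> C0 T"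
  unfolding C0_iff locally_cont_def
proof (intro conjI ballI allI impI)
  fix t e assume t: "t \<in> T" and e: "(0::real) < e"
  obtain g K where g: "g \<in> C0 T" "\<And>s t. \<bar>f s - f t\<bar> \<le> K * \<bar>g s - g t\<bar> + e/2"
    using assms(1)[of "e/2"] e by auto
  \<comment> \<open>\<open>\<bar>K\<bar> + 1\<close> replaces \<open>K\<close>, which may be zero or
    negative.\<close>
  have "e / (2 * (\<bar>K\<bar> + 1)) > 0" using e by (simp add: pos_divide_less_eq)
  from C0_cont[OF g(1) t this] obtain A
    where A: "A \<in> lowers t" "\<And>s. s \<in> seg t - A \<Longrightarrow> \<bar>g s - g t\<bar> < e / (2 * (\<bar>K\<bar> + 1))" by blast
  have "\<bar>f s - f t\<bar> < e" if "s \<in> seg t - A" for s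
  proof -
    have "K * \<bar>g s - g t\<bar> \<le> (\<bar>K\<bar> + 1) * \<bar>g s - g t\<bar>" by (intro mult_right_mono) auto
    also have "\<dots> < (\<bar>K\<bar> + 1) * (e / (2 * (\<bar>K\<bar> + 1)))"
      using A(2)[OF that] by (intro mult_strict_left_mono) auto
    also have "\<dots> = e/2" by (simp add: field_simps)
    finally show ?thesis using g(2)[of s t] by simp
  qed
  then show "\<exists>A\<in>lowers t. \<forall>s\<in>seg t - A. \<bar>f s - f t\<bar> < e" using A(1) by blast
next
  fix e :: real assume e: "e > 0"
  obtain g K where g: "g \<in> C0 T" "\<And>t. \<bar>f t\<bar> \<le> K * \<bar>g t\<bar> + e/2"
    using assms(1)[of "e/2"] e by auto
  have "e / (2 * (\<bar>K\<bar> + 1)) > 0" using e by (simp add: pos_divide_less_eq)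
  from C0_vanish[OF g(1) this] obtain F where F: "finite F" "F \<subseteq> T"
    "\<And>t. t \<notin> (\<Union>u\<in>F. seg u) \<Longrightarrow> \<bar>g t\<bar> < e / (2 * (\<bar>K\<bar> + 1))" by blast
  have "t \<in> (\<Union>u\<in>F. seg u)" if "e \<le> \<bar>f t\<bar>" for t
  proof (rule ccontr)
    assume n: "t \<notin> (\<Union>u\<in>F. seg u)"
    have "K * \<bar>g t\<bar> \<le> (\<bar>K\<bar> + 1) * \<bar>g t\<bar>" by (intro mult_right_mono) auto
    also have "\<dots> < (\<bar>K\<bar> + 1) * (e / (2 * (\<bar>K\<bar> + 1)))"
      using F(3)[OF n] by (intro mult_strict_left_mono) auto
    also have "\<dots> = e/2" by (simp add: field_simps)
    finally show False using g(2)[of t] that by simp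
  qed
  then show "\<exists>F. finite F \<and> F \<subseteq> T \<and> (\<forall>t. e \<le> \<bar>f t\<bar> \<longrightarrow> t \<in> (\<Union>u\<in>F. seg u))"
    using F(1,2) by blast
qed (fact z)

lemma C0_uniform_limit:
  assumes "\<And>e::real. e > 0 \<Longrightarrow> \<exists>g\<in>C0 T. \<forall>t. \<bar>f t - g t\<bar> \<le> e"
  shows "f \<in> C0 T"
proof (rule C0_approx)
  fix e :: real assume "e > 0"
  then obtain g where g: "g \<in> C0 T" "\<And>t. \<bar>f t - g t\<bar> \<le> e/2" using assms[of "e/2"] by auto
  have "\<bar>f s - f t\<bar> \<le> 1 * \<bar>g s - g t\<bar> + e \<and> \<bar>f t\<bar> \<le> 1 * \<bar>g t\<bar> + e" for s t
  proof -
    have "\<bar>f s - f t\<bar> \<le> \<bar>f s - g s\<bar> + \<bar>f t - g t\<bar> + \<bar>g s - g t\<bar>" by linarith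
    moreover have "\<bar>f t\<bar> \<le> \<bar>f t - g t\<bar> + \<bar>g t\<bar>" by linarith
    moreover have "e / 2 + e / 2 = e" by simp
    ultimately show ?thesis using g(2)[of s] g(2)[of t] \<open>e > 0\<close> by simp
  qed
  then show "\<exists>g\<in>C0 T. \<exists>K. \<forall>s t. \<bar>f s - f t\<bar> \<le> K * \<bar>g s - g t\<bar> + e \<and> \<bar>f t\<bar> \<le> K * \<bar>g t\<bar> + e"
    using g(1) by blast
next
  fix t assume t: "t \<notin> T"
  show "f t = 0"
  proof (rule ccontr)
    assume "f t \<noteq> 0"
    then obtain g where "g \<in> C0 T" "\<bar>f t - g t\<bar> \<le> \<bar>f t\<bar> / 2" using assms[of "\<bar>f t\<bar> / 2"] by auto
    then show False using C0_off[of g t] t \<open>f t \<noteq> 0\<close> by auto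
  qed
qed

lemma C0_scale: "f \<in> C0 T \<Longrightarrow> (\<lambda>t. c * f t) \<in> C0 T"
proof (rule C0_approx)
  fix e :: real assume "f \<in> C0 T" "e > 0"
  moreover have "\<bar>c * f s - c * f t\<bar> \<le> \<bar>c\<bar> * \<bar>f s - f t\<bar> + e \<and> \<bar>c * f t\<bar> \<le> \<bar>c\<bar> * \<bar>f t\<bar> + e" for s t
    using \<open>e > 0\<close> by (simp add: abs_mult right_diff_distrib[symmetric])
  ultimately show "\<exists>g\<in>C0 T. \<exists>K. \<forall>s t. \<bar>c * f s - c * f t\<bar> \<le> K * \<bar>g s - g t\<bar> + e \<and> \<bar>c * f t\<bar> \<le> K * \<bar>g t\<bar> + e"
    by blast
qed (simp add: C0_off)

lemma C0_add:
  assumes f: "f \<in> C0 T" and g: "g \<in> C0 T"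
  shows "(\<lambda>t. f t + g t) \<in> C0 T"
  unfolding C0_iff locally_cont_def
proof (intro conjI ballI allI impI)
  fix t e assume t: "t \<in> T" and e: "(0::real) < e"
  then have e2: "e/2 > 0" by simp
  obtain A where A: "A \<in> lowers t" "\<And>s. s \<in> seg t - A \<Longrightarrow> \<bar>f s - f t\<bar> < e/2"
    using C0_cont[OF f t e2] by blast
  obtain B where B: "B \<in> lowers t" "\<And>s. s \<in> seg t - B \<Longrightarrow> \<bar>g s - g t\<bar> < e/2"
    using C0_cont[OF g t e2] by blast
  have "\<bar>f s + g s - (f t + g t)\<bar> < e" if "s \<in> seg t - (A \<union> B)" for s
    using A(2)[of s] B(2)[of s] that by (auto simp: abs_if split: if_splits)
  then show "\<exists>A\<in>lowers t. \<forall>s\<in>seg t - A. \<bar>f s + g s - (f t + g t)\<bar> < e"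
    using lowers_Un[OF t A(1) B(1)] by blast
next
  fix e assume e: "(0::real) < e"
  then have e2: "e/2 > 0" by simp
  obtain F where F: "finite F" "F \<subseteq> T" "\<And>t. t \<notin> (\<Union>u\<in>F. seg u) \<Longrightarrow> \<bar>f t\<bar> < e/2"
    using C0_vanish[OF f e2] by blast
  obtain G where G: "finite G" "G \<subseteq> T" "\<And>t. t \<notin> (\<Union>u\<in>G. seg u) \<Longrightarrow> \<bar>g t\<bar> < e/2"
    using C0_vanish[OF g e2] by blast
  have "t \<in> (\<Union>u\<in>F\<union>G. seg u)" if "e \<le> \<bar>f t + g t\<bar>" for t
  proof (rule ccontr)
    assume "t \<notin> (\<Union>u\<in>F\<union>G. seg u)"
    then have "\<bar>f t\<bar> < e/2" "\<bar>g t\<bar> < e/2" using F(3)[of t] G(3)[of t] by auto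
    then show False using that by linarith
  qed
  then show "\<exists>F. finite F \<and> F \<subseteq> T \<and> (\<forall>t. e \<le> \<bar>f t + g t\<bar> \<longrightarrow> t \<in> (\<Union>u\<in>F. seg u))"
    using F(1,2) G(1,2) by (intro exI[of _ "F \<union> G"]) auto
qed (simp add: C0_off[OF f] C0_off[OF g])

lemma C0_diff: "f \<in> C0 T \<Longrightarrow> g \<in> C0 T \<Longrightarrow> (\<lambda>t. f t - g t) \<in> C0 T"
  using C0_add[of f "\<lambda>t. (-1) * g t"] C0_scale[of g "-1"] by simp

lemma C0_sum:
  assumes "finite F" "\<And>i. i \<in> F \<Longrightarrow> f i \<in> C0 T"
  shows "(\<lambda>t. \<Sum>i\<in>F. f i t) \<in> C0 T"
  using assms by (induction F rule: finite_induct) (auto intro: zero_C0 C0_add)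

text \<open>A piece is open and closed, which preserves continuity, and compact, which produces the
  vanishing at infinity. In this form it applies to the constant 1 as well.\<close>

lemma C0_cut_locally_cont:
  assumes "locally_cont f" "A \<in> pieces"
  shows "cutoff A f \<in> C0 T"
proof (cases "A = {}")
  case False
  then obtain r where r: "r \<in> T" "A = seg r" using assms(2) by (auto simp: pieces_def)
  show ?thesis
    unfolding C0_iff locally_cont_def
  proof (intro conjI ballI allI impI)
    fix t e assume t: "t \<in> T" and e: "(0::real) < e"
    show "\<exists>B\<in>lowers t. \<forall>s\<in>seg t - B. \<bar>cutoff A f s - cutoff A f t\<bar> < e"
    proof (cases "t \<le> r")
      case True
      then have "seg t \<subseteq> A" "t \<in> A" using seg_mono r t by (auto simp: mem_seg)
      moreover obtain B where "B \<in> lowers t" "\<forall>s\<in>seg t - B. \<bar>f s - f t\<bar> < e"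
        using assms(1) t e unfolding locally_cont_def by blast
      ultimately show ?thesis by (intro bexI[of _ B]) auto
    next
      case False
      then have "seg t \<inter> seg r \<in> lowers t" using seg_Int_lowers r t by blast
      moreover have "t \<notin> A" using False r by (simp add: mem_seg)
      ultimately show ?thesis using r e by (intro bexI[of _ "seg t \<inter> seg r"]) auto
    qed
  next
    fix e assume "(0::real) < e"
    then show "\<exists>F. finite F \<and> F \<subseteq> T \<and> (\<forall>t. e \<le> \<bar>cutoff A f t\<bar> \<longrightarrow> t \<in> (\<Union>u\<in>F. seg u))"
      using r by (intro exI[of _ "{r}"]) auto
  qed (use r seg_subset in auto)
qed (simp add: zero_C0)

lemma C0_cut: "f \<in> C0 T \<Longrightarrow> A \<in> pieces \<Longrightarrow> cutoff A f \<in> C0 T"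
  using C0_cut_locally_cont C0_iff by blast

lemma indicator_C0: "A \<in> pieces \<Longrightarrow> (indicator A :: 'a \<Rightarrow> real) \<in> C0 T"
proof -
  assume "A \<in> pieces"
  moreover have "locally_cont (\<lambda>_. 1)" unfolding locally_cont_def using empty_lowers by (auto intro: exI[of _ "{}"])
  ultimately have "cutoff A (\<lambda>_. 1) \<in> C0 T" by (rule C0_cut_locally_cont[rotated])
  moreover have "cutoff A (\<lambda>_. 1) = (indicator A :: 'a \<Rightarrow> real)" by (auto simp: indicator_def)
  ultimately show ?thesis by simp
qed

lemma indicator_diff_C0:
  assumes "t \<in> T" "A \<in> lowers t"
  shows "(indicator (seg t - A) :: 'a \<Rightarrow> real) \<in> C0 T"
proof -
  have "(indicator (seg t - A) :: 'a \<Rightarrow> real) = (\<lambda>s. indicator (seg t) s - indicator A s)"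
    using lowers_subset[OF assms(2)] by (fastforce simp: indicator_def)
  then show ?thesis
    using C0_diff indicator_C0 seg_pieces[OF assms(1)] lowers_pieces[OF assms(2)] by metis
qed

lemma C0_bounded:
  assumes "f \<in> C0 T"
  obtains M where "\<And>t. \<bar>f t\<bar> \<le> M"
proof -
  have cm: "continuous_map (interval_topology T) euclideanreal f"
    and cp: "compactin (interval_topology T) {t \<in> T. 1 \<le> \<bar>f t\<bar>}"
    using assms by (auto simp: C0_def)
  have "compact (f ` {t \<in> T. 1 \<le> \<bar>f t\<bar>})"
    using image_compactin[OF cp cm] by simp
  then have "bounded (f ` {t \<in> T. 1 \<le> \<bar>f t\<bar>})" by (rule compact_imp_bounded)
  then obtain M where M: "\<And>t. t \<in> T \<Longrightarrow> 1 \<le> \<bar>f t\<bar> \<Longrightarrow> \<bar>f t\<bar> \<le> M"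
    unfolding bounded_real by blast
  have "\<bar>f t\<bar> \<le> max 1 M" for t
    using M[of t] C0_off[OF assms, of t] by (cases "t \<in> T"; cases "1 \<le> \<bar>f t\<bar>") auto
  then show ?thesis by (rule that)
qed

lemma abs_le_sup_norm:
  assumes "f \<in> C0 T"
  shows "\<bar>f t\<bar> \<le> sup_norm f"
proof -
  obtain M where "\<And>t. \<bar>f t\<bar> \<le> M" using C0_bounded[OF assms] by blast
  then have "bdd_above (range (\<lambda>t. \<bar>f t\<bar>))" by (auto simp: bdd_above_def)
  then show ?thesis unfolding sup_norm_def by (intro cSUP_upper) auto
qed

lemma sup_norm_le: "(\<And>t. \<bar>f t\<bar> \<le> M) \<Longrightarrow> sup_norm f \<le> M"
  unfolding sup_norm_def by (intro cSUP_least) auto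

lemma sup_norm_nonneg: "f \<in> C0 T \<Longrightarrow> 0 \<le> sup_norm f"
  using abs_le_sup_norm abs_ge_zero order_trans by blast

lemma compact_image_seg:
  assumes "f \<in> C0 T" "t \<in> T"
  shows "compact (f ` seg t)"
  using image_compactin[OF compactin_seg[OF assms(2)], of euclideanreal f] assms(1)
  by (simp add: C0_def)

end

section \<open>Transfinite sequences as compact well-ordered sets of reals\<close>

text \<open>A sequence in \<open>Y\<close> is determined by its range, a nonempty compact well-ordered set, and the
  order of \<open>Y\<close> becomes: the least element of the symmetric difference lies in the larger set.\<close>

definition lex_less :: "real set \<Rightarrow> real set \<Rightarrow> bool" where
  "lex_less K L \<longleftrightarrow> (\<exists>d\<in>L. d \<notin> K \<and> K \<inter> {..<d} = L \<inter> {..<d})"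

definition compact_wo :: "real set \<Rightarrow> bool" where
  "compact_wo K \<longleftrightarrow> K \<noteq> {} \<and> compact K \<and> (\<forall>S\<subseteq>K. S \<noteq> {} \<longrightarrow> (\<exists>m\<in>S. \<forall>x\<in>S. m \<le> x))"

lemma uncountable_omega1:
  includes cardinal_syntax
  shows "uncountable (UNIV :: omega1 set)"
proof
  assume "countable (UNIV :: omega1 set)"
  then have "countable (range Rep_omega1)" by (rule countable_image)
  then have "countable (Field (cardSuc natLeq))"
    using type_definition.Rep_range[OF type_definition_omega1] by simp
  then have "|Field (cardSuc natLeq)| \<le>o |UNIV :: nat set|"
    unfolding countable_def card_of_ordLeq[symmetric] by auto
  then have "|Field (cardSuc natLeq)| \<le>o natLeq"
    using card_of_nat ordLeq_ordIso_trans by blast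
  moreover have "|Field (cardSuc natLeq)| =o cardSuc natLeq"
    by (intro card_of_Field_ordIso cardSuc_Card_order natLeq_Card_order)
  ultimately have "cardSuc natLeq \<le>o natLeq"
    using ordIso_ordLeq_trans ordIso_symmetric by blast
  moreover have "natLeq <o cardSuc natLeq" by (rule cardSuc_greater[OF natLeq_Card_order])
  ultimately show False using not_ordLess_ordLeq by blast
qed

text \<open>The gaps between the value at a point and the value at its successor are disjoint, so
  rationals chosen in them are distinct and the index set would be countable.\<close>

lemma not_strict_mono_omega1_real: "\<not> strict_mono (g :: omega1 \<Rightarrow> real)"
proof
  assume g: "strict_mono g"
  \<comment> \<open>The points that have a successor. At most one point, a largest one, is left
    out.\<close>
  let ?A = "{\<xi>. \<exists>\<zeta>::omega1. \<xi> < \<zeta>}"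
  define nx where "nx \<xi> = (LEAST \<zeta>::omega1. \<xi> < \<zeta>)" for \<xi>
  have nx: "\<xi> < nx \<xi>" if "\<xi> \<in> ?A" for \<xi>
    using that unfolding nx_def by (auto intro: LeastI)
  have nx_le: "nx \<xi> \<le> \<zeta>" if "\<xi> < \<zeta>" for \<xi> \<zeta>
    using that unfolding nx_def by (rule Least_le)
  have "\<forall>\<xi>. \<exists>q. \<xi> \<in> ?A \<longrightarrow> g \<xi> < real_of_rat q \<and> real_of_rat q < g (nx \<xi>)"
    using nx g by (metis of_rat_dense strict_monoD)
  then obtain q where q: "\<And>\<xi>. \<xi> \<in> ?A \<Longrightarrow> g \<xi> < real_of_rat (q \<xi>) \<and> real_of_rat (q \<xi>) < g (nx \<xi>)"
    by metis
  have less: "q \<xi> < q \<zeta>" if "\<xi> \<in> ?A" "\<zeta> \<in> ?A" "\<xi> < \<zeta>" for \<xi> \<zeta>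
  proof -
    have "g (nx \<xi>) \<le> g \<zeta>" using nx_le[OF that(3)] g by (simp add: strict_mono_less_eq)
    then have "real_of_rat (q \<xi>) < real_of_rat (q \<zeta>)" using q[OF that(1)] q[OF that(2)] by linarith
    then show ?thesis by (simp add: of_rat_less)
  qed
  have "inj_on q ?A"
    by (rule inj_onI) (metis less less_irrefl linorder_neqE)
  then have "countable ?A" by (rule countableI') 
  moreover have "finite (- ?A)"
  proof (cases "- ?A = {}")
    case False
    then obtain m where "m \<in> - ?A" by blast
    have "x = m" if "x \<in> - ?A" for x
      using that \<open>m \<in> - ?A\<close> by (metis (mono_tags, lifting) ComplD linorder_less_linear mem_Collect_eq)
    then have "- ?A \<subseteq> {m}" by blast
    then show ?thesis by (rule finite_subset) simp
  qed simp
  ultimately have "countable (?A \<union> - ?A)" using countable_finite countable_Un by blast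
  then show False using uncountable_omega1 by simp
qed

section \<open>Increasing enumeration of a compact well-ordered set\<close>

definition enum_rest :: "(omega1 \<Rightarrow> real option) \<Rightarrow> real set \<Rightarrow> omega1 \<Rightarrow> real set" where
  "enum_rest h K \<xi> = {a \<in> K. \<forall>\<eta><\<xi>. \<forall>b. h \<eta> = Some b \<longrightarrow> b < a}"

text \<open>The value \<open>None\<close> means that \<open>K\<close> is used up. It persists from
  then on (\<open>enum_None_mono\<close>), so the domain is an initial segment of the countable
  ordinals.\<close>

definition enum :: "real set \<Rightarrow> omega1 \<Rightarrow> real option" where
  "enum K = wfrec {(x, y). x < y} (\<lambda>h \<xi>.
     if enum_rest h K \<xi> = {} then None else Some (LEAST a. a \<in> enum_rest h K \<xi>))"

lemma enum_unfold:
  "enum K \<xi> = (if enum_rest (enum K) K \<xi> = {} then None else Some (LEAST a. a \<in> enum_rest (enum K) K \<xi>))"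
proof -
  have "enum_rest (Wfrec.cut (enum K) {(x, y). x < y} \<xi>) K \<xi> = enum_rest (enum K) K \<xi>"
    by (auto simp: enum_rest_def Wfrec.cut_def)
  then show ?thesis
    by (subst (1) enum_def, subst wfrec[OF wf]) (simp flip: enum_def)
qed

lemma enum_None_iff: "enum K \<xi> = None \<longleftrightarrow> enum_rest (enum K) K \<xi> = {}"
  by (subst enum_unfold) simp

lemma enum_Some:
  assumes "compact_wo K" "enum K \<xi> = Some a"
  shows "a \<in> enum_rest (enum K) K \<xi>" "\<And>c. c \<in> enum_rest (enum K) K \<xi> \<Longrightarrow> a \<le> c"
proof -
  let ?S = "enum_rest (enum K) K \<xi>"
  have "?S \<noteq> {}" using assms(2) enum_None_iff[of K \<xi>] by simp
  moreover have "?S \<subseteq> K" by (auto simp: enum_rest_def)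
  ultimately obtain m where m: "m \<in> ?S" "\<forall>x\<in>?S. m \<le> x"
    using assms(1) unfolding compact_wo_def by meson
  then have "(LEAST a. a \<in> ?S) = m" by (intro Least_equality) auto
  then have "a = m" using assms(2) \<open>?S \<noteq> {}\<close> enum_unfold[of K \<xi>] by simp
  then show "a \<in> ?S" "\<And>c. c \<in> ?S \<Longrightarrow> a \<le> c" using m by auto
qed

lemma enum_mem: "compact_wo K \<Longrightarrow> enum K \<xi> = Some a \<Longrightarrow> a \<in> K"
  using enum_Some(1) by (fastforce simp: enum_rest_def)

lemma enum_strict: "compact_wo K \<Longrightarrow> enum K \<xi> = Some a \<Longrightarrow> enum K \<zeta> = Some b \<Longrightarrow> \<xi> < \<zeta> \<Longrightarrow> a < b"
  using enum_Some(1)[of K \<zeta> b] by (simp add: enum_rest_def)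

lemma enum_None_mono: "enum K \<xi> = None \<Longrightarrow> \<xi> \<le> \<zeta> \<Longrightarrow> enum K \<zeta> = None"
  unfolding enum_None_iff by (force simp: enum_rest_def)

lemma enum_exhausted:
  assumes K: "compact_wo K"
  shows "\<exists>\<xi>. enum K \<xi> = None"
proof (rule ccontr)
  assume "\<nexists>\<xi>. enum K \<xi> = None"
  then have "strict_mono (\<lambda>\<xi>. the (enum K \<xi>))"
    using enum_strict[OF K] by (intro strict_monoI) (metis option.exhaust_sel)
  then show False using not_strict_mono_omega1_real by blast
qed

text \<open>By compactness \<open>K\<close> has a maximum, and the enumeration stops exactly after
  it. This produces a last index \<beta>, as the definition of \<open>Y\<close> demands.\<close>

lemma enum_dom:
  assumes K: "compact_wo K"
  obtains \<beta> where "dom (enum K) = {..\<beta>}"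
proof -
  obtain \<gamma> where \<gamma>: "enum K \<gamma> = None" using enum_exhausted[OF K] by blast
  obtain M where M: "M \<in> K" "\<And>x. x \<in> K \<Longrightarrow> x \<le> M"
    using K compact_attains_sup[of K] unfolding compact_wo_def by blast
  have "M \<notin> enum_rest (enum K) K \<gamma>" using \<gamma> enum_None_iff by blast
  then obtain \<eta> b where \<eta>: "enum K \<eta> = Some b" "\<not> b < M" using M(1) by (auto simp: enum_rest_def)
  have "enum K \<zeta> = None" if "\<eta> < \<zeta>" for \<zeta>
  proof (rule ccontr)
    assume "enum K \<zeta> \<noteq> None"
    then obtain a where a: "enum K \<zeta> = Some a" by blast
    then show False using enum_strict[OF K \<eta>(1) a that] M(2)[OF enum_mem[OF K a]] \<eta>(2) by linarith
  qed
  moreover have "enum K \<zeta> \<noteq> None" if "\<zeta> \<le> \<eta>" for \<zeta>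
    using enum_None_mono[OF _ that] \<eta>(1) by fastforce
  ultimately have "dom (enum K) = {..\<eta>}" by (auto simp: dom_def) (metis linorder_not_le option.distinct(1))
  then show ?thesis by (rule that)
qed

text \<open>Look at the first index whose value is at least \<open>d\<close>. There \<open>d\<close>
  itself is still available, so the greedy choice cannot exceed it.\<close>

lemma enum_surj:
  assumes K: "compact_wo K" and d: "d \<in> K"
  obtains \<xi> where "enum K \<xi> = Some d"
proof -
  have "\<exists>\<eta> b. enum K \<eta> = Some b \<and> d \<le> b"
  proof (rule ccontr)
    assume n: "\<nexists>\<eta> b. enum K \<eta> = Some b \<and> d \<le> b"
    obtain \<gamma> where "enum K \<gamma> = None" using enum_exhausted[OF K] by blast
    moreover have "d \<in> enum_rest (enum K) K \<gamma>"
      using n d by (auto simp: enum_rest_def not_le)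
    ultimately show False using enum_None_iff by blast
  qed
  then have ex: "\<exists>\<eta>. \<exists>b. enum K \<eta> = Some b \<and> d \<le> b" .
  define \<eta> where "\<eta> = (LEAST \<eta>. \<exists>b. enum K \<eta> = Some b \<and> d \<le> b)"
  obtain b where b: "enum K \<eta> = Some b" "d \<le> b" using LeastI_ex[OF ex] \<eta>_def by blast
  have "c < d" if "\<zeta> < \<eta>" "enum K \<zeta> = Some c" for \<zeta> c
  proof -
    have "\<not> (\<exists>b. enum K \<zeta> = Some b \<and> d \<le> b)"
      using that(1) unfolding \<eta>_def by (rule not_less_Least)
    then show ?thesis using that(2) by (simp add: not_le)
  qed
  then have "d \<in> enum_rest (enum K) K \<eta>" using d by (simp add: enum_rest_def)
  then have "b = d" using enum_Some(2)[OF K b(1)] b(2) by (simp add: antisym)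
  then show ?thesis using that b(1) by blast
qed

text \<open>An index has a neighbourhood that contains no larger index, so only continuity from the
  left matters. It comes from the closedness of \<open>K\<close>: the supremum of the earlier values
  belongs to \<open>K\<close>, and the greedy choice cannot skip it.\<close>

lemma enum_continuous:
  assumes K: "compact_wo K" and dom: "dom (enum K) = {..\<beta>}"
  shows "continuous_on {..\<beta>} (\<lambda>\<xi>. the (enum K \<xi>))"
proof -
  let ?g = "\<lambda>\<xi>. the (enum K \<xi>)"
  have g: "enum K \<xi> = Some (?g \<xi>)" if "\<xi> \<le> \<beta>" for \<xi>
  proof -
    have "\<xi> \<in> dom (enum K)" using that dom by simp
    then show ?thesis by auto
  qed
  have less: "?g \<xi> < ?g \<zeta>" if "\<xi> < \<zeta>" "\<zeta> \<le> \<beta>" for \<xi> \<zeta>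
    using enum_strict[OF K g g that(1)] that by simp
  have le: "?g \<xi> \<le> ?g \<zeta>" if "\<xi> \<le> \<zeta>" "\<zeta> \<le> \<beta>" for \<xi> \<zeta>
    using less[of \<xi> \<zeta>] that by (cases "\<xi> = \<zeta>") (simp_all add: less_le)
  have "(?g \<longlongrightarrow> ?g \<xi>) (at \<xi> within {..\<beta>})" if \<xi>: "\<xi> \<le> \<beta>" for \<xi>
  proof (rule order_tendstoI)
    fix a assume a: "?g \<xi> < a"
    have "\<exists>U. open U \<and> \<xi> \<in> U \<and> (\<forall>\<eta>\<in>U. \<eta> \<le> \<beta> \<longrightarrow> \<eta> \<le> \<xi>)"
    proof (cases "\<xi> = \<beta>")
      case True
      then show ?thesis by (intro exI[of _ UNIV]) auto
    next
      case False
      then have lt: "\<xi> < \<beta>" using \<xi> by simp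
      define \<zeta> where "\<zeta> = (LEAST \<zeta>. \<xi> < \<zeta>)"
      have "\<xi> < \<zeta>" unfolding \<zeta>_def using lt by (rule LeastI)
      moreover have "\<eta> \<le> \<xi>" if "\<eta> < \<zeta>" for \<eta>
        using not_less_Least that unfolding \<zeta>_def by (metis linorder_not_le)
      ultimately show ?thesis by (intro exI[of _ "{..<\<zeta>}"]) auto
    qed
    then obtain U where U: "open U" "\<xi> \<in> U" "\<And>\<eta>. \<eta> \<in> U \<Longrightarrow> \<eta> \<le> \<beta> \<Longrightarrow> \<eta> \<le> \<xi>" by blast
    show "\<forall>\<^sub>F \<eta> in at \<xi> within {..\<beta>}. ?g \<eta> < a"
      unfolding eventually_at_topological
    proof (intro exI[of _ U] conjI ballI impI)
      fix \<eta> assume "\<eta> \<in> U" "\<eta> \<noteq> \<xi>" "\<eta> \<in> {..\<beta>}"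
      then show "?g \<eta> < a" using le[OF U(3) \<xi>, of \<eta>] a by simp
    qed (use U in auto)
  next
    fix a assume a: "a < ?g \<xi>"
    have "\<exists>U. open U \<and> \<xi> \<in> U \<and> (\<forall>\<eta>\<in>U. \<eta> \<le> \<beta> \<longrightarrow> a < ?g \<eta>)"
    proof (cases "\<exists>\<eta><\<xi>. a < ?g \<eta>")
      case True
      then obtain \<eta> where \<eta>: "\<eta> < \<xi>" "a < ?g \<eta>" by blast
      then have "a < ?g \<zeta>" if "\<eta> < \<zeta>" "\<zeta> \<le> \<beta>" for \<zeta> using less[OF that] by simp
      then show ?thesis using \<eta> by (intro exI[of _ "{\<eta><..}"]) auto
    next
      \<comment> \<open>All earlier values stay below the bound \<open>a\<close>. Then \<xi> is
        isolated, being the least index or the immediate successor of some \<eta>: if the supremum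
        of the earlier values were not attained, it would be an available element of
        \<open>K\<close> smaller than \<open>?g \<xi>\<close>.\<close>
      case False
      then have low: "?g \<eta> \<le> a" if "\<eta> < \<xi>" for \<eta> using that by force
      have "\<exists>U. open U \<and> \<xi> \<in> U \<and> (\<forall>\<eta>\<in>U. \<xi> \<le> \<eta>)"
      proof (cases "\<exists>\<eta>. \<eta> < \<xi>")
        case True
        let ?S = "?g ` {..<\<xi>}"
        have ne: "?S \<noteq> {}" using True by auto
        have bd: "bdd_above ?S" using low by (intro bdd_aboveI[of _ a]) auto
        have "?S \<subseteq> K" using enum_mem[OF K g] \<xi> by auto
        moreover have "closed K" using K by (simp add: compact_wo_def compact_imp_closed)
        ultimately have SK: "Sup ?S \<in> K" using closed_subset_contains_Sup[OF _ _ ne bd] by blast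
        have "Sup ?S \<le> a" using low ne by (intro cSup_least) auto
        then have "Sup ?S \<notin> enum_rest (enum K) K \<xi>"
          using enum_Some(2)[OF K g[OF \<xi>], of "Sup ?S"] a by linarith
        then obtain \<eta> b where "\<eta> < \<xi>" "enum K \<eta> = Some b" "\<not> b < Sup ?S"
          using SK by (auto simp: enum_rest_def)
        then have \<eta>: "\<eta> < \<xi>" "Sup ?S \<le> ?g \<eta>" by auto
        have "\<xi> \<le> \<zeta>" if "\<eta> < \<zeta>" for \<zeta>
        proof (rule ccontr)
          assume "\<not> \<xi> \<le> \<zeta>"
          then have "\<zeta> < \<xi>" by simp
          then have "?g \<zeta> \<le> Sup ?S" using bd by (intro cSup_upper) auto
          then show False using less[OF that] \<eta>(2) \<open>\<zeta> < \<xi>\<close> \<xi> by force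
        qed
        then show ?thesis using \<eta>(1) by (intro exI[of _ "{\<eta><..}"]) auto
      next
        case False
        then show ?thesis by (intro exI[of _ UNIV]) (auto simp: not_less)
      qed
      then show ?thesis using a le by (meson less_le_trans)
    qed
    then obtain U where "open U" "\<xi> \<in> U" "\<And>\<eta>. \<eta> \<in> U \<Longrightarrow> \<eta> \<le> \<beta> \<Longrightarrow> a < ?g \<eta>" by blast
    then show "\<forall>\<^sub>F \<eta> in at \<xi> within {..\<beta>}. a < ?g \<eta>"
      unfolding eventually_at_topological by (intro exI[of _ U]) auto
  qed
  then show ?thesis by (simp add: continuous_on_def)
qed

definition to_Y :: "real set \<Rightarrow> Y" where "to_Y K = Abs_Y (enum K)"

lemma Rep_to_Y:
  assumes K: "compact_wo K"
  shows "Rep_Y (to_Y K) = enum K"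
proof -
  obtain \<beta> where \<beta>: "dom (enum K) = {..\<beta>}" using enum_dom[OF K] .
  have "strict_mono_on {..\<beta>} (\<lambda>\<xi>. the (enum K \<xi>))"
  proof (rule strict_mono_onI)
    fix \<xi> \<zeta> assume "\<xi> \<in> {..\<beta>}" "\<zeta> \<in> {..\<beta>}" "\<xi> < \<zeta>"
    moreover then obtain a b where "enum K \<xi> = Some a" "enum K \<zeta> = Some b" using \<beta> by blast
    ultimately show "the (enum K \<xi>) < the (enum K \<zeta>)" using enum_strict[OF K] by simp
  qed
  then show ?thesis
    unfolding to_Y_def using \<beta> enum_continuous[OF K \<beta>] by (intro Abs_Y_inverse) auto
qed

text \<open>Up to the place \<alpha> where \<open>L\<close> takes the value \<open>d\<close> the two
  enumerations coincide. At \<alpha> either \<open>K\<close> is exhausted, so the second sequence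
  extends the first, or its value exceeds \<open>d\<close>, because \<open>d\<close> is not in
  \<open>K\<close> and all smaller elements are shared. The larger value belongs to the smaller
  sequence, in accordance with the reversed comparison in \<open>Y\<close>.\<close>

lemma to_Y_less:
  assumes K: "compact_wo K" and L: "compact_wo L" and "lex_less K L"
  shows "to_Y K < to_Y L"
proof -
  obtain d where d: "d \<in> L" "d \<notin> K" "K \<inter> {..<d} = L \<inter> {..<d}"
    using assms(3) unfolding lex_less_def by blast
  obtain \<alpha> where \<alpha>: "enum L \<alpha> = Some d" using enum_surj[OF L d(1)] .
  have below: "enum L \<xi> \<noteq> None \<and> the (enum L \<xi>) < d" if "\<xi> < \<alpha>" for \<xi>
  proof -
    have "enum L \<xi> \<noteq> None" using enum_None_mono[of L \<xi> \<alpha>] less_imp_le[OF that] \<alpha> by auto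
    then show ?thesis using enum_strict[OF L _ \<alpha> that] by auto
  qed
  have eq: "enum K \<xi> = enum L \<xi>" if "\<xi> < \<alpha>" for \<xi>
    using that
  proof (induction \<xi> rule: less_induct)
    case (less \<xi>)
    then have rest: "(\<forall>\<eta><\<xi>. \<forall>b. enum K \<eta> = Some b \<longrightarrow> b < c) \<longleftrightarrow> (\<forall>\<eta><\<xi>. \<forall>b. enum L \<eta> = Some b \<longrightarrow> b < c)" for c
      by (metis less_trans)
    obtain a where a: "enum L \<xi> = Some a" "a < d" using below[OF less.prems] by auto
    have "a \<in> K" using d(3) enum_mem[OF L a(1)] a(2) by blast
    then have aK: "a \<in> enum_rest (enum K) K \<xi>" 
      using enum_Some(1)[OF L a(1)] rest[of a] by (simp add: enum_rest_def)
    then obtain b where b: "enum K \<xi> = Some b" using enum_None_iff by blast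
    have "b \<le> a" using enum_Some(2)[OF K b aK] .
    then have "b \<in> K \<inter> {..<d}" using enum_mem[OF K b] a(2) by simp
    then have "b \<in> L" using d(3) by blast
    then have "b \<in> enum_rest (enum L) L \<xi>"
      using enum_Some(1)[OF K b] rest[of b] by (simp add: enum_rest_def)
    then have "a \<le> b" using enum_Some(2)[OF L a(1)] by blast
    then show ?case using \<open>b \<le> a\<close> a b by simp
  qed
  have "d < b" if "enum K \<alpha> = Some b" for b
  proof (rule ccontr)
    assume "\<not> d < b"
    moreover have "b \<in> K" using enum_mem[OF K that] .
    ultimately have "b < d" using d(2) by (metis linorder_neqE_linordered_idom)
    then have "b \<in> L" using d(3) \<open>b \<in> K\<close> by blast
    then have "b \<in> enum_rest (enum L) L \<alpha>"
      using enum_Some(1)[OF K that] eq by (auto simp: enum_rest_def)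
    then show False using enum_Some(2)[OF L \<alpha>] \<open>b < d\<close> by fastforce
  qed
  then show ?thesis
  proof (cases "enum K \<alpha>")
    case None
    have "enum K \<subseteq>\<^sub>m enum L"
      unfolding map_le_def
    proof
      fix \<xi> assume "\<xi> \<in> dom (enum K)"
      then have "\<xi> < \<alpha>" using enum_None_mono[OF None] by (meson domIff linorder_not_le)
      then show "enum K \<xi> = enum L \<xi>" by (rule eq)
    qed
    moreover have "enum K \<noteq> enum L" using None \<alpha> by auto
    ultimately show ?thesis unfolding less_Y_def Rep_to_Y[OF K] Rep_to_Y[OF L] by blast
  next
    case (Some b)
    then have "d < b" by (rule \<open>\<And>b. enum K \<alpha> = Some b \<Longrightarrow> d < b\<close>)
    then show ?thesis unfolding less_Y_def Rep_to_Y[OF K] Rep_to_Y[OF L]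
      using Some \<alpha> eq by (intro disjI2 bexI[of _ \<alpha>]) auto
  qed
qed

section \<open>A strictly increasing map from a smooth lattice norm\<close>

text \<open>The bound is the error of the equation \<open>N g = sqrt s\<close> under a uniform
  perturbation of size \<open>e\<close>: linear from the norm, \<open>sqrt e\<close> from the square
  root.\<close>

lemma le_zero_if_le_modulus:
  fixes b x :: real
  assumes "\<And>e. e > 0 \<Longrightarrow> x \<le> b * e + sqrt e"
  shows "x \<le> 0"
proof -
  have "((\<lambda>e. b * e + sqrt e) \<longlongrightarrow> b * 0 + sqrt 0) (at_right 0)"
    by (intro tendsto_intros)
  then have lim: "((\<lambda>e. b * e + sqrt e) \<longlongrightarrow> 0) (at_right 0)" by simp
  show ?thesis
    by (rule tendsto_lowerbound[OF lim]) (auto simp: eventually_at_right_less assms intro: eventually_mono[OF eventually_at_right_less])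
qed

locale lattice_normed_tree = order_tree T for T :: "'a::order set" +
  fixes N :: "('a \<Rightarrow> real) \<Rightarrow> real"
  assumes equiv: "equivalent_norm_on (C0 T) sup_norm N"
    and lattice: "lattice_norm (C0 T) N"
begin

lemma N_lower:
  obtains a where "a > 0" "\<And>f t. f \<in> C0 T \<Longrightarrow> a * \<bar>f t\<bar> \<le> N f"
proof -
  obtain a where a: "a > 0" "\<And>f. f \<in> C0 T \<Longrightarrow> a * sup_norm f \<le> N f"
    using equiv unfolding equivalent_norm_on_def by blast
  have "a * \<bar>f t\<bar> \<le> N f" if "f \<in> C0 T" for f t
    using a(2)[OF that] mult_left_mono[OF abs_le_sup_norm[OF that, of t], of a] a(1) by linarith
  then show ?thesis using that a(1) by blast
qed

lemma N_upper:
  obtains b where "b > 0" "\<And>f e. f \<in> C0 T \<Longrightarrow> (\<And>t. \<bar>f t\<bar> \<le> e) \<Longrightarrow> N f \<le> b * e"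
proof -
  obtain b where b: "b > 0" "\<And>f. f \<in> C0 T \<Longrightarrow> N f \<le> b * sup_norm f"
    using equiv unfolding equivalent_norm_on_def by blast
  have "N f \<le> b * e" if "f \<in> C0 T" "\<And>t. \<bar>f t\<bar> \<le> e" for f e
  proof -
    have "sup_norm f \<le> e" using that(2) by (rule sup_norm_le)
    then have "b * sup_norm f \<le> b * e" using b(1) by (intro mult_left_mono) auto
    then show ?thesis using b(2)[OF that(1)] by simp
  qed
  then show ?thesis using that b(1) by blast
qed

lemma N_mono: "f \<in> C0 T \<Longrightarrow> g \<in> C0 T \<Longrightarrow> (\<And>t. \<bar>f t\<bar> \<le> \<bar>g t\<bar>) \<Longrightarrow> N f \<le> N g"
  using lattice unfolding lattice_norm_def by blast

lemma norm: "norm_on (C0 T) N"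
  using equiv by (simp add: equivalent_norm_on_def)

lemma N_add: "f \<in> C0 T \<Longrightarrow> g \<in> C0 T \<Longrightarrow> N (\<lambda>t. f t + g t) \<le> N f + N g"
  using norm by (simp add: norm_on_def)

lemma N_zero: "N (\<lambda>_. 0) = 0"
proof -
  have "\<forall>x\<in>C0 T. \<forall>c. N (\<lambda>i. c * x i) = \<bar>c\<bar> * N x"
    using norm by (simp add: norm_on_def)
  from this[rule_format, OF zero_C0, of 0] show ?thesis by simp
qed

lemma N_lipschitz:
  obtains b where "b > 0"
    "\<And>f g e. f \<in> C0 T \<Longrightarrow> g \<in> C0 T \<Longrightarrow> (\<And>t. \<bar>f t - g t\<bar> \<le> e) \<Longrightarrow> \<bar>N f - N g\<bar> \<le> b * e"
proof -
  obtain b where b: "b > 0" "\<And>f e. f \<in> C0 T \<Longrightarrow> (\<And>t. \<bar>f t\<bar> \<le> e) \<Longrightarrow> N f \<le> b * e"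
    using N_upper by metis
  have "N f - N g \<le> b * e" if "f \<in> C0 T" "g \<in> C0 T" "\<And>t. \<bar>f t - g t\<bar> \<le> e" for f g e
  proof -
    have "N (\<lambda>t. g t + (f t - g t)) \<le> N g + N (\<lambda>t. f t - g t)"
      using that C0_diff by (intro N_add) auto
    moreover have "N (\<lambda>t. f t - g t) \<le> b * e" using that C0_diff by (intro b(2)) auto
    ultimately show ?thesis by simp
  qed
  then have "\<bar>N f - N g\<bar> \<le> b * e" if "f \<in> C0 T" "g \<in> C0 T" "\<And>t. \<bar>f t - g t\<bar> \<le> e" for f g e
    using that by (simp add: abs_le_iff abs_minus_commute)
  then show ?thesis using that b(1) by blast
qed

definition below :: "'a \<Rightarrow> 'a set" where "below u = {w \<in> T. w < u}"

definition plat :: "'a set \<Rightarrow> 'a \<Rightarrow> ('a \<Rightarrow> real) \<Rightarrow> real \<Rightarrow> 'a \<Rightarrow> real" where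
  "plat A t g y = (\<lambda>w. if w \<in> A then g w else if w \<in> seg t then y else 0)"

text \<open>For the nonnegative nondecreasing functions considered here this is the last value, or
  the left limit, before \<open>u\<close>. The inserted 0 is the value at a minimal node.\<close>

definition base :: "('a \<Rightarrow> real) \<Rightarrow> 'a \<Rightarrow> real" where
  "base g u = Sup (insert 0 (g ` below u))"

text \<open>The first conjunct says that \<open>u\<close> is minimal or has an immediate
  predecessor, so that a new value can start at \<open>u\<close> without destroying
  continuity.\<close>

definition jump :: "('a \<Rightarrow> real) \<Rightarrow> 'a \<Rightarrow> bool" where
  "jump g u \<longleftrightarrow> below u \<in> lowers u \<and> N (cutoff (below u) g) = sqrt (base g u)"

definition heights :: "'a \<Rightarrow> ('a \<Rightarrow> real) \<Rightarrow> 'a \<Rightarrow> real set" where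
  "heights t g u = {y. base g u \<le> y \<and> N (plat (below u) t g y) \<le> sqrt y}"

definition rise :: "'a \<Rightarrow> ('a \<Rightarrow> real) \<Rightarrow> 'a \<Rightarrow> real" where
  "rise t g u = (if jump g u then Sup (heights t g u) else base g u)"

text \<open>Along the segment below \<open>t\<close> the function \<open>climb t\<close> stays constant until the part \<open>g\<close> built so far
  satisfies \<open>N g = sqrt s\<close>, where \<open>s\<close> is its last value; then it rises to the largest \<open>y\<close> for which
  continuing with the constant value \<open>y\<close> up to \<open>t\<close> gives a function of norm at most \<open>sqrt y\<close>.
  Instead of \<open>sqrt\<close> any function would do that vanishes at \<open>0\<close>, grows faster than linearly at \<open>0\<close>
  and slower at infinity, and has positive slope.\<close>

definition climb :: "'a \<Rightarrow> 'a \<Rightarrow> real" where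
  "climb t = wfrec {(x, y). x \<in> T \<and> y \<in> T \<and> x < y} (rise t)"

lemma below_cong:
  assumes "\<And>w. w \<in> below u \<Longrightarrow> g w = h w"
  shows "cutoff (below u) g = cutoff (below u) h" "base g u = base h u"
    "jump g u = jump h u" "plat (below u) t g y = plat (below u) t h y"
    "heights t g u = heights t h u" "rise t g u = rise t h u"
proof -
  show 1: "cutoff (below u) g = cutoff (below u) h" using assms by auto
  have "g ` below u = h ` below u" using assms by (rule image_cong[OF refl])
  then show 2: "base g u = base h u" by (simp add: base_def)
  show 3: "jump g u = jump h u" unfolding jump_def 1 2 ..
  have 4: "plat (below u) t g y = plat (below u) t h y" for y using assms by (auto simp: plat_def)
  then show "plat (below u) t g y = plat (below u) t h y" .
  show 5: "heights t g u = heights t h u" unfolding heights_def 2 4 ..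
  show "rise t g u = rise t h u" unfolding rise_def 2 3 5 ..
qed

lemma climb_unfold:
  assumes "u \<in> T"
  shows "climb t u = rise t (climb t) u"
proof -
  let ?R = "{(x, y). x \<in> T \<and> y \<in> T \<and> x < y}"
  have "climb t u = rise t (Wfrec.cut (climb t) ?R u) u"
    unfolding climb_def by (rule wfrec[OF wf_tree])
  also have "\<dots> = rise t (climb t) u"
    by (rule below_cong(6)) (use assms in \<open>auto simp: below_def Wfrec.cut_def\<close>)
  finally show ?thesis .
qed

lemma below_lowers:
  assumes "below u \<in> lowers u" "u \<in> seg t"
  shows "below u \<in> lowers t"
  using assms lowers_trans by (auto simp: mem_seg)

text \<open>The function \<^term>\<open>plat (seg u) t (climb t) (climb t u)\<close> agrees with \<^term>\<open>climb t\<close> up to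
  \<open>u\<close> and is constant from there up to \<open>t\<close>.\<close>

definition good :: "'a \<Rightarrow> 'a \<Rightarrow> bool" where
  "good t u \<longleftrightarrow> 0 \<le> climb t u \<and> (\<forall>w\<in>below u. climb t w \<le> climb t u) \<and>
     plat (seg u) t (climb t) (climb t u) \<in> C0 T \<and>
     N (plat (seg u) t (climb t) (climb t u)) = sqrt (climb t u)"

lemma plat_seg: "u \<in> seg t \<Longrightarrow> plat (seg u) t g (g u) = plat (below u) t g (g u)"
  by (fastforce simp: plat_def mem_seg below_def less_le)

text \<open>The norm dominates \<open>a * y\<close>, where \<open>y\<close> is the value at
  \<open>t\<close>, and \<open>a * y \<le> sqrt y\<close> forces \<open>y \<le> 1 / a^2\<close>.
  Here the slow growth of \<open>sqrt\<close> at infinity is used.\<close>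

lemma height_bound:
  obtains c where "\<And>g t. g \<in> C0 T \<Longrightarrow> 0 \<le> g t \<Longrightarrow> N g \<le> sqrt (g t) \<Longrightarrow> g t \<le> c"
proof -
  obtain a where a: "a > 0" "\<And>f t. f \<in> C0 T \<Longrightarrow> a * \<bar>f t\<bar> \<le> N f" using N_lower by metis
  have "g t \<le> 1 / a^2" if "g \<in> C0 T" "0 \<le> g t" "N g \<le> sqrt (g t)" for g t
  proof -
    have "a * g t \<le> sqrt (g t)" using a(2)[OF that(1), of t] that by simp
    then have "(a * g t)^2 \<le> (sqrt (g t))^2" using a(1) that(2) by (intro power_mono) auto
    then have "a^2 * (g t * g t) \<le> g t" using that(2) by (simp add: power2_eq_square algebra_simps)
    then have "g t \<noteq> 0 \<Longrightarrow> a^2 * g t \<le> 1" using that(2)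
      by (metis less_eq_real_def mult.left_commute mult.right_neutral mult_le_cancel_left_pos mult.commute)
    then show ?thesis using a(1) by (cases "g t = 0") (auto simp: field_simps)
  qed
  then show ?thesis using that by blast
qed

context
  fixes t u assumes t: "t \<in> T" and u: "u \<in> seg t" and IH: "\<And>w. w \<in> below u \<Longrightarrow> good t w"
begin

lemma below_seg: "w \<in> below u \<Longrightarrow> w \<in> seg t"
  using u by (auto simp: below_def mem_seg)

lemma bdd_climb_below: "bdd_above (insert 0 (climb t ` below u))"
proof -
  obtain c where c: "\<And>g t. g \<in> C0 T \<Longrightarrow> 0 \<le> g t \<Longrightarrow> N g \<le> sqrt (g t) \<Longrightarrow> g t \<le> c"
    using height_bound by metis
  have "climb t w \<le> c" if w: "w \<in> below u" for w
  proof -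
    have "plat (seg w) t (climb t) (climb t w) w = climb t w"
      using w by (simp add: plat_def mem_seg below_def)
    then show ?thesis
      using c[of "plat (seg w) t (climb t) (climb t w)" w] IH[OF w] unfolding good_def by simp
  qed
  then show ?thesis by (intro bdd_aboveI[of _ "max 0 c"]) (auto intro: le_max_iff_disj[THEN iffD2])
qed

lemma base_nonneg: "0 \<le> base (climb t) u"
  unfolding base_def using bdd_climb_below by (intro cSup_upper) auto

lemma le_base: "w \<in> below u \<Longrightarrow> climb t w \<le> base (climb t) u"
  unfolding base_def using bdd_climb_below by (intro cSup_upper) auto

text \<open>The limit step of the recursion. The plateaus built at \<open>w\<close> before
  \<open>u\<close> converge uniformly to the plateau of height \<open>base (climb t) u\<close> as
  their heights approach this supremum, and membership in \<open>C0 T\<close> and the norm equation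
  survive the limit.\<close>

lemma plat_base:
  shows "plat (below u) t (climb t) (base (climb t) u) \<in> C0 T" (is "?H \<in> _")
    and "N (plat (below u) t (climb t) (base (climb t) u)) = sqrt (base (climb t) u)"
proof -
  let ?f = "climb t" and ?s = "base (climb t) u"
  have "?H \<in> C0 T \<and> N ?H = sqrt ?s"
  proof (cases "below u = {}")
    case True
    then have "?H = (\<lambda>_. 0)" "?s = 0" by (auto simp: plat_def base_def)
    then show ?thesis using zero_C0 N_zero by simp
  next
    case False
    have approx: "\<exists>w\<in>below u. ?s - e < ?f w" if "e > 0" for e
    proof -
      have "?s - e < Sup (insert 0 (?f ` below u))" using that by (simp add: base_def)
      then obtain x where x: "x \<in> insert 0 (?f ` below u)" "?s - e < x"
        using less_cSup_iff[OF _ bdd_climb_below, of "?s - e"] by blast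
      show ?thesis
      proof (cases "x = 0")
        case True
        obtain w where "w \<in> below u" using False by blast
        then show ?thesis using IH[of w] x(2) True unfolding good_def by force
      qed (use x in auto)
    qed
    let ?F = "\<lambda>w. plat (seg w) t ?f (?f w)"
    \<comment> \<open>Up to \<open>w\<close> the two functions coincide. Further on inside
      \<open>seg t\<close> both lie between \<open>?f w\<close> and \<open>?s\<close>, and outside
      \<open>seg t\<close> both are 0.\<close>
    have close: "\<bar>?H z - ?F w z\<bar> \<le> e" if w: "w \<in> below u" "?s - e < ?f w" for w e z
    proof -
      have ws: "?f w \<le> ?s" using le_base[OF w(1)] .
      consider "z \<in> seg w" | "z \<notin> seg w" "z \<in> below u" | "z \<notin> below u" "z \<notin> seg w" by blast
      then show ?thesis
      proof cases
        case 1
        then have "z \<in> below u" using w(1) by (auto simp: below_def mem_seg)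
        then show ?thesis using 1 ws w(2) by (simp add: plat_def)
      next
        case 2
        have zt: "z \<in> seg t" "w \<in> seg t" using 2 w below_seg by auto
        then have "w < z" using seg_linear[OF t zt] 2(1) by (auto simp: mem_seg less_le)
        then have "?f w \<le> ?f z"
          using IH[OF 2(2)] w(1) unfolding good_def by (auto simp: below_def)
        then show ?thesis using 2 zt le_base[OF 2(2)] w(2) by (simp add: plat_def)
      next
        case 3
        then show ?thesis using ws w(2) by (simp add: plat_def)
      qed
    qed
    have HC: "?H \<in> C0 T"
    proof (rule C0_uniform_limit)
      fix e :: real assume "e > 0"
      then obtain w where "w \<in> below u" "?s - e < ?f w" using approx by blast
      then show "\<exists>g\<in>C0 T. \<forall>z. \<bar>?H z - g z\<bar> \<le> e"
        using close IH unfolding good_def by (intro bexI[of _ "?F w"]) auto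
    qed
    obtain b where b: "b > 0"
      "\<And>f g e. f \<in> C0 T \<Longrightarrow> g \<in> C0 T \<Longrightarrow> (\<And>t. \<bar>f t - g t\<bar> \<le> e) \<Longrightarrow> \<bar>N f - N g\<bar> \<le> b * e"
      using N_lipschitz by metis
    have "\<bar>N ?H - sqrt ?s\<bar> \<le> b * e + sqrt e" if e: "e > 0" for e
    proof -
      obtain w where w: "w \<in> below u" "?s - e < ?f w" using approx[OF e] by blast
      have "\<bar>N ?H - N (?F w)\<bar> \<le> b * e"
        using b(2)[OF HC _ close[OF w]] IH[OF w(1)] unfolding good_def by blast
      moreover have "N (?F w) = sqrt (?f w)" "0 \<le> ?f w" using IH[OF w(1)] unfolding good_def by auto
      moreover have "sqrt (?f w) \<le> sqrt ?s" using le_base[OF w(1)] by simp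
      moreover have "sqrt ?s \<le> sqrt (?f w) + sqrt e"
      proof -
        have "sqrt ?s \<le> sqrt (?f w + e)" using w(2) by simp
        also have "\<dots> \<le> sqrt (?f w) + sqrt e"
          using \<open>0 \<le> ?f w\<close> e by (intro sqrt_add_le_add_sqrt) auto
        finally show ?thesis .
      qed
      ultimately show ?thesis by linarith
    qed
    then have "\<bar>N ?H - sqrt ?s\<bar> \<le> 0" by (rule le_zero_if_le_modulus)
    then show ?thesis using HC by simp
  qed
  then show "?H \<in> C0 T" "N ?H = sqrt ?s" by auto
qed

lemma plat_C0:
  assumes "below u \<in> lowers u"
  shows "plat (below u) t (climb t) y \<in> C0 T" "cutoff (below u) (climb t) \<in> C0 T"
proof -
  let ?s = "base (climb t) u"
  have low: "below u \<in> lowers t" using below_lowers[OF assms u] .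
  then have "cutoff (below u) (plat (below u) t (climb t) ?s) \<in> C0 T"
    using plat_base(1) lowers_pieces by (intro C0_cut) auto
  moreover have "cutoff (below u) (plat (below u) t (climb t) ?s) = cutoff (below u) (climb t)"
    by (auto simp: plat_def)
  ultimately show 1: "cutoff (below u) (climb t) \<in> C0 T" by simp
  have "plat (below u) t (climb t) y =
      (\<lambda>w. cutoff (below u) (climb t) w + y * indicator (seg t - below u) w)"
    by (auto simp: plat_def)
  then show "plat (below u) t (climb t) y \<in> C0 T"
    using C0_add[OF 1 C0_scale[OF indicator_diff_C0[OF t low]]] by simp
qed

text \<open>The admissible heights form a closed bounded set, since the norm is Lipschitz in the
  height, so the supremum is attained. If the inequality were strict there, continuity would admit a
  slightly larger height; this yields the equation that keeps the recursion going.\<close>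

lemma climb_jump:
  assumes "jump (climb t) u"
  shows "climb t u \<in> heights t (climb t) u"
    and "\<And>y. y \<in> heights t (climb t) u \<Longrightarrow> y \<le> climb t u"
    and "N (plat (below u) t (climb t) (climb t u)) = sqrt (climb t u)"
proof -
  let ?f = "climb t" and ?s = "base (climb t) u"
  let ?h = "\<lambda>y. N (plat (below u) t ?f y)" and ?Y = "heights t ?f u"
  have low: "below u \<in> lowers u" using assms by (simp add: jump_def)
  note C = plat_C0(1)[OF low]
  obtain b where b: "b > 0"
      "\<And>f g e. f \<in> C0 T \<Longrightarrow> g \<in> C0 T \<Longrightarrow> (\<And>t. \<bar>f t - g t\<bar> \<le> e) \<Longrightarrow> \<bar>N f - N g\<bar> \<le> b * e"
    using N_lipschitz by metis
  have "b-lipschitz_on UNIV ?h"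
  proof (rule lipschitz_onI)
    fix x y
    have "\<bar>?h x - ?h y\<bar> \<le> b * \<bar>x - y\<bar>"
      by (intro b(2) C) (auto simp: plat_def)
    then show "dist (?h x) (?h y) \<le> b * dist x y" by (simp add: dist_real_def)
  qed (use b in simp)
  then have cont: "continuous_on UNIV ?h" by (rule lipschitz_on_continuous_on)
  have sY: "?s \<in> ?Y" using plat_base(2) by (simp add: heights_def)
  have uH: "plat (below u) t ?f y u = y" for y using u by (simp add: plat_def below_def)
  obtain c where c: "\<And>g t. g \<in> C0 T \<Longrightarrow> 0 \<le> g t \<Longrightarrow> N g \<le> sqrt (g t) \<Longrightarrow> g t \<le> c"
    using height_bound by metis
  have bd: "bdd_above ?Y"
  proof (rule bdd_aboveI)
    fix y assume "y \<in> ?Y"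
    then show "y \<le> c" using c[OF C[of y], of u] uH[of y] base_nonneg by (auto simp: heights_def)
  qed
  have "closed ?Y"
    unfolding heights_def Collect_conj_eq
    by (intro closed_Int closed_Collect_le continuous_intros cont)
  then have mem: "Sup ?Y \<in> ?Y" using sY bd by (intro closed_contains_Sup) auto
  have eq: "?f u = Sup ?Y" using climb_unfold[of u t] u assms by (simp add: rise_def mem_seg)
  show "?f u \<in> ?Y" using mem eq by simp
  show ub: "y \<le> ?f u" if "y \<in> ?Y" for y using that bd eq cSup_upper by metis
  have le: "?h (?f u) \<le> sqrt (?f u)" and ge: "?s \<le> ?f u" using mem eq by (auto simp: heights_def)
  show "?h (?f u) = sqrt (?f u)"
  proof (rule ccontr)
    assume "?h (?f u) \<noteq> sqrt (?f u)"
    then have pos: "0 < sqrt (?f u) - ?h (?f u)" using le by simp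
    have "((\<lambda>y. sqrt y - ?h y) \<longlongrightarrow> sqrt (?f u) - ?h (?f u)) (at_right (?f u))"
      using cont by (intro tendsto_intros) (auto simp: continuous_on_def intro: tendsto_within_subset)
    then have "\<forall>\<^sub>F y in at_right (?f u). 0 < sqrt y - ?h y"
      using pos by (rule order_tendstoD)
    moreover have "\<forall>\<^sub>F y in at_right (?f u). ?f u < y" by (rule eventually_at_right_less)
    ultimately obtain y where "0 < sqrt y - ?h y" "?f u < y"
      using eventually_happens'[OF _ eventually_conj] by (metis (mono_tags, lifting) trivial_limit_at_right_real)
    then show False using ub[of y] ge by (simp add: heights_def)
  qed
qed

lemma good_step: "good t u"
proof -
  have main: "base (climb t) u \<le> climb t u \<and> plat (below u) t (climb t) (climb t u) \<in> C0 T \<and>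
      N (plat (below u) t (climb t) (climb t u)) = sqrt (climb t u)"
  proof (cases "jump (climb t) u")
    case True
    then show ?thesis
      using climb_jump[OF True] plat_C0 by (auto simp: heights_def jump_def)
  next
    case False
    then have "climb t u = base (climb t) u"
      using climb_unfold[of u t] u by (simp add: rise_def mem_seg)
    then show ?thesis using plat_base by simp
  qed
  then show ?thesis
    using main base_nonneg le_base plat_seg[OF u] unfolding good_def by fastforce
qed

end

lemma good: "t \<in> T \<Longrightarrow> u \<in> seg t \<Longrightarrow> good t u"
proof -
  assume t: "t \<in> T" "u \<in> seg t"
  then have "u \<in> T" by (simp add: mem_seg)
  then have "u \<in> seg t \<longrightarrow> good t u"
  proof (induction u rule: tree_induct)
    case (less u)
    show ?case
    proof
      assume u: "u \<in> seg t"
      show "good t u"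
        by (rule good_step[OF t(1) u]) (use less u in \<open>auto simp: below_def mem_seg\<close>)
    qed
  qed
  then show ?thesis using t by blast
qed

lemma good_below: "t \<in> T \<Longrightarrow> u \<in> seg t \<Longrightarrow> w \<in> below u \<Longrightarrow> good t w"
  by (rule good) (auto simp: below_def mem_seg)

lemma climb_mono:
  assumes "t \<in> T" "u \<in> seg t" "w \<in> T" "w \<le> u"
  shows "climb t w \<le> climb t u"
proof (cases "w = u")
  case False
  then have "w \<in> below u" using assms by (simp add: below_def less_le)
  then show ?thesis using good[OF assms(1,2)] by (simp add: good_def)
qed simp

definition profile :: "'a \<Rightarrow> real set" where
  "profile t = climb t ` seg t"

lemma plat_top: "plat (seg t) t g y = cutoff (seg t) g"
  by (auto simp: plat_def)

lemma compact_wo_profile: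
  assumes t: "t \<in> T"
  shows "compact_wo (profile t)"
  unfolding compact_wo_def
proof (intro conjI allI impI)
  have tt: "t \<in> seg t" using t by (simp add: mem_seg)
  then show "profile t \<noteq> {}" by (auto simp: profile_def)
  have "cutoff (seg t) (climb t) \<in> C0 T"
    using good[OF t tt] by (simp add: good_def plat_top)
  from compact_image_seg[OF this t] show "compact (profile t)"
    by (simp add: profile_def cong: image_cong)
  fix S assume S: "S \<subseteq> profile t" "S \<noteq> {}"
  then have "{u \<in> seg t. climb t u \<in> S} \<noteq> {}" by (auto simp: profile_def)
  then obtain m where m: "m \<in> {u \<in> seg t. climb t u \<in> S}" "\<And>x. x \<in> {u \<in> seg t. climb t u \<in> S} \<Longrightarrow> m \<le> x"
    using seg_least[OF t, of "{u \<in> seg t. climb t u \<in> S}"] by blast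
  have "climb t m \<le> x" if x: "x \<in> S" for x
  proof -
    obtain u where "u \<in> seg t" "x = climb t u" using x S by (auto simp: profile_def)
    then show ?thesis using climb_mono[OF t, of u m] m x by (auto simp: mem_seg)
  qed
  then show "\<exists>m\<in>S. \<forall>x\<in>S. m \<le> x" using m(1) by blast
qed

end

locale smooth_normed_tree = lattice_normed_tree +
  assumes smooth: "gateaux_smooth (C0 T) N"
begin

text \<open>The norm is constant on the segment between the two functions compared in \<open>jump\<close>, so its derivative
  in the direction of the remaining piece vanishes, whereas the square root has positive slope.\<close>

lemma jump_strict:
  assumes t: "t \<in> T" and u: "u \<in> seg t" and jump: "jump (climb t) u"
  shows "base (climb t) u < climb t u"
proof -
  note IH = good_below[OF t u]
  let ?f = "climb t" and ?s = "base (climb t) u"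
  let ?g = "cutoff (below u) (climb t)" and ?H = "\<lambda>y. plat (below u) t (climb t) y"
  let ?B = "indicator (seg t - below u) :: 'a \<Rightarrow> real"
  have low: "below u \<in> lowers u" and Ng: "N ?g = sqrt ?s" using jump by (auto simp: jump_def)
  have C: "?H y \<in> C0 T" and gC: "?g \<in> C0 T" for y using plat_C0[OF t u IH low] by auto
  have s0: "0 \<le> ?s" using base_nonneg[OF t u IH] .
  have HN: "N (?H ?s) = sqrt ?s" using plat_base(2)[OF t u IH] .
  have f0: "0 \<le> ?f w" "?f w \<le> ?s" if "w \<in> below u" for w
    using IH[OF that] le_base[OF t u IH that] by (auto simp: good_def)
  have "\<exists>y>?s. N (?H y) \<le> sqrt y"
  proof (cases "?s = 0")
    \<comment> \<open>Nothing has risen yet and the norm has no derivative at the zero function.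
      Instead, the plateau of height \<open>y\<close> has norm at most \<open>b * y\<close>, which
      equals \<open>sqrt y\<close> for \<open>y = 1 / b^2\<close>.\<close>
    case True
    obtain b where b: "b > 0" "\<And>f e. f \<in> C0 T \<Longrightarrow> (\<And>t. \<bar>f t\<bar> \<le> e) \<Longrightarrow> N f \<le> b * e"
      using N_upper by metis
    have "?f w = 0" if "w \<in> below u" for w using f0[OF that] True by simp
    then have "N (?H (1 / b^2)) \<le> b * (1 / b^2)" using b(1) by (intro b(2) C) (auto simp: plat_def)
    also have "\<dots> = sqrt (1 / b^2)" using b(1) by (simp add: real_sqrt_divide power2_eq_square)
    finally show ?thesis using True b(1) by (intro exI[of _ "1 / b^2"]) auto
  next
    case False
    then have s: "0 < ?s" using s0 by simp
    have ne: "?H ?s \<noteq> (\<lambda>_. 0)" using HN s N_zero by auto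
    have BC: "?B \<in> C0 T" using indicator_diff_C0[OF t below_lowers[OF low u]] .
    have shift: "(\<lambda>i. ?H ?s i + l * ?B i) = ?H (?s + l)" for l by (auto simp: plat_def)
    obtain D where "((\<lambda>l. (N (\<lambda>i. ?H ?s i + l * ?B i) - N (?H ?s)) / l) \<longlongrightarrow> D) (at 0)"
      using smooth C ne BC unfolding gateaux_smooth_def by blast
    then have lim: "((\<lambda>l. (N (?H (?s + l)) - sqrt ?s) / l) \<longlongrightarrow> D) (at 0)"
      unfolding shift HN .
    have const: "N (?H (?s + l)) = sqrt ?s" if "- ?s < l" "l < 0" for l
    proof -
      have "N ?g \<le> N (?H (?s + l))"
        by (rule N_mono[OF gC C]) (auto simp: plat_def)
      moreover have "N (?H (?s + l)) \<le> N (?H ?s)"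
        by (rule N_mono[OF C C]) (use that in \<open>auto simp: plat_def\<close>)
      ultimately show ?thesis using Ng HN by simp
    qed
    have "((\<lambda>l. (N (?H (?s + l)) - sqrt ?s) / l) \<longlongrightarrow> D) (at_left 0)"
      using lim filterlim_at_split by blast
    moreover have "((\<lambda>l. (N (?H (?s + l)) - sqrt ?s) / l) \<longlongrightarrow> 0) (at_left 0)"
    proof (rule tendsto_eventually)
      have "\<forall>\<^sub>F l in at_left 0. l \<in> {- ?s<..<0}"
        using s by (intro eventually_at_left_real) simp
      then show "\<forall>\<^sub>F l in at_left 0. (N (?H (?s + l)) - sqrt ?s) / l = 0"
        by (rule eventually_mono) (simp add: const)
    qed
    ultimately have "D = 0" using tendsto_unique trivial_limit_at_left_real by blast
    \<comment> \<open>The derivative is two-sided: constancy on the left makes it 0, and this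
      controls the norm to the right, where larger heights are sought.\<close>
    then have R: "((\<lambda>l. (N (?H (?s + l)) - sqrt ?s) / l) \<longlongrightarrow> 0) (at_right 0)"
      using lim filterlim_at_split by blast
    have "(sqrt has_real_derivative inverse (sqrt ?s) / 2) (at ?s)"
      using s by (rule DERIV_real_sqrt)
    then have "((\<lambda>l. (sqrt (?s + l) - sqrt ?s) / l) \<longlongrightarrow> inverse (sqrt ?s) / 2) (at 0)"
      by (simp add: DERIV_def)
    then have "((\<lambda>l. (sqrt (?s + l) - sqrt ?s) / l) \<longlongrightarrow> inverse (sqrt ?s) / 2) (at_right 0)"
      using filterlim_at_split by blast
    from tendsto_diff[OF this R]
    have "((\<lambda>l. (sqrt (?s + l) - sqrt ?s) / l - (N (?H (?s + l)) - sqrt ?s) / l) \<longlongrightarrow> inverse (sqrt ?s) / 2) (at_right 0)"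
      by simp
    then have "\<forall>\<^sub>F l in at_right 0. 0 < (sqrt (?s + l) - sqrt ?s) / l - (N (?H (?s + l)) - sqrt ?s) / l"
      by (rule order_tendstoD(1)) (use s in simp)
    moreover have "\<forall>\<^sub>F l in at_right 0. (0::real) < l" by (rule eventually_at_right_less)
    ultimately have "\<forall>\<^sub>F l in at_right 0. N (?H (?s + l)) < sqrt (?s + l) \<and> 0 < l"
      by (rule eventually_elim2) (simp add: diff_divide_distrib[symmetric] zero_less_divide_iff)
    then obtain l where "N (?H (?s + l)) < sqrt (?s + l)" "0 < l"
      using eventually_happens' trivial_limit_at_right_real by blast
    then show ?thesis by (intro exI[of _ "?s + l"]) auto
  qed
  then obtain y where "?s < y" "y \<in> heights t ?f u" by (auto simp: heights_def)
  then show ?thesis using climb_jump(2)[OF t u IH jump] by force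
qed

text \<open>The new element of the larger set is \<open>climb t u\<close>. By \<open>gap\<close> all
  values strictly before \<open>u\<close> are smaller than it, and by monotonicity all values from
  \<open>u\<close> on are not.\<close>

lemma lex_less_profileI:
  assumes t: "t \<in> T" and u: "u \<in> seg t" and gap: "base (climb t) u < climb t u"
    and K: "K \<inter> {..<climb t u} = climb t ` below u" "climb t u \<notin> K"
  shows "lex_less K (profile t)"
proof -
  have "profile t \<inter> {..<climb t u} = climb t ` below u"
  proof (intro equalityI subsetI)
    fix x assume x: "x \<in> profile t \<inter> {..<climb t u}"
    then obtain w where w: "w \<in> seg t" "x = climb t w" by (auto simp: profile_def)
    have "\<not> u \<le> w" using climb_mono[OF t w(1), of u] x w u by (auto simp: mem_seg)
    then have "w \<in> below u" using seg_linear[OF t w(1) u] w(1) by (auto simp: below_def mem_seg less_le)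
    then show "x \<in> climb t ` below u" using w(2) by blast
  next
    fix x assume "x \<in> climb t ` below u"
    then obtain w where w: "w \<in> below u" "x = climb t w" by blast
    then have "w \<in> seg t" using below_seg[OF t u good_below[OF t u]] by blast
    moreover have "climb t w < climb t u" using le_base[OF t u good_below[OF t u] w(1)] gap by simp
    ultimately show "x \<in> profile t \<inter> {..<climb t u}" using w by (auto simp: profile_def)
  qed
  then show ?thesis
    using K u unfolding lex_less_def by (intro bexI[of _ "climb t u"]) (auto simp: profile_def)
qed

lemma profile_lex_less:
  assumes s: "s \<in> T" and t: "t \<in> T" and st: "s < t"
  shows "lex_less (profile s) (profile t)"
proof (cases "\<exists>u\<in>seg s. climb s u \<noteq> climb t u")
  case True
  let ?D = "{u \<in> seg s. climb s u \<noteq> climb t u}"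
  have "?D \<noteq> {}" using True by blast
  then obtain u where u: "u \<in> ?D" "\<And>w. w \<in> ?D \<Longrightarrow> u \<le> w"
    using seg_least[OF s, of ?D] by blast
  have us: "u \<in> seg s" and ut: "u \<in> seg t" using u(1) st by (auto simp: mem_seg)
  have eq: "climb s w = climb t w" if "w \<in> below u" for w
  proof (rule ccontr)
    assume "climb s w \<noteq> climb t w"
    moreover have "w \<in> seg s" using that us by (auto simp: below_def mem_seg)
    ultimately have "u \<le> w" using u(2) by blast
    then show False using that by (auto simp: below_def)
  qed
  note cong = below_cong[of u "climb s" "climb t", OF eq]
  have uT: "u \<in> T" using us by (simp add: mem_seg)
  \<comment> \<open>Away from jumps the value is the base, which depends only on earlier values. So
    the first disagreement must occur at a jump.\<close>
  have jump: "jump (climb t) u"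
  proof (rule ccontr)
    assume "\<not> jump (climb t) u"
    then have "climb s u = climb t u"
      using climb_unfold[OF uT] cong(2,3) by (simp add: rise_def)
    then show False using u(1) by simp
  qed
  then have jumps: "jump (climb s) u" using cong(3) by simp
  have gap: "base (climb t) u < climb t u" using jump_strict[OF t ut jump] .
  have low: "below u \<in> lowers u" using jump by (simp add: jump_def)
  \<comment> \<open>Below \<open>u\<close> both climbs agree and \<open>seg s\<close> is contained
    in \<open>seg t\<close>, so the lattice property compares the two plateaus: a height admissible
    for \<open>t\<close> is admissible for \<open>s\<close>.\<close>
  have "climb t u \<in> heights s (climb s) u"
  proof -
    have "N (plat (below u) s (climb s) (climb t u)) \<le> N (plat (below u) t (climb t) (climb t u))"
    proof (rule N_mono)
      show "plat (below u) s (climb s) (climb t u) \<in> C0 T"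
        using plat_C0(1)[OF s us good_below[OF s us] low] .
      show "plat (below u) t (climb t) (climb t u) \<in> C0 T"
        using plat_C0(1)[OF t ut good_below[OF t ut] low] .
      show "\<bar>plat (below u) s (climb s) (climb t u) z\<bar> \<le> \<bar>plat (below u) t (climb t) (climb t u) z\<bar>" for z
        using st eq by (auto simp: plat_def mem_seg)
    qed
    then show ?thesis
      using climb_jump(1)[OF t ut good_below[OF t ut] jump] cong(2) by (simp add: heights_def)
  qed
  then have "climb t u \<le> climb s u"
    using climb_jump(2)[OF s us good_below[OF s us] jumps] by blast
  then have lt: "climb t u < climb s u" using u(1) by auto
  have hi: "climb t u < climb s w" if "w \<in> seg s" "u \<le> w" for w
    using climb_mono[OF s that(1) uT that(2)] lt by simp
  have lo: "climb s w < climb t u" if "w \<in> below u" for w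
    using le_base[OF t ut good_below[OF t ut] that] gap eq[OF that] by simp
  have split: "w \<in> below u \<or> u \<le> w" if "w \<in> seg s" for w
    using seg_linear[OF s that us] that by (auto simp: below_def mem_seg less_le)
  have sub: "below u \<subseteq> seg s" using us by (auto simp: below_def mem_seg)
  show ?thesis
  proof (rule lex_less_profileI[OF t ut gap])
    show "climb t u \<notin> profile s"
      using hi lo split unfolding profile_def by (metis imageE less_irrefl)
    have "profile s \<inter> {..<climb t u} = climb s ` below u"
    proof (intro equalityI subsetI)
      fix x assume "x \<in> profile s \<inter> {..<climb t u}"
      then obtain w where w: "w \<in> seg s" "x = climb s w" "climb s w < climb t u"
        by (auto simp: profile_def)
      then have "w \<in> below u" using split[OF w(1)] hi[OF w(1)] by force
      then show "x \<in> climb s ` below u" using w(2) by blast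
    qed (use sub lo in \<open>auto simp: profile_def\<close>)
    also have "\<dots> = climb t ` below u" using eq by (rule image_cong[OF refl])
    finally show "profile s \<inter> {..<climb t u} = climb t ` below u" .
  qed
next
  \<comment> \<open>Here \<open>climb t\<close> extends \<open>climb s\<close>. The next node
    \<open>u\<close> after \<open>s\<close> on the way to \<open>t\<close> is a jump, because what
    has been built up to \<open>s\<close> has norm exactly \<open>sqrt (climb s s)\<close>. The
    value at \<open>u\<close> is therefore a new element above all of
    \<open>profile s\<close>.\<close>
  case False
  then have eq: "climb s w = climb t w" if "w \<in> seg s" for w using that by blast
  have "seg t - seg s \<noteq> {}" using st t by (auto simp: mem_seg)
  then obtain u where u: "u \<in> seg t - seg s" "\<And>w. w \<in> seg t - seg s \<Longrightarrow> u \<le> w"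
    using seg_least[OF t, of "seg t - seg s"] by blast
  have ut: "u \<in> seg t" using u(1) by blast
  have stt: "s \<in> seg t" using s st by (simp add: mem_seg)
  have su: "s < u"
    using seg_linear[OF t ut stt] u(1) by (auto simp: mem_seg less_le)
  have bel: "below u = seg s"
  proof (intro equalityI subsetI)
    fix w assume w: "w \<in> below u"
    then have "w \<in> seg t" using ut by (auto simp: below_def mem_seg)
    moreover have "\<not> u \<le> w" using w by (auto simp: below_def)
    ultimately show "w \<in> seg s" using u(2)[of w] by blast
  qed (use su in \<open>auto simp: below_def mem_seg\<close>)
  have ss: "s \<in> seg s" using s by (simp add: mem_seg)
  have top: "base (climb t) u = climb s s"
  proof -
    have "climb t ` below u = climb s ` seg s" using bel eq by auto
    moreover have "Sup (insert 0 (climb s ` seg s)) = climb s s"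
      using ss climb_mono[OF s ss] good[OF s ss]
      by (intro cSup_eq_maximum) (auto simp: mem_seg good_def)
    ultimately show ?thesis by (simp add: base_def)
  qed
  have "cutoff (seg s) (climb t) = cutoff (seg s) (climb s)" using eq by auto
  moreover have "N (cutoff (seg s) (climb s)) = sqrt (climb s s)"
    using good[OF s ss] by (simp add: good_def plat_top)
  ultimately have jump: "jump (climb t) u"
    unfolding jump_def bel using top s su by (simp add: seg_lowers)
  note gap = jump_strict[OF t ut jump]
  have le: "x \<le> climb s s" if "x \<in> profile s" for x
    using that climb_mono[OF s ss] by (auto simp: profile_def mem_seg)
  show ?thesis
  proof (rule lex_less_profileI[OF t ut gap])
    show "climb t u \<notin> profile s" using le gap top by force
    have "profile s \<inter> {..<climb t u} = profile s" using le gap top by force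
    also have "\<dots> = climb t ` below u" unfolding profile_def bel using eq by (rule image_cong[OF refl])
    finally show "profile s \<inter> {..<climb t u} = climb t ` below u" .
  qed
qed

lemma strict_mono_to_Y: "strict_mono_on T (\<lambda>t. to_Y (profile t))"
  by (intro strict_mono_onI to_Y_less compact_wo_profile profile_lex_less)

end

section \<open>The dual space as a space of atomic measures\<close>

lemma eq_zero_if_abs_le_mult:
  fixes x K :: real
  assumes "\<And>e. e > 0 \<Longrightarrow> \<bar>x\<bar> \<le> K * e"
  shows "x = 0"
proof (rule ccontr)
  assume "x \<noteq> 0"
  then have "\<bar>x\<bar> / (2 * (\<bar>K\<bar> + 1)) > 0" by (intro divide_pos_pos) auto
  from assms[OF this] have "\<bar>x\<bar> \<le> K * (\<bar>x\<bar> / (2 * (\<bar>K\<bar> + 1)))" .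
  also have "\<dots> \<le> (\<bar>K\<bar> + 1) * (\<bar>x\<bar> / (2 * (\<bar>K\<bar> + 1)))" by (intro mult_right_mono) auto
  also have "\<dots> = \<bar>x\<bar> / 2" by (simp add: field_simps)
  finally show False using \<open>x \<noteq> 0\<close> by simp
qed

lemma abs_summable_tail:
  fixes g :: "'b \<Rightarrow> real"
  assumes "(\<lambda>x. \<bar>g x\<bar>) summable_on S" "e > 0"
  obtains F where "finite F" "F \<subseteq> S" "\<And>B. B \<subseteq> S - F \<Longrightarrow> (\<Sum>\<^sub>\<infinity>x\<in>B. \<bar>g x\<bar>) \<le> e"
proof -
  obtain F where F: "finite F" "F \<subseteq> S" "dist (\<Sum>x\<in>F. \<bar>g x\<bar>) (\<Sum>\<^sub>\<infinity>x\<in>S. \<bar>g x\<bar>) \<le> e"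
    using infsum_finite_approximation[OF assms] by blast
  have "(\<Sum>\<^sub>\<infinity>x\<in>B. \<bar>g x\<bar>) \<le> e" if B: "B \<subseteq> S - F" for B
  proof -
    have s: "(\<lambda>x. \<bar>g x\<bar>) summable_on C" if "C \<subseteq> S" for C
      using summable_on_subset_banach[OF assms(1) that] .
    have BS: "B \<subseteq> S" "F \<union> B \<subseteq> S" "F \<inter> B = {}" using B F(2) by auto
    have "(\<Sum>x\<in>F. \<bar>g x\<bar>) + (\<Sum>\<^sub>\<infinity>x\<in>B. \<bar>g x\<bar>) = (\<Sum>\<^sub>\<infinity>x\<in>F \<union> B. \<bar>g x\<bar>)"
      using infsum_Un_disjoint[OF s[OF F(2)] s[OF BS(1)] BS(3)] F(1) by simp
    also have "\<dots> \<le> (\<Sum>\<^sub>\<infinity>x\<in>S. \<bar>g x\<bar>)"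
      by (rule infsum_mono_neutral[OF s[OF BS(2)] assms(1)]) (use BS(2) in auto)
    finally show ?thesis using F(3) by (simp add: dist_real_def)
  qed
  then show ?thesis using that F by blast
qed

lemma abs_infsum_le:
  fixes g :: "'b \<Rightarrow> real"
  assumes "(\<lambda>x. \<bar>g x\<bar>) summable_on S"
  shows "\<bar>\<Sum>\<^sub>\<infinity>x\<in>S. g x\<bar> \<le> (\<Sum>\<^sub>\<infinity>x\<in>S. \<bar>g x\<bar>)"
  using norm_infsum_bound[of g S] assms by (simp add: real_norm_def)

lemma abs_summable_real:
  fixes g :: "'b \<Rightarrow> real"
  assumes "(\<lambda>x. \<bar>g x\<bar>) summable_on S"
  shows "g summable_on S"
  using abs_summable_summable[of g S] assms by simp

lemma abs_summable_mult:
  fixes g :: "'b \<Rightarrow> real"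
  assumes "(\<lambda>x. \<bar>g x\<bar>) summable_on S" "\<And>x. \<bar>h x\<bar> \<le> M"
  shows "(\<lambda>x. \<bar>g x * h x\<bar>) summable_on S" "(\<Sum>\<^sub>\<infinity>x\<in>S. \<bar>g x * h x\<bar>) \<le> M * (\<Sum>\<^sub>\<infinity>x\<in>S. \<bar>g x\<bar>)"
proof -
  have s: "(\<lambda>x. M * \<bar>g x\<bar>) summable_on S" using assms(1) by (rule summable_on_cmult_right)
  have le: "\<bar>g x * h x\<bar> \<le> M * \<bar>g x\<bar>" for x
    using mult_left_mono[OF assms(2)[of x], of "\<bar>g x\<bar>"] by (simp add: abs_mult mult.commute)
  show 1: "(\<lambda>x. \<bar>g x * h x\<bar>) summable_on S"
    by (rule summable_on_comparison_test[OF s]) (use le in auto)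
  have "(\<Sum>\<^sub>\<infinity>x\<in>S. \<bar>g x * h x\<bar>) \<le> (\<Sum>\<^sub>\<infinity>x\<in>S. M * \<bar>g x\<bar>)"
    by (rule infsum_mono[OF 1 s le])
  then show "(\<Sum>\<^sub>\<infinity>x\<in>S. \<bar>g x * h x\<bar>) \<le> M * (\<Sum>\<^sub>\<infinity>x\<in>S. \<bar>g x\<bar>)"
    by (simp add: infsum_cmult_right')
qed

context order_tree
begin

text \<open>Convergence along this filter is convergence over the shrinking neighbourhoods
  \<open>seg t - A\<close> of \<open>t\<close>. If \<open>t\<close> is isolated, there is a largest
  \<open>A\<close>, and the limit is the value at it.\<close>

definition at_low :: "'a \<Rightarrow> 'a set filter" where
  "at_low t = (INF A\<in>lowers t. principal {B \<in> lowers t. A \<subseteq> B})"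

lemma eventually_at_low:
  assumes "t \<in> T"
  shows "eventually P (at_low t) \<longleftrightarrow> (\<exists>A\<in>lowers t. \<forall>B\<in>lowers t. A \<subseteq> B \<longrightarrow> P B)"
  unfolding at_low_def
proof (subst eventually_INF_base)
  show "lowers t \<noteq> {}" using empty_lowers by blast
  fix A B assume "A \<in> lowers t" "B \<in> lowers t"
  then show "\<exists>C\<in>lowers t. principal {B \<in> lowers t. C \<subseteq> B} \<le>
      inf (principal {C \<in> lowers t. A \<subseteq> C}) (principal {C \<in> lowers t. B \<subseteq> C})"
    using lowers_Un[OF assms] by (intro bexI[of _ "A \<union> B"]) auto
qed (auto simp: eventually_principal)

lemma eventually_at_low_ge:
  assumes "t \<in> T" "A \<in> lowers t"
  shows "\<forall>\<^sub>F B in at_low t. B \<in> lowers t \<and> A \<subseteq> B"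
  using assms by (auto simp: eventually_at_low)

lemma at_low_nonbot:
  assumes "t \<in> T"
  shows "at_low t \<noteq> bot"
  using eventually_at_low[OF assms, of "\<lambda>_. False"] by (auto simp: trivial_limit_def)

lemma eventually_at_low_obtain:
  assumes "t \<in> T" "eventually P (at_low t)"
  obtains A where "A \<in> lowers t" "P A"
  using assms by (auto simp: eventually_at_low)

lemma at_low_absorb:
  assumes t: "t \<in> T" and F: "finite F" "\<And>s. s \<in> F \<Longrightarrow> s \<in> T \<and> s < t"
  shows "\<forall>\<^sub>F A in at_low t. F \<subseteq> A"
proof -
  have "\<forall>\<^sub>F A in at_low t. s \<in> A" if "s \<in> F" for s
    by (rule eventually_mono[OF eventually_at_low_ge[OF t seg_lowers]])
       (use F(2)[OF that] in \<open>auto simp: mem_seg\<close>)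
  then have "\<forall>\<^sub>F A in at_low t. \<forall>s\<in>F. s \<in> A" using F(1) by (intro eventually_ball_finite) auto
  then show ?thesis by (rule eventually_mono) blast
qed

text \<open>Of two distinct points at least one is not below the other, and its neighbourhood can
  avoid the segment of the other. Finitely many such demands, together with \<open>P\<close>, hold
  eventually along \<open>at_low\<close>.\<close>

lemma disjoint_neighbourhoods:
  assumes F: "finite F" "F \<subseteq> T" and P: "\<And>t. t \<in> F \<Longrightarrow> eventually (P t) (at_low t)"
  obtains A where "\<And>t. t \<in> F \<Longrightarrow> A t \<in> lowers t" "\<And>t. t \<in> F \<Longrightarrow> P t (A t)"
    "\<And>t t'. t \<in> F \<Longrightarrow> t' \<in> F \<Longrightarrow> t \<noteq> t' \<Longrightarrow> (seg t - A t) \<inter> (seg t' - A t') = {}"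
proof -
  have "\<exists>A. A \<in> lowers t \<and> P t A \<and> (\<forall>t'\<in>F. \<not> t \<le> t' \<longrightarrow> seg t \<inter> seg t' \<subseteq> A)" if t: "t \<in> F" for t
  proof -
    have tT: "t \<in> T" using t F by blast
    have "\<forall>\<^sub>F A in at_low t. \<not> t \<le> t' \<longrightarrow> seg t \<inter> seg t' \<subseteq> A" if "t' \<in> F" for t'
    proof (cases "t \<le> t'")
      case False
      then have "seg t \<inter> seg t' \<in> lowers t" using seg_Int_lowers tT that F by blast
      from eventually_at_low_ge[OF tT this] show ?thesis by (rule eventually_mono) simp
    qed simp
    then have "\<forall>\<^sub>F A in at_low t. \<forall>t'\<in>F. \<not> t \<le> t' \<longrightarrow> seg t \<inter> seg t' \<subseteq> A"
      using F(1) by (intro eventually_ball_finite) auto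
    with P[OF t] have "\<forall>\<^sub>F A in at_low t. P t A \<and> (\<forall>t'\<in>F. \<not> t \<le> t' \<longrightarrow> seg t \<inter> seg t' \<subseteq> A)"
      by (rule eventually_conj)
    then obtain A where "A \<in> lowers t" "P t A \<and> (\<forall>t'\<in>F. \<not> t \<le> t' \<longrightarrow> seg t \<inter> seg t' \<subseteq> A)"
      by (rule eventually_at_low_obtain[OF tT])
    then show ?thesis by blast
  qed
  then obtain A where A: "\<And>t. t \<in> F \<Longrightarrow> A t \<in> lowers t \<and> P t (A t) \<and>
      (\<forall>t'\<in>F. \<not> t \<le> t' \<longrightarrow> seg t \<inter> seg t' \<subseteq> A t)"
    by metis
  have disj: "(seg t - A t) \<inter> (seg t' - A t') = {}" if "t \<in> F" "t' \<in> F" "t \<noteq> t'" for t t'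
  proof -
    have "\<not> t \<le> t' \<or> \<not> t' \<le> t" using that(3) by auto
    moreover have "seg t \<inter> seg t' \<subseteq> A t" if "\<not> t \<le> t'" using A[OF \<open>t \<in> F\<close>] \<open>t' \<in> F\<close> that by blast
    moreover have "seg t' \<inter> seg t \<subseteq> A t'" if "\<not> t' \<le> t" using A[OF \<open>t' \<in> F\<close>] \<open>t \<in> F\<close> that by blast
    ultimately show ?thesis by blast
  qed
  show ?thesis by (rule that[of A]) (use A disj in blast)+
qed

abbreviation nbhd_ind :: "'a \<Rightarrow> 'a set \<Rightarrow> 'a \<Rightarrow> real" where
  "nbhd_ind t A \<equiv> indicator (seg t - A)"

text \<open>The mass of the atom at \<open>t\<close> of the measure representing \<open>\<phi>\<close>.\<close>

definition mass :: "(('a \<Rightarrow> real) \<Rightarrow> real) \<Rightarrow> 'a \<Rightarrow> real" where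
  "mass \<phi> t = (if t \<in> T then Lim (at_low t) (\<lambda>A. \<phi> (nbhd_ind t A)) else 0)"

abbreviation dual :: "(('a \<Rightarrow> real) \<Rightarrow> real) set" where
  "dual \<equiv> dual_space (C0 T) sup_norm"

lemma dual_add: "\<phi> \<in> dual \<Longrightarrow> f \<in> C0 T \<Longrightarrow> g \<in> C0 T \<Longrightarrow> \<phi> (\<lambda>t. f t + g t) = \<phi> f + \<phi> g"
  by (simp add: dual_space_def)

lemma dual_scale: "\<phi> \<in> dual \<Longrightarrow> f \<in> C0 T \<Longrightarrow> \<phi> (\<lambda>t. c * f t) = c * \<phi> f"
  by (simp add: dual_space_def)

lemma dual_diff:
  assumes "\<phi> \<in> dual" "f \<in> C0 T" "g \<in> C0 T"
  shows "\<phi> (\<lambda>t. f t - g t) = \<phi> f - \<phi> g"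
  using dual_add[OF assms(1,2) C0_scale[OF assms(3), of "-1"]] dual_scale[OF assms(1,3), of "-1"] by simp

lemma dual_sum:
  assumes "\<phi> \<in> dual" "finite F" "\<And>i. i \<in> F \<Longrightarrow> f i \<in> C0 T"
  shows "\<phi> (\<lambda>t. \<Sum>i\<in>F. c i * f i t) = (\<Sum>i\<in>F. c i * \<phi> (f i))"
  using assms(2,3)
proof (induction F rule: finite_induct)
  case empty
  then show ?case using dual_scale[OF assms(1) zero_C0, of 0] by simp
next
  case (insert i F)
  have "(\<lambda>t. \<Sum>i\<in>F. c i * f i t) \<in> C0 T"
    using insert by (intro C0_sum C0_scale) auto
  then show ?case using insert dual_add[OF assms(1) C0_scale] dual_scale[OF assms(1)] by simp
qed

lemma dual_bound:
  assumes "\<phi> \<in> dual"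
  obtains K where "K \<ge> 0" "\<And>f M. f \<in> C0 T \<Longrightarrow> (\<And>t. \<bar>f t\<bar> \<le> M) \<Longrightarrow> \<bar>\<phi> f\<bar> \<le> K * M"
proof -
  obtain K where K: "\<And>f. f \<in> C0 T \<Longrightarrow> \<bar>\<phi> f\<bar> \<le> K * sup_norm f"
    using assms unfolding dual_space_def by blast
  have "\<bar>\<phi> f\<bar> \<le> \<bar>K\<bar> * M" if f: "f \<in> C0 T" "\<And>t. \<bar>f t\<bar> \<le> M" for f M
  proof -
    have "K * sup_norm f \<le> \<bar>K\<bar> * sup_norm f" using sup_norm_nonneg[OF f(1)] by (intro mult_right_mono) auto
    also have "\<dots> \<le> \<bar>K\<bar> * M" using sup_norm_le[OF f(2)] by (intro mult_left_mono) auto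
    finally show ?thesis using K[OF f(1)] by simp
  qed
  then show ?thesis using that[of "\<bar>K\<bar>"] by simp
qed

context
  fixes \<phi> assumes \<phi>: "\<phi> \<in> dual"
begin

lemma nbhd_ind_diff:
  assumes "t \<in> T" "A \<in> lowers t" "B \<in> lowers t" "A \<subseteq> B"
  shows "\<phi> (nbhd_ind t A) - \<phi> (nbhd_ind t B) = \<phi> (indicator (B - A))"
    "(indicator (B - A) :: 'a \<Rightarrow> real) \<in> C0 T"
proof -
  have "(indicator (B - A) :: 'a \<Rightarrow> real) = (\<lambda>s. nbhd_ind t A s - nbhd_ind t B s)"
    using lowers_subset[OF assms(3)] assms(4) by (fastforce simp: indicator_def)
  then show "\<phi> (nbhd_ind t A) - \<phi> (nbhd_ind t B) = \<phi> (indicator (B - A))"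
    "(indicator (B - A) :: 'a \<Rightarrow> real) \<in> C0 T"
    using dual_diff[OF \<phi>] C0_diff indicator_diff_C0 assms by auto
qed

text \<open>Otherwise there are infinitely many disjoint open and closed pieces below
  \<open>t\<close> on whose indicators the functional is at least \<open>e\<close> in absolute
  value. The sum of \<open>n\<close> of them with suitable signs has sup norm at most 1 but value at
  least \<open>n * e\<close>.\<close>

lemma lowers_Cauchy:
  assumes t: "t \<in> T" and e: "e > 0"
  shows "\<exists>A\<in>lowers t. \<forall>B\<in>lowers t. A \<subseteq> B \<longrightarrow> \<bar>\<phi> (indicator (B - A))\<bar> < e"
proof (rule ccontr)
  assume "\<not> ?thesis"
  then have "\<forall>A\<in>lowers t. \<exists>B\<in>lowers t. A \<subseteq> B \<and> e \<le> \<bar>\<phi> (indicator (B - A))\<bar>"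
    by (meson linorder_not_le)
  then have "\<exists>A. \<forall>n. A n \<in> lowers t \<and> A n \<subseteq> A (Suc n) \<and> e \<le> \<bar>\<phi> (indicator (A (Suc n) - A n))\<bar>"
    by (intro dependent_nat_choice) (use empty_lowers in blast)+
  then obtain A where A: "\<And>n. A n \<in> lowers t" "\<And>n. A n \<subseteq> A (Suc n)"
      "\<And>n. e \<le> \<bar>\<phi> (indicator (A (Suc n) - A n))\<bar>"
    by blast
  let ?I = "\<lambda>n. indicator (A (Suc n) - A n) :: 'a \<Rightarrow> real"
  let ?c = "\<lambda>n. sgn (\<phi> (?I n))"
  have IC: "?I n \<in> C0 T" for n using nbhd_ind_diff(2)[OF t A(1) A(1) A(2)] .
  \<comment> \<open>The second conjunct carries the induction: the sum so far lives on
    \<open>A n\<close>, and the next piece is disjoint from \<open>A n\<close>.\<close>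
  have small: "\<bar>\<Sum>k<n. ?c k * ?I k s\<bar> \<le> 1 \<and> (s \<notin> A n \<longrightarrow> (\<Sum>k<n. ?c k * ?I k s) = 0)" for n s
  proof (induction n)
    case (Suc n)
    show ?case
    proof (cases "s \<in> A n")
      case True
      then have "s \<in> A (Suc n)" using A(2) by blast
      then show ?thesis using Suc True by simp
    next
      case False
      then show ?thesis using Suc by (auto simp: indicator_def abs_sgn_eq)
    qed
  qed simp
  obtain K where K: "\<And>f M. f \<in> C0 T \<Longrightarrow> (\<And>t. \<bar>f t\<bar> \<le> M) \<Longrightarrow> \<bar>\<phi> f\<bar> \<le> K * M"
    using dual_bound[OF \<phi>] by metis
  have "of_nat n * e \<le> K" for n
  proof -
    have "of_nat n * e = (\<Sum>k<n. e)" by simp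
    also have "\<dots> \<le> (\<Sum>k<n. ?c k * \<phi> (?I k))"
      using A(3) by (intro sum_mono) (simp add: sgn_mult_self_eq mult.commute abs_sgn)
    also have "\<dots> = \<phi> (\<lambda>s. \<Sum>k<n. ?c k * ?I k s)"
      using IC by (intro dual_sum[OF \<phi>, symmetric]) auto
    also have "\<dots> \<le> \<bar>\<phi> (\<lambda>s. \<Sum>k<n. ?c k * ?I k s)\<bar>" by (rule abs_ge_self)
    also have "\<dots> \<le> K * 1"
    proof (rule K)
      show "(\<lambda>s. \<Sum>k<n. ?c k * ?I k s) \<in> C0 T" by (intro C0_sum C0_scale IC) simp
      show "\<bar>\<Sum>k<n. ?c k * ?I k s\<bar> \<le> 1" for s using small by blast
    qed
    finally show ?thesis by simp
  qed
  moreover obtain n where "K < of_nat n * e" using reals_Archimedean3[OF e] by blast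
  ultimately show False by (meson linorder_not_le)
qed

text \<open>The filter need not have a countable base, but a sequence of Cauchy thresholds
  \<open>A n\<close> determines the limit, since beyond \<open>A n\<close> all values are within
  \<open>1 / (n + 1)\<close> of the value at \<open>A n\<close>.\<close>

lemma mass_tendsto:
  assumes t: "t \<in> T"
  shows "((\<lambda>A. \<phi> (nbhd_ind t A)) \<longlongrightarrow> mass \<phi> t) (at_low t)"
proof -
  have "\<forall>n. \<exists>A\<in>lowers t. \<forall>B\<in>lowers t. A \<subseteq> B \<longrightarrow> \<bar>\<phi> (indicator (B - A))\<bar> < inverse (real (Suc n))"
    using lowers_Cauchy[OF t] by simp
  then obtain A where A: "\<And>n. A n \<in> lowers t"
      "\<And>n B. B \<in> lowers t \<Longrightarrow> A n \<subseteq> B \<Longrightarrow> \<bar>\<phi> (indicator (B - A n))\<bar> < inverse (real (Suc n))"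
    by metis
  let ?x = "\<lambda>A. \<phi> (nbhd_ind t A)"
  have near: "\<bar>?x B - ?x (A n)\<bar> < inverse (real (Suc n))" if "B \<in> lowers t" "A n \<subseteq> B" for n B
    using A(2)[OF that] nbhd_ind_diff(1)[OF t A(1) that] by (simp add: abs_minus_commute)
  \<comment> \<open>The thresholds need not increase with \<open>n\<close>, but any two are
    comparable, and the smaller one gives the estimate.\<close>
  have near2: "\<bar>?x (A m) - ?x (A n)\<bar> < inverse (real (Suc n))" if "n \<le> m" for m n
  proof (cases "A n \<subseteq> A m")
    case False
    then have "A m \<subseteq> A n" using lowers_chain[OF t A(1) A(1)] by blast
    then have "\<bar>?x (A n) - ?x (A m)\<bar> < inverse (real (Suc m))" using near A(1) by blast
    also have "\<dots> \<le> inverse (real (Suc n))" using that by (intro le_imp_inverse_le) auto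
    finally show ?thesis by (simp add: abs_minus_commute)
  qed (use near A(1) in blast)
  have "Cauchy (\<lambda>n. ?x (A n))"
  proof (rule metric_CauchyI)
    fix e :: real assume "e > 0"
    then obtain N where N: "inverse (real (Suc N)) < e / 2" using reals_Archimedean[of "e/2"] by auto
    have "dist (?x (A m)) (?x (A n)) < e" if "m \<ge> N" "n \<ge> N" for m n
      using near2[OF that(1)] near2[OF that(2)] N unfolding dist_real_def by linarith
    then show "\<exists>N. \<forall>m\<ge>N. \<forall>n\<ge>N. dist (?x (A m)) (?x (A n)) < e" by blast
  qed
  then obtain v where v: "(\<lambda>n. ?x (A n)) \<longlonglongrightarrow> v"
    using Cauchy_convergent convergent_def by blast
  have "(?x \<longlongrightarrow> v) (at_low t)"
  proof (rule tendstoI)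
    fix e :: real assume e: "e > 0"
    then obtain N where N: "inverse (real (Suc N)) < e / 2" using reals_Archimedean[of "e/2"] by auto
    obtain M where M: "\<And>n. n \<ge> M \<Longrightarrow> dist (?x (A n)) v < e / 2"
      using v e unfolding lim_sequentially by (meson half_gt_zero)
    let ?n = "max N M"
    have "inverse (real (Suc ?n)) \<le> inverse (real (Suc N))" by (intro le_imp_inverse_le) auto
    then have "dist (?x B) v < e" if "B \<in> lowers t" "A ?n \<subseteq> B" for B
      using near[OF that] M[of ?n] N unfolding dist_real_def by linarith
    then show "\<forall>\<^sub>F B in at_low t. dist (?x B) v < e"
      by (intro eventually_mono[OF eventually_at_low_ge[OF t A(1)[of ?n]]]) simp
  qed
  moreover from this have "mass \<phi> t = v"
    using tendsto_Lim[OF at_low_nonbot[OF t]] t by (simp add: mass_def)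
  ultimately show ?thesis by simp
qed

text \<open>On small disjoint neighbourhoods of the points of \<open>F\<close> the function
  \<open>f\<close> takes the constant values \<open>L t - d\<close>, cut at 0, with the sign of the
  mass. Lower semicontinuity at those points keeps \<open>f\<close> below \<open>L\<close>, and the
  definition of the mass makes \<phi> almost additive over the atoms.\<close>

lemma test_function:
  assumes F: "finite F" "F \<subseteq> T" and L0: "\<And>t. 0 \<le> L t" and e: "e > 0"
    and lsc: "\<And>t d. t \<in> F \<Longrightarrow> d > 0 \<Longrightarrow> \<exists>A\<in>lowers t. \<forall>s\<in>seg t - A. L t - d \<le> L s"
  obtains f where "f \<in> C0 T" "\<And>s. \<bar>f s\<bar> \<le> L s" "(\<Sum>t\<in>F. \<bar>mass \<phi> t\<bar> * L t) - e \<le> \<phi> f"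
proof -
  \<comment> \<open>The error at \<open>t\<close> is at most \<open>d\<close> times
    \<open>\<bar>mass \<phi> t\<bar> + L t\<close>; \<open>C\<close> bounds the sum of these
    factors, and the summand 1 keeps it positive.\<close>
  define C where "C = 1 + (\<Sum>t\<in>F. \<bar>mass \<phi> t\<bar>) + (\<Sum>t\<in>F. L t)"
  have C: "C > 0" unfolding C_def using L0 by (intro add_pos_nonneg sum_nonneg) auto
  define d where "d = e / C"
  have d: "d > 0" using C e by (simp add: d_def)
  have "\<forall>\<^sub>F A in at_low t. (\<forall>s\<in>seg t - A. L t - d \<le> L s) \<and> \<bar>\<phi> (nbhd_ind t A) - mass \<phi> t\<bar> < d"
    if t: "t \<in> F" for t
  proof (rule eventually_conj)
    have tT: "t \<in> T" using t F by blast
    obtain A where A: "A \<in> lowers t" "\<forall>s\<in>seg t - A. L t - d \<le> L s" using lsc[OF t d] by blast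
    show "\<forall>\<^sub>F A in at_low t. \<forall>s\<in>seg t - A. L t - d \<le> L s"
      by (rule eventually_mono[OF eventually_at_low_ge[OF tT A(1)]]) (use A(2) in blast)
    show "\<forall>\<^sub>F A in at_low t. \<bar>\<phi> (nbhd_ind t A) - mass \<phi> t\<bar> < d"
      using tendstoD[OF mass_tendsto[OF tT] d] by (simp add: dist_real_def)
  qed
  from disjoint_neighbourhoods[OF F this] obtain A where A: "\<And>t. t \<in> F \<Longrightarrow> A t \<in> lowers t"
    "\<And>t. t \<in> F \<Longrightarrow> (\<forall>s\<in>seg t - A t. L t - d \<le> L s) \<and> \<bar>\<phi> (nbhd_ind t (A t)) - mass \<phi> t\<bar> < d"
    "\<And>t t'. t \<in> F \<Longrightarrow> t' \<in> F \<Longrightarrow> t \<noteq> t' \<Longrightarrow> (seg t - A t) \<inter> (seg t' - A t') = {}"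
    by blast
  define c where "c t = sgn (mass \<phi> t) * max 0 (L t - d)" for t
  define f where "f s = (\<Sum>t\<in>F. c t * nbhd_ind t (A t) s)" for s
  have IC: "nbhd_ind t (A t) \<in> C0 T" if "t \<in> F" for t
    using indicator_diff_C0 A(1)[OF that] that F by blast
  have "f \<in> C0 T"
    unfolding f_def using IC F by (intro C0_sum C0_scale) auto
  moreover have "\<bar>f s\<bar> \<le> L s" for s
  proof (cases "\<exists>t\<in>F. s \<in> seg t - A t")
    case True
    then obtain t where t: "t \<in> F" "s \<in> seg t - A t" by blast
    have "f s = (\<Sum>r\<in>{t}. c r * nbhd_ind r (A r) s)"
      unfolding f_def
    proof (rule sum.mono_neutral_right)
      show "\<forall>r\<in>F - {t}. c r * nbhd_ind r (A r) s = 0"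
        using A(3) t by (fastforce simp: indicator_def)
    qed (use t F in auto)
    then have "f s = c t * nbhd_ind t (A t) s" by (simp only: sum.insert sum.empty finite.emptyI empty_iff not_False_eq_True add_0_right)
    then have "\<bar>f s\<bar> = \<bar>c t\<bar>" using t(2) by (simp add: indicator_def)
    also have "\<dots> \<le> max 0 (L t - d)" by (simp add: c_def abs_mult sgn_if)
    also have "\<dots> \<le> L s" using A(2)[OF t(1)] t(2) L0[of s] by simp
    finally show ?thesis .
  next
    case False
    then have "f s = 0" unfolding f_def by (intro sum.neutral) (auto simp: indicator_def)
    then show ?thesis using L0 by simp
  qed
  moreover have "(\<Sum>t\<in>F. \<bar>mass \<phi> t\<bar> * L t) - e \<le> \<phi> f"
  proof -
    have bound: "\<bar>mass \<phi> t\<bar> * L t - d * (\<bar>mass \<phi> t\<bar> + L t) \<le> c t * \<phi> (nbhd_ind t (A t))"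
      if t: "t \<in> F" for t
    proof -
      let ?m = "mass \<phi> t" and ?p = "\<phi> (nbhd_ind t (A t))" and ?k = "max 0 (L t - d)"
      have k: "L t - d \<le> ?k" "0 \<le> ?k" "?k \<le> L t" using d L0[of t] by auto
      have "\<bar>c t * (?p - ?m)\<bar> \<le> L t * d"
        unfolding abs_mult using A(2)[OF t] k L0[of t]
        by (intro mult_mono) (auto simp: c_def abs_mult sgn_if)
      then have "c t * ?m - L t * d \<le> c t * ?p" by (simp add: right_diff_distrib abs_le_iff)
      moreover have "c t * ?m = ?k * \<bar>?m\<bar>" by (simp add: c_def sgn_if)
      moreover have "(L t - d) * \<bar>?m\<bar> \<le> ?k * \<bar>?m\<bar>" using k(1) by (intro mult_right_mono) auto
      ultimately show ?thesis by (simp add: algebra_simps)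
    qed
    have "d * (\<Sum>t\<in>F. \<bar>mass \<phi> t\<bar> + L t) \<le> d * C"
      unfolding C_def using d by (intro mult_left_mono) (auto simp: sum.distrib)
    also have "\<dots> = e" using C by (simp add: d_def)
    finally have "(\<Sum>t\<in>F. \<bar>mass \<phi> t\<bar> * L t) - e \<le> (\<Sum>t\<in>F. \<bar>mass \<phi> t\<bar> * L t - d * (\<bar>mass \<phi> t\<bar> + L t))"
      by (simp add: sum_subtractf sum_distrib_left)
    also have "\<dots> \<le> (\<Sum>t\<in>F. c t * \<phi> (nbhd_ind t (A t)))" using bound by (rule sum_mono)
    also have "\<dots> = \<phi> f"
      unfolding f_def using IC F by (intro dual_sum[OF \<phi>, symmetric]) auto
    finally show ?thesis .
  qed
  ultimately show ?thesis by (rule that)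
qed

text \<open>Test functions below the constant 1 bound every finite partial sum by
  \<open>K + 1\<close>, with \<open>K\<close> a bound for \<phi>.\<close>

lemma mass_summable: "(\<lambda>t. \<bar>mass \<phi> t\<bar>) summable_on UNIV"
proof -
  obtain K where K: "\<And>f M. f \<in> C0 T \<Longrightarrow> (\<And>t. \<bar>f t\<bar> \<le> M) \<Longrightarrow> \<bar>\<phi> f\<bar> \<le> K * M"
    using dual_bound[OF \<phi>] by metis
  have "(\<Sum>t\<in>F. \<bar>mass \<phi> t\<bar>) \<le> K + 1" if F: "finite F" for F
  proof -
    have "(\<Sum>t\<in>F. \<bar>mass \<phi> t\<bar>) = (\<Sum>t\<in>F \<inter> T. \<bar>mass \<phi> t\<bar> * 1)"
      using F by (intro sum.mono_neutral_cong_right) (auto simp: mass_def)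
    moreover have "\<exists>A\<in>lowers t. \<forall>s\<in>seg t - A. (1::real) - d \<le> 1" if "d > 0" for t d
      using that by (intro bexI[of _ "{}"]) auto
    then obtain f where f: "f \<in> C0 T" "\<And>s. \<bar>f s\<bar> \<le> 1"
        "(\<Sum>t\<in>F \<inter> T. \<bar>mass \<phi> t\<bar> * 1) - 1 \<le> \<phi> f"
      using test_function[of "F \<inter> T" "\<lambda>_. 1" 1] F by (metis Int_lower2 finite_Int zero_le_one zero_less_one)
    moreover have "\<bar>\<phi> f\<bar> \<le> K * 1" using f(1,2) by (rule K)
    ultimately show ?thesis by linarith
  qed
  then show ?thesis
    by (intro nonneg_bdd_above_summable_on bdd_aboveI[of _ "K + 1"]) auto
qed

lemma mass_summable_on: "(\<lambda>t. \<bar>mass \<phi> t\<bar>) summable_on S"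
  using summable_on_subset_banach[OF mass_summable] by blast

text \<open>No mass escapes at limits: along \<open>at_low t\<close> the sums over the lower sets
  tend to the sum over \<open>seg t - {t}\<close> by summability, and by induction and the
  definition of the mass they also tend to \<phi> of the indicator minus the mass at
  \<open>t\<close>.\<close>

lemma infsum_mass_seg:
  assumes "t \<in> T"
  shows "(\<Sum>\<^sub>\<infinity>s\<in>seg t. mass \<phi> s) = \<phi> (indicator (seg t))"
  using assms
proof (induction t rule: tree_induct)
  case (less t)
  note t = less.hyps
  have "(indicator {} :: 'a \<Rightarrow> real) = (\<lambda>_. 0)" by auto
  then have zero: "\<phi> (indicator {}) = 0" using dual_scale[OF \<phi> zero_C0, of 0] by simp
  have IH: "(\<Sum>\<^sub>\<infinity>s\<in>A. mass \<phi> s) = \<phi> (indicator A)" if "A \<in> lowers t" for A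
    using that by (cases rule: lowers_cases) (use less zero in auto)
  have sm: "mass \<phi> summable_on S" for S using abs_summable_real[OF mass_summable_on] .
  let ?S = "seg t - {t}"
  have "((\<lambda>A. \<Sum>\<^sub>\<infinity>s\<in>A. mass \<phi> s) \<longlongrightarrow> (\<Sum>\<^sub>\<infinity>s\<in>?S. mass \<phi> s)) (at_low t)"
  proof (rule tendstoI)
    fix e :: real assume e: "e > 0"
    then have "e / 2 > 0" by simp
    from abs_summable_tail[OF mass_summable_on this] obtain F where
      F: "finite F" "F \<subseteq> ?S" "\<And>B. B \<subseteq> ?S - F \<Longrightarrow> (\<Sum>\<^sub>\<infinity>x\<in>B. \<bar>mass \<phi> x\<bar>) \<le> e / 2"
      by blast
    have "\<forall>\<^sub>F A in at_low t. F \<subseteq> A"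
      using F(2) by (intro at_low_absorb[OF t F(1)]) (auto simp: mem_seg less_le)
    moreover have "\<forall>\<^sub>F A in at_low t. A \<in> lowers t"
      using eventually_at_low_ge[OF t empty_lowers] by (rule eventually_mono) simp
    ultimately show "\<forall>\<^sub>F A in at_low t. dist (\<Sum>\<^sub>\<infinity>s\<in>A. mass \<phi> s) (\<Sum>\<^sub>\<infinity>s\<in>?S. mass \<phi> s) < e"
    proof (rule eventually_elim2)
      fix A assume A: "F \<subseteq> A" "A \<in> lowers t"
      have "A \<subseteq> ?S" using lowers_subset not_mem_lowers A(2) by blast
      then have "?S = A \<union> (?S - A)" by blast
      then have "(\<Sum>\<^sub>\<infinity>s\<in>?S. mass \<phi> s) = (\<Sum>\<^sub>\<infinity>s\<in>A. mass \<phi> s) + (\<Sum>\<^sub>\<infinity>s\<in>?S - A. mass \<phi> s)"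
        using infsum_Un_disjoint[OF sm sm, of A "?S - A"] by simp
      moreover have "\<bar>\<Sum>\<^sub>\<infinity>s\<in>?S - A. mass \<phi> s\<bar> \<le> e / 2"
        using abs_infsum_le[OF mass_summable_on] F(3)[of "?S - A"] A(1) by (meson Diff_mono order_refl order_trans)
      ultimately show "dist (\<Sum>\<^sub>\<infinity>s\<in>A. mass \<phi> s) (\<Sum>\<^sub>\<infinity>s\<in>?S. mass \<phi> s) < e"
        using e by (simp add: dist_real_def)
    qed
  qed
  moreover have "((\<lambda>A. \<Sum>\<^sub>\<infinity>s\<in>A. mass \<phi> s) \<longlongrightarrow> \<phi> (indicator (seg t)) - mass \<phi> t) (at_low t)"
  proof (rule Lim_transform_eventually)
    show "((\<lambda>A. \<phi> (indicator (seg t)) - \<phi> (nbhd_ind t A)) \<longlongrightarrow> \<phi> (indicator (seg t)) - mass \<phi> t) (at_low t)"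
      by (intro tendsto_intros mass_tendsto[OF t])
    show "\<forall>\<^sub>F A in at_low t. \<phi> (indicator (seg t)) - \<phi> (nbhd_ind t A) = (\<Sum>\<^sub>\<infinity>s\<in>A. mass \<phi> s)"
      using eventually_at_low_ge[OF t empty_lowers]
    proof (rule eventually_mono)
      fix A assume "A \<in> lowers t \<and> {} \<subseteq> A"
      then show "\<phi> (indicator (seg t)) - \<phi> (nbhd_ind t A) = (\<Sum>\<^sub>\<infinity>s\<in>A. mass \<phi> s)"
        using nbhd_ind_diff(1)[OF t empty_lowers, of A] IH by simp
    qed
  qed
  ultimately have "(\<Sum>\<^sub>\<infinity>s\<in>?S. mass \<phi> s) = \<phi> (indicator (seg t)) - mass \<phi> t"
    using tendsto_unique[OF at_low_nonbot[OF t]] by blast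
  moreover have "seg t = insert t ?S" using t by (auto simp: mem_seg)
  then have "(\<Sum>\<^sub>\<infinity>s\<in>seg t. mass \<phi> s) = mass \<phi> t + (\<Sum>\<^sub>\<infinity>s\<in>?S. mass \<phi> s)"
    using infsum_insert[OF sm, of t ?S] by simp
  ultimately show ?case by simp
qed

text \<open>The part of \<phi> that its atoms do not account for. It is linear and bounded, and is
  shown to vanish on indicators of pieces, then on functions cut to a segment, to finitely many
  segments, and finally everywhere.\<close>

definition defect :: "('a \<Rightarrow> real) \<Rightarrow> real" where
  "defect f = \<phi> f - (\<Sum>\<^sub>\<infinity>t. mass \<phi> t * f t)"

lemma mass_mult_summable: "f \<in> C0 T \<Longrightarrow> (\<lambda>t. \<bar>mass \<phi> t * f t\<bar>) summable_on S"
  using C0_bounded abs_summable_mult(1)[OF mass_summable_on] by metis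

lemma defect_add:
  assumes "f \<in> C0 T" "g \<in> C0 T"
  shows "defect (\<lambda>t. f t + g t) = defect f + defect g"
proof -
  have "(\<Sum>\<^sub>\<infinity>t. mass \<phi> t * (f t + g t)) = (\<Sum>\<^sub>\<infinity>t. mass \<phi> t * f t) + (\<Sum>\<^sub>\<infinity>t. mass \<phi> t * g t)"
    using infsum_add[OF abs_summable_real abs_summable_real, OF mass_mult_summable mass_mult_summable] assms
    by (simp add: distrib_left)
  then show ?thesis using dual_add[OF \<phi> assms] by (simp add: defect_def)
qed

lemma defect_scale:
  assumes "f \<in> C0 T"
  shows "defect (\<lambda>t. c * f t) = c * defect f"
proof -
  have "(\<Sum>\<^sub>\<infinity>t. mass \<phi> t * (c * f t)) = c * (\<Sum>\<^sub>\<infinity>t. mass \<phi> t * f t)"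
    by (simp add: infsum_cmult_right'[symmetric] mult.left_commute)
  then show ?thesis using dual_scale[OF \<phi> assms] by (simp add: defect_def right_diff_distrib)
qed

lemma defect_diff:
  assumes "f \<in> C0 T" "g \<in> C0 T"
  shows "defect (\<lambda>t. f t - g t) = defect f - defect g"
  using defect_add[OF assms(1) C0_scale[OF assms(2), of "-1"]] defect_scale[OF assms(2), of "-1"] by simp

lemma defect_bound:
  obtains K where "\<And>f M. f \<in> C0 T \<Longrightarrow> (\<And>t. \<bar>f t\<bar> \<le> M) \<Longrightarrow> \<bar>defect f\<bar> \<le> K * M"
proof -
  obtain K where K: "\<And>f M. f \<in> C0 T \<Longrightarrow> (\<And>t. \<bar>f t\<bar> \<le> M) \<Longrightarrow> \<bar>\<phi> f\<bar> \<le> K * M"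
    using dual_bound[OF \<phi>] by metis
  let ?V = "\<Sum>\<^sub>\<infinity>t. \<bar>mass \<phi> t\<bar>"
  have "\<bar>defect f\<bar> \<le> (K + ?V) * M" if f: "f \<in> C0 T" "\<And>t. \<bar>f t\<bar> \<le> M" for f M
  proof -
    have "\<bar>\<Sum>\<^sub>\<infinity>t. mass \<phi> t * f t\<bar> \<le> M * ?V"
      using abs_infsum_le[OF mass_mult_summable[OF f(1)]] abs_summable_mult(2)[OF mass_summable f(2)]
      by (rule order_trans)
    then show ?thesis using K[OF f] unfolding defect_def by (simp add: algebra_simps abs_le_iff)
  qed
  then show ?thesis by (rule that)
qed

text \<open>Near \<open>t\<close> the function is almost constant. So up to \<open>e\<close> it is
  its restriction to some \<open>A \<in> lowers t\<close>, settled by induction, plus a multiple of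
  the indicator of \<open>seg t - A\<close>.\<close>

lemma defect_seg:
  assumes "t \<in> T" "f \<in> C0 T"
  shows "defect (cutoff (seg t) f) = 0"
  using assms
proof (induction t arbitrary: f rule: tree_induct)
  case (less t)
  note t = less.hyps and f = less.prems
  have zero: "defect (\<lambda>_. 0) = 0" using defect_scale[OF zero_C0, of 0] by simp
  obtain K where K: "\<And>f M. f \<in> C0 T \<Longrightarrow> (\<And>t. \<bar>f t\<bar> \<le> M) \<Longrightarrow> \<bar>defect f\<bar> \<le> K * M"
    using defect_bound by metis
  have ind: "defect (indicator A) = 0" if "A \<in> pieces" for A
  proof (cases "A = {}")
    case False
    then have "A \<in> seg ` T" using \<open>A \<in> pieces\<close> by (simp add: pieces_def)
    then obtain s where s: "s \<in> T" "A = seg s" by blast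
    have "(\<Sum>\<^sub>\<infinity>t. mass \<phi> t * indicator A t) = (\<Sum>\<^sub>\<infinity>t\<in>A. mass \<phi> t)"
      by (rule infsum_cong_neutral) (auto simp: indicator_def)
    then show ?thesis using infsum_mass_seg s by (simp add: defect_def)
  next
    case True
    then have "(indicator A :: 'a \<Rightarrow> real) = (\<lambda>_. 0)" by auto
    then show ?thesis using zero by simp
  qed
  have seg: "seg t \<in> pieces" using t by (rule seg_pieces)
  show ?case
  proof (rule eq_zero_if_abs_le_mult)
    fix e :: real assume e: "e > 0"
    from C0_cont[OF f t e] obtain A where A: "A \<in> lowers t" "\<And>s. s \<in> seg t - A \<Longrightarrow> \<bar>f s - f t\<bar> < e"
      by blast
    note AP = lowers_pieces[OF A(1)]
    let ?g = "\<lambda>s. cutoff A f s + f t * nbhd_ind t A s"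
    have nC: "nbhd_ind t A \<in> C0 T" using indicator_diff_C0[OF t A(1)] .
    have gC: "?g \<in> C0 T" by (intro C0_add C0_scale nC C0_cut[OF f AP])
    have "nbhd_ind t A = (\<lambda>s. indicator (seg t) s - indicator A s)"
      using lowers_subset[OF A(1)] by (fastforce simp: indicator_def)
    then have "defect (nbhd_ind t A) = 0"
      using defect_diff[OF indicator_C0[OF seg] indicator_C0[OF AP]] ind[OF seg] ind[OF AP] by simp
    moreover have "defect (cutoff A f) = 0"
      using A(1) by (cases rule: lowers_cases) (use zero less.IH f in auto)
    ultimately have "defect ?g = 0"
      using defect_add[OF C0_cut[OF f AP] C0_scale[OF nC]] defect_scale[OF nC] by simp
    moreover have "\<bar>defect (\<lambda>s. cutoff (seg t) f s - ?g s)\<bar> \<le> K * e"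
    proof (rule K)
      show "(\<lambda>s. cutoff (seg t) f s - ?g s) \<in> C0 T" by (intro C0_diff gC C0_cut[OF f seg])
      show "\<bar>cutoff (seg t) f s - ?g s\<bar> \<le> e" for s
        using A(2)[of s] lowers_subset[OF A(1)] e
        by (cases "s \<in> A"; cases "s \<in> seg t") (auto intro: less_imp_le)
    qed
    ultimately show "\<bar>defect (cutoff (seg t) f)\<bar> \<le> K * e"
      using defect_diff[OF C0_cut[OF f seg] gC] by simp
  qed
qed

text \<open>A new segment is added by inclusion and exclusion. Its intersection with the old union
  is a single piece, since the members of \<open>lowers t\<close> form a chain.\<close>

lemma defect_Union_seg:
  assumes "finite F" "F \<subseteq> T" "f \<in> C0 T"
  shows "cutoff (\<Union>u\<in>F. seg u) f \<in> C0 T \<and> defect (cutoff (\<Union>u\<in>F. seg u) f) = 0"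
  using assms
proof (induction F rule: finite_induct)
  case empty
  then show ?case using zero_C0 defect_scale[OF zero_C0, of 0] by simp
next
  case (insert t F)
  let ?W = "\<Union>u\<in>F. seg u"
  have t: "t \<in> T" using insert.prems by simp
  have W: "cutoff ?W f \<in> C0 T" "defect (cutoff ?W f) = 0" using insert by auto
  show ?case
  proof (cases "t \<in> ?W")
    case True
    then have "seg t \<subseteq> ?W" by (fastforce simp: mem_seg intro: order_trans)
    then have "(\<Union>u\<in>insert t F. seg u) = ?W" by blast
    then show ?thesis using W by simp
  next
    case False
    have "(\<Union>u\<in>G. seg u \<inter> seg t) \<in> lowers t" if "G \<subseteq> F" for G
      using finite_subset[OF that insert.hyps(1)] that
    proof (induction G rule: finite_induct)
      case (insert u G)
      have "\<not> t \<le> u" using False insert.prems t by (auto simp: mem_seg)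
      moreover have "u \<in> T" using insert.prems \<open>insert t F \<subseteq> T\<close> by blast
      ultimately have "seg t \<inter> seg u \<in> lowers t" using seg_Int_lowers[OF t] by blast
      then have "seg u \<inter> seg t \<in> lowers t" by (simp only: Int_commute)
      moreover have "(\<Union>u\<in>G. seg u \<inter> seg t) \<in> lowers t" using insert by blast
      ultimately show ?case using lowers_Un[OF t] by simp
    qed simp
    then have "?W \<inter> seg t \<in> lowers t" by (simp add: Int_UN_distrib2)
    note P = lowers_pieces[OF this]
    define g h k where "g = cutoff ?W f" and "h = cutoff (seg t) f" and "k = cutoff (?W \<inter> seg t) f"
    have C: "g \<in> C0 T" "h \<in> C0 T" "k \<in> C0 T" and "defect g = 0"
      unfolding g_def h_def k_def
      using W C0_cut[OF \<open>f \<in> C0 T\<close> P] C0_cut[OF \<open>f \<in> C0 T\<close> seg_pieces[OF t]] by blast+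
    have "k = cutoff (seg t) g" by (auto simp: g_def k_def)
    then have "defect k = 0" using defect_seg[OF t C(1)] by simp
    moreover have "defect h = 0" unfolding h_def using defect_seg[OF t \<open>f \<in> C0 T\<close>] .
    ultimately have "defect (\<lambda>s. g s + (h s - k s)) = 0"
      using defect_add[OF C(1) C0_diff[OF C(2,3)]] defect_diff[OF C(2,3)] \<open>defect g = 0\<close> by simp
    moreover have "cutoff (\<Union>u\<in>insert t F. seg u) f = (\<lambda>s. g s + (h s - k s))"
      by (auto simp: g_def h_def k_def)
    ultimately show ?thesis using C0_add[OF C(1) C0_diff[OF C(2,3)]] by metis
  qed
qed

theorem dual_representation:
  assumes f: "f \<in> C0 T"
  shows "\<phi> f = (\<Sum>\<^sub>\<infinity>t. mass \<phi> t * f t)"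
proof -
  obtain K where K: "\<And>f M. f \<in> C0 T \<Longrightarrow> (\<And>t. \<bar>f t\<bar> \<le> M) \<Longrightarrow> \<bar>defect f\<bar> \<le> K * M"
    using defect_bound by metis
  have "defect f = 0"
  proof (rule eq_zero_if_abs_le_mult)
    fix e :: real assume e: "e > 0"
    from C0_vanish[OF f e] obtain F where F: "finite F" "F \<subseteq> T" "\<And>t. t \<notin> (\<Union>u\<in>F. seg u) \<Longrightarrow> \<bar>f t\<bar> < e"
      by blast
    let ?g = "cutoff (\<Union>u\<in>F. seg u) f"
    have g: "?g \<in> C0 T" "defect ?g = 0" using defect_Union_seg[OF F(1,2) f] by auto
    have "\<bar>defect (\<lambda>s. f s - ?g s)\<bar> \<le> K * e"
    proof (rule K)
      show "(\<lambda>s. f s - ?g s) \<in> C0 T" using C0_diff[OF f g(1)] .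
      show "\<bar>f s - ?g s\<bar> \<le> e" for s using F(3)[of s] e by (auto intro: less_imp_le)
    qed
    then show "\<bar>defect f\<bar> \<le> K * e" using defect_diff[OF f g(1)] g(2) by simp
  qed
  then show ?thesis by (simp add: defect_def)
qed

end

end

section \<open>Integrals of lower semicontinuous functions against |mu|\<close>

context order_tree
begin

definition lsc :: "('a \<Rightarrow> real) \<Rightarrow> bool" where
  "lsc g \<longleftrightarrow> (\<forall>t\<in>T. \<forall>d>0. \<exists>A\<in>lowers t. \<forall>s\<in>seg t - A. g t - d \<le> g s)"

lemma lsc_add:
  assumes "lsc f" "lsc g"
  shows "lsc (\<lambda>t. f t + g t)"
  unfolding lsc_def
proof (intro ballI allI impI)
  fix t and d :: real assume t: "t \<in> T" and "d > 0"
  then have "d / 2 > 0" by simp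
  then obtain A B where A: "A \<in> lowers t" "\<forall>s\<in>seg t - A. f t - d / 2 \<le> f s"
      and B: "B \<in> lowers t" "\<forall>s\<in>seg t - B. g t - d / 2 \<le> g s"
    using assms t unfolding lsc_def by meson
  have "f t + g t - d \<le> f s + g s" if "s \<in> seg t - (A \<union> B)" for s
  proof -
    have "f t - d / 2 \<le> f s" "g t - d / 2 \<le> g s" using A(2) B(2) that by auto
    then show ?thesis by (simp add: field_simps)
  qed
  then show "\<exists>A\<in>lowers t. \<forall>s\<in>seg t - A. f t + g t - d \<le> f s + g s"
    using lowers_Un[OF t A(1) B(1)] by blast
qed

lemma lsc_scale:
  assumes "lsc f" "0 \<le> c"
  shows "lsc (\<lambda>t. c * f t)"
proof (cases "c = 0")
  case True
  then show ?thesis unfolding lsc_def using empty_lowers by (metis add_0 diff_le_eq less_imp_le mult_zero_left)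
next
  case False
  then have c: "c > 0" using assms(2) by simp
  show ?thesis
    unfolding lsc_def
  proof (intro ballI allI impI)
    fix t and d :: real assume t: "t \<in> T" and "d > 0"
    then have "d / c > 0" using c by simp
    then obtain A where A: "A \<in> lowers t" "\<forall>s\<in>seg t - A. f t - d / c \<le> f s"
      using assms(1) t unfolding lsc_def by meson
    have "c * f t - d \<le> c * f s" if "s \<in> seg t - A" for s
    proof -
      have "c * (f t - d / c) \<le> c * f s" using A(2) that c by (intro mult_left_mono) auto
      then show ?thesis using c by (simp add: right_diff_distrib)
    qed
    then show "\<exists>A\<in>lowers t. \<forall>s\<in>seg t - A. c * f t - d \<le> c * f s" using A(1) by blast
  qed
qed

lemma lsc_sum:
  assumes "finite F" "\<And>i. i \<in> F \<Longrightarrow> lsc (g i)"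
  shows "lsc (\<lambda>t. \<Sum>i\<in>F. g i t)"
  using assms
proof (induction F rule: finite_induct)
  case empty
  then show ?case unfolding lsc_def using empty_lowers by fastforce
next
  case (insert i F)
  then show ?case using lsc_add[of "g i" "\<lambda>t. \<Sum>i\<in>F. g i t"] by simp
qed

text \<open>The integral of \<open>g\<close> against |mu|, where mu is the atomic measure
  representing \<phi>.\<close>

definition integ :: "(('a \<Rightarrow> real) \<Rightarrow> real) \<Rightarrow> ('a \<Rightarrow> real) \<Rightarrow> real" where
  "integ \<phi> g = (\<Sum>\<^sub>\<infinity>t. \<bar>mass \<phi> t\<bar> * g t)"

lemma integ_summable:
  assumes "\<phi> \<in> dual" "\<And>t. \<bar>g t\<bar> \<le> M"
  shows "(\<lambda>t. \<bar>mass \<phi> t\<bar> * g t) summable_on S"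
  using abs_summable_real[OF abs_summable_mult(1)[of "\<lambda>t. \<bar>mass \<phi> t\<bar>" S g M]]
    mass_summable_on[OF assms(1)] assms(2) by simp

lemma integ_mono:
  assumes "\<phi> \<in> dual" "\<And>t. 0 \<le> f t" "\<And>t. f t \<le> g t" "\<And>t. g t \<le> M"
  shows "integ \<phi> f \<le> integ \<phi> g"
proof -
  have "\<bar>f t\<bar> \<le> M" "\<bar>g t\<bar> \<le> M" for t
    using assms(2)[of t] assms(3)[of t] assms(4)[of t] by auto
  then show ?thesis
    unfolding integ_def using assms
    by (intro infsum_mono integ_summable[of _ _ M]) (auto intro: mult_left_mono)
qed

lemma integ_scale: "integ \<phi> (\<lambda>t. c * g t) = c * integ \<phi> g"
  unfolding integ_def by (simp add: infsum_cmult_right'[symmetric] mult.left_commute)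

lemma integ_sum:
  assumes "\<phi> \<in> dual" "finite F" "\<And>i t. i \<in> F \<Longrightarrow> \<bar>g i t\<bar> \<le> M"
  shows "integ \<phi> (\<lambda>t. \<Sum>i\<in>F. c i * g i t) = (\<Sum>i\<in>F. c i * integ \<phi> (g i))"
proof -
  have "((\<lambda>t. \<bar>mass \<phi> t\<bar> * (\<Sum>i\<in>F. c i * g i t)) has_sum (\<Sum>i\<in>F. c i * integ \<phi> (g i))) UNIV"
    using assms(2,3)
  proof (induction F rule: finite_induct)
    case (insert i F)
    have "((\<lambda>t. \<bar>mass \<phi> t\<bar> * g i t) has_sum integ \<phi> (g i)) UNIV"
      unfolding integ_def using integ_summable[OF assms(1)] insert.prems by (intro has_sum_infsum) blast
    then have "((\<lambda>t. c i * (\<bar>mass \<phi> t\<bar> * g i t)) has_sum c i * integ \<phi> (g i)) UNIV"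
      by (rule has_sum_cmult_right)
    then have "((\<lambda>t. c i * (\<bar>mass \<phi> t\<bar> * g i t) + \<bar>mass \<phi> t\<bar> * (\<Sum>i\<in>F. c i * g i t)) has_sum
        c i * integ \<phi> (g i) + (\<Sum>i\<in>F. c i * integ \<phi> (g i))) UNIV"
      using insert.IH insert.prems by (intro has_sum_add) auto
    then show ?case using insert.hyps by (simp add: algebra_simps)
  qed simp
  then show ?thesis unfolding integ_def by (rule infsumI)
qed

lemma abs_dual_le_integ:
  assumes "\<phi> \<in> dual" "f \<in> C0 T" "\<And>t. \<bar>f t\<bar> \<le> g t" "\<And>t. g t \<le> M"
  shows "\<bar>\<phi> f\<bar> \<le> integ \<phi> g"
proof -
  have "\<bar>\<phi> f\<bar> \<le> (\<Sum>\<^sub>\<infinity>t. \<bar>mass \<phi> t * f t\<bar>)"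
    using abs_infsum_le[OF mass_mult_summable[OF assms(1,2)]] dual_representation[OF assms(1,2)] by simp
  also have "\<dots> = integ \<phi> (\<lambda>t. \<bar>f t\<bar>)" by (simp add: integ_def abs_mult)
  also have "\<dots> \<le> integ \<phi> g" by (rule integ_mono[OF assms(1)]) (use assms in auto)
  finally show ?thesis .
qed

text \<open>The purpose of lower semicontinuity: the integral against |mu| is recovered from values
  of \<phi> at functions in \<open>C0 T\<close> whose modulus is dominated by \<open>g\<close>.
  Together with \<open>abs_dual_le_integ\<close> it becomes the supremum of these values.\<close>

lemma integ_approx:
  assumes \<phi>: "\<phi> \<in> dual" and g: "lsc g" "\<And>t. 0 \<le> g t" "\<And>t. g t \<le> M" and e: "e > 0"
  obtains f where "f \<in> C0 T" "\<And>t. \<bar>f t\<bar> \<le> g t" "integ \<phi> g - e \<le> \<phi> f"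
proof -
  have "(\<lambda>t. \<bar>mass \<phi> t\<bar> * g t) summable_on UNIV"
    by (rule integ_summable[OF \<phi>, of g M]) (use g in auto)
  moreover have e2: "e / 2 > 0" using e by simp
  ultimately obtain F where F: "finite F"
      "dist (\<Sum>t\<in>F. \<bar>mass \<phi> t\<bar> * g t) (\<Sum>\<^sub>\<infinity>t. \<bar>mass \<phi> t\<bar> * g t) \<le> e / 2"
    using infsum_finite_approximation by blast
  have "(\<Sum>t\<in>F. \<bar>mass \<phi> t\<bar> * g t) = (\<Sum>t\<in>F \<inter> T. \<bar>mass \<phi> t\<bar> * g t)"
    using F(1) by (intro sum.mono_neutral_right) (auto simp: mass_def)
  then have *: "integ \<phi> g - e / 2 \<le> (\<Sum>t\<in>F \<inter> T. \<bar>mass \<phi> t\<bar> * g t)"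
    using F(2) unfolding integ_def dist_real_def abs_le_iff by linarith
  have fin: "finite (F \<inter> T)" "F \<inter> T \<subseteq> T" using F(1) by auto
  have low: "\<exists>A\<in>lowers t. \<forall>s\<in>seg t - A. g t - d \<le> g s" if "t \<in> F \<inter> T" "d > 0" for t d
    using g(1) that unfolding lsc_def by blast
  from test_function[OF \<phi> fin g(2) e2 low] obtain f where "f \<in> C0 T" "\<And>s. \<bar>f s\<bar> \<le> g s" "(\<Sum>t\<in>F \<inter> T. \<bar>mass \<phi> t\<bar> * g t) - e / 2 \<le> \<phi> f" by blast
  moreover then have "integ \<phi> g - e \<le> \<phi> f" using * by (simp add: field_simps)
  ultimately show ?thesis using that by blast
qed

section \<open>Gauges of convex sets of lower semicontinuous functions\<close>

text \<open>The gauge of the set of functions dominated in modulus by a member of \<open>G\<close>.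
  Its dual norm is the support function of \<open>G\<close>
  (\<open>dual_norm_gauge\<close>).\<close>

definition gauge_norm :: "('a \<Rightarrow> real) set \<Rightarrow> ('a \<Rightarrow> real) \<Rightarrow> real" where
  "gauge_norm G f = Inf {c. 0 \<le> c \<and> (\<exists>g\<in>G. \<forall>t. \<bar>f t\<bar> \<le> c * g t)}"

lemma dual_space_equiv:
  assumes "equivalent_norm_on (C0 T) sup_norm N"
  shows "dual_space (C0 T) N = dual"
proof -
  obtain a b where ab: "a > 0" "b > 0" "\<And>x. x \<in> C0 T \<Longrightarrow> a * sup_norm x \<le> N x \<and> N x \<le> b * sup_norm x"
    using assms unfolding equivalent_norm_on_def by blast
  have "(\<exists>K. \<forall>x\<in>C0 T. \<bar>\<phi> x\<bar> \<le> K * N x) \<longleftrightarrow> (\<exists>K. \<forall>x\<in>C0 T. \<bar>\<phi> x\<bar> \<le> K * sup_norm x)" for \<phi> :: "('a \<Rightarrow> real) \<Rightarrow> real"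
  proof
    assume "\<exists>K. \<forall>x\<in>C0 T. \<bar>\<phi> x\<bar> \<le> K * N x"
    then obtain K where K: "\<And>x. x \<in> C0 T \<Longrightarrow> \<bar>\<phi> x\<bar> \<le> K * N x" by blast
    have "\<bar>\<phi> x\<bar> \<le> (\<bar>K\<bar> * b) * sup_norm x" if x: "x \<in> C0 T" for x
    proof -
      have "0 \<le> N x" using ab(1,3) x sup_norm_nonneg[OF x] by (meson mult_nonneg_nonneg less_imp_le order_trans)
      then have "K * N x \<le> \<bar>K\<bar> * N x" by (intro mult_right_mono) auto
      also have "\<dots> \<le> \<bar>K\<bar> * (b * sup_norm x)" using ab(3)[OF x] by (intro mult_left_mono) auto
      finally show ?thesis using K[OF x] by (simp add: mult.assoc)
    qed
    then show "\<exists>K. \<forall>x\<in>C0 T. \<bar>\<phi> x\<bar> \<le> K * sup_norm x" by blast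
  next
    assume "\<exists>K. \<forall>x\<in>C0 T. \<bar>\<phi> x\<bar> \<le> K * sup_norm x"
    then obtain K where K: "\<And>x. x \<in> C0 T \<Longrightarrow> \<bar>\<phi> x\<bar> \<le> K * sup_norm x" by blast
    have "\<bar>\<phi> x\<bar> \<le> (\<bar>K\<bar> / a) * N x" if x: "x \<in> C0 T" for x
    proof -
      have "K * sup_norm x \<le> \<bar>K\<bar> * sup_norm x" using sup_norm_nonneg[OF x] by (intro mult_right_mono) auto
      also have "\<dots> \<le> \<bar>K\<bar> * (N x / a)" using ab(1) ab(3)[OF x] by (intro mult_left_mono) (auto simp: field_simps)
      finally show ?thesis using K[OF x] by simp
    qed
    then show "\<exists>K. \<forall>x\<in>C0 T. \<bar>\<phi> x\<bar> \<le> K * N x" by blast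
  qed
  then show ?thesis unfolding dual_space_def by simp
qed

context
  fixes G :: "('a \<Rightarrow> real) set" and M :: real
  assumes G_nonneg: "\<And>g t. g \<in> G \<Longrightarrow> 0 \<le> g t"
    and G_le: "\<And>g t. g \<in> G \<Longrightarrow> g t \<le> M"
    and G_lsc: "\<And>g. g \<in> G \<Longrightarrow> lsc g"
    and G_convex: "\<And>g h \<theta>. g \<in> G \<Longrightarrow> h \<in> G \<Longrightarrow> 0 \<le> \<theta> \<Longrightarrow> \<theta> \<le> 1 \<Longrightarrow> (\<lambda>t. \<theta> * g t + (1 - \<theta>) * h t) \<in> G"
    and G_one: "indicator T \<in> G"
    and M: "M > 0"
begin

lemma gauge_set_bdd: "bdd_below {c. 0 \<le> c \<and> (\<exists>g\<in>G. \<forall>t. \<bar>f t\<bar> \<le> c * g t)}"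
  by (intro bdd_belowI[of _ 0]) auto

lemma gauge_set_nonempty:
  assumes "f \<in> C0 T"
  shows "sup_norm f \<in> {c. 0 \<le> c \<and> (\<exists>g\<in>G. \<forall>t. \<bar>f t\<bar> \<le> c * g t)}"
proof -
  have "\<bar>f t\<bar> \<le> sup_norm f * indicator T t" for t
    using abs_le_sup_norm[OF assms, of t] C0_off[OF assms, of t] by (cases "t \<in> T") auto
  then show ?thesis using G_one sup_norm_nonneg[OF assms] by blast
qed

lemma gauge_le: "0 \<le> r \<Longrightarrow> g \<in> G \<Longrightarrow> (\<And>t. \<bar>f t\<bar> \<le> r * g t) \<Longrightarrow> gauge_norm G f \<le> r"
  unfolding gauge_norm_def by (intro cInf_lower gauge_set_bdd) auto

lemma gauge_less:
  assumes "f \<in> C0 T" "gauge_norm G f < r"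
  obtains g where "g \<in> G" "\<And>t. \<bar>f t\<bar> \<le> r * g t"
proof -
  have "{c. 0 \<le> c \<and> (\<exists>g\<in>G. \<forall>t. \<bar>f t\<bar> \<le> c * g t)} \<noteq> {}"
    using gauge_set_nonempty[OF assms(1)] by blast
  then obtain c g where c: "0 \<le> c" "c < r" "g \<in> G" "\<And>t. \<bar>f t\<bar> \<le> c * g t"
    using cInf_lessD[OF _ assms(2)[unfolded gauge_norm_def]] by blast
  have "\<bar>f t\<bar> \<le> r * g t" for t
    using c(4)[of t] mult_right_mono[of c r "g t"] c(2) G_nonneg[OF c(3), of t] by simp
  then show ?thesis using that c(3) by blast
qed

lemma gauge_nonneg:
  assumes "f \<in> C0 T"
  shows "0 \<le> gauge_norm G f"
  unfolding gauge_norm_def using gauge_set_nonempty[OF assms] by (intro cInf_greatest) auto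

lemma abs_le_gauge:
  assumes "f \<in> C0 T"
  shows "\<bar>f t\<bar> \<le> M * gauge_norm G f"
proof (rule field_le_epsilon)
  fix e :: real assume "e > 0"
  then have "gauge_norm G f < gauge_norm G f + e / M" using M by simp
  from gauge_less[OF assms this] obtain g where g: "g \<in> G" "\<And>t. \<bar>f t\<bar> \<le> (gauge_norm G f + e / M) * g t"
    by blast
  have "\<bar>f t\<bar> \<le> (gauge_norm G f + e / M) * g t" using g(2) .
  also have "\<dots> \<le> (gauge_norm G f + e / M) * M"
    using G_le[OF g(1)] gauge_nonneg[OF assms] M \<open>e > 0\<close> by (intro mult_left_mono) auto
  also have "\<dots> = M * gauge_norm G f + e" using M by (simp add: field_simps)
  finally show "\<bar>f t\<bar> \<le> M * gauge_norm G f + e" .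
qed

lemma gauge_mono:
  assumes "f \<in> C0 T" "h \<in> C0 T" "\<And>t. \<bar>f t\<bar> \<le> \<bar>h t\<bar>"
  shows "gauge_norm G f \<le> gauge_norm G h"
proof (rule field_le_epsilon)
  fix e :: real assume "e > 0"
  then have "gauge_norm G h < gauge_norm G h + e" by simp
  from gauge_less[OF assms(2) this] obtain g where "g \<in> G" "\<And>t. \<bar>h t\<bar> \<le> (gauge_norm G h + e) * g t" by blast
  then show "gauge_norm G f \<le> gauge_norm G h + e"
    using gauge_nonneg[OF assms(2)] \<open>e > 0\<close> assms(3) by (intro gauge_le[of _ g]) (auto intro: order_trans)
qed

lemma gauge_scale_le:
  assumes f: "f \<in> C0 T"
  shows "gauge_norm G (\<lambda>t. c * f t) \<le> \<bar>c\<bar> * gauge_norm G f"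
proof (rule field_le_epsilon)
  fix e :: real assume e: "e > 0"
  have d: "e / (\<bar>c\<bar> + 1) > 0" using e by (intro divide_pos_pos) auto
  then have "gauge_norm G f < gauge_norm G f + e / (\<bar>c\<bar> + 1)" by simp
  from gauge_less[OF f this] obtain g where g: "g \<in> G" "\<And>t. \<bar>f t\<bar> \<le> (gauge_norm G f + e / (\<bar>c\<bar> + 1)) * g t" by blast
  have "gauge_norm G (\<lambda>t. c * f t) \<le> \<bar>c\<bar> * (gauge_norm G f + e / (\<bar>c\<bar> + 1))"
    using g d gauge_nonneg[OF f] mult_left_mono[OF g(2), of "\<bar>c\<bar>"]
    by (intro gauge_le[of _ g]) (auto simp: abs_mult mult.assoc)
  also have "\<dots> = \<bar>c\<bar> * gauge_norm G f + \<bar>c\<bar> * (e / (\<bar>c\<bar> + 1))" by (simp add: distrib_left)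
  also have "\<bar>c\<bar> * (e / (\<bar>c\<bar> + 1)) \<le> e" using e by (simp add: field_simps)
  finally show "gauge_norm G (\<lambda>t. c * f t) \<le> \<bar>c\<bar> * gauge_norm G f + e" by simp
qed

lemma gauge_scale:
  assumes f: "f \<in> C0 T"
  shows "gauge_norm G (\<lambda>t. c * f t) = \<bar>c\<bar> * gauge_norm G f"
proof (cases "c = 0")
  case True
  then show ?thesis using gauge_scale_le[OF f, of c] gauge_nonneg[OF C0_scale[OF f, of c]] by simp
next
  case False
  have "gauge_norm G (\<lambda>t. inverse c * (c * f t)) \<le> \<bar>inverse c\<bar> * gauge_norm G (\<lambda>t. c * f t)"
    using gauge_scale_le[OF C0_scale[OF f]] .
  then have "gauge_norm G f \<le> \<bar>inverse c\<bar> * gauge_norm G (\<lambda>t. c * f t)" using False by (simp add: mult.assoc[symmetric])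
  then have "\<bar>c\<bar> * gauge_norm G f \<le> gauge_norm G (\<lambda>t. c * f t)" using False by (simp add: field_simps abs_inverse)
  then show ?thesis using gauge_scale_le[OF f, of c] by simp
qed

lemma gauge_add:
  assumes f: "f \<in> C0 T" and h: "h \<in> C0 T"
  shows "gauge_norm G (\<lambda>t. f t + h t) \<le> gauge_norm G f + gauge_norm G h"
proof (rule field_le_epsilon)
  fix e :: real assume e: "e > 0"
  define r where "r = gauge_norm G f + e / 2"
  define s where "s = gauge_norm G h + e / 2"
  have rs: "r > 0" "s > 0" using gauge_nonneg[OF f] gauge_nonneg[OF h] e by (auto simp: r_def s_def)
  have "gauge_norm G f < r" "gauge_norm G h < s" using e by (auto simp: r_def s_def)
  from gauge_less[OF f this(1)] gauge_less[OF h this(2)] obtain g k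
    where g: "g \<in> G" "\<And>t. \<bar>f t\<bar> \<le> r * g t" and k: "k \<in> G" "\<And>t. \<bar>h t\<bar> \<le> s * k t" by metis
  \<comment> \<open>With these weights \<open>r + s\<close> times the convex combination of
    \<open>g\<close> and \<open>k\<close> is \<open>r * g + s * k\<close>.\<close>
  define \<theta> where "\<theta> = r / (r + s)"
  have \<theta>: "0 \<le> \<theta>" "\<theta> \<le> 1" "(r + s) * \<theta> = r" "(r + s) * (1 - \<theta>) = s"
    using rs by (auto simp: \<theta>_def field_simps)
  have "\<bar>f t + h t\<bar> \<le> (r + s) * (\<theta> * g t + (1 - \<theta>) * k t)" for t
  proof -
    have "(r + s) * (\<theta> * g t + (1 - \<theta>) * k t) = ((r + s) * \<theta>) * g t + ((r + s) * (1 - \<theta>)) * k t"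
      by (simp add: algebra_simps)
    also have "\<dots> = r * g t + s * k t" unfolding \<theta>(3,4) ..
    finally show ?thesis using g(2)[of t] k(2)[of t] abs_triangle_ineq[of "f t" "h t"] by linarith
  qed
  then have "gauge_norm G (\<lambda>t. f t + h t) \<le> r + s"
    using G_convex[OF g(1) k(1) \<theta>(1,2)] rs by (intro gauge_le) auto
  then show "gauge_norm G (\<lambda>t. f t + h t) \<le> gauge_norm G f + gauge_norm G h + e"
    by (simp add: r_def s_def)
qed

lemma gauge_equivalent: "equivalent_norm_on (C0 T) sup_norm (gauge_norm G)"
  unfolding equivalent_norm_on_def
proof (intro conjI)
  show "norm_on (C0 T) (gauge_norm G)"
    unfolding norm_on_def
  proof (intro conjI ballI allI impI)
    fix f assume "f \<in> C0 T" "gauge_norm G f = 0"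
    then show "f = (\<lambda>_. 0)" using abs_le_gauge[of f] by auto
  qed (use gauge_nonneg gauge_scale gauge_add in auto)
  have "1 / M * sup_norm f \<le> gauge_norm G f" if "f \<in> C0 T" for f
    using sup_norm_le[OF abs_le_gauge[OF that]] M by (simp add: field_simps)
  moreover have "gauge_norm G f \<le> 1 * sup_norm f" if "f \<in> C0 T" for f
    using gauge_set_nonempty[OF that] gauge_set_bdd unfolding gauge_norm_def by (simp add: cInf_lower)
  ultimately show "\<exists>a>0. \<exists>b>0. \<forall>f\<in>C0 T. a * sup_norm f \<le> gauge_norm G f \<and> gauge_norm G f \<le> b * sup_norm f"
    using M by (intro exI[of _ "1 / M"] conjI exI[of _ 1]) auto
qed

lemma gauge_lattice: "lattice_norm (C0 T) (gauge_norm G)"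
  unfolding lattice_norm_def using gauge_mono by blast

lemma integ_bdd:
  assumes "\<phi> \<in> dual"
  shows "bdd_above (integ \<phi> ` G)"
proof (rule bdd_aboveI2)
  fix g assume "g \<in> G"
  then show "integ \<phi> g \<le> integ \<phi> (\<lambda>_. M)"
    using G_nonneg G_le by (intro integ_mono[OF assms, of _ _ M]) auto
qed

text \<open>A function of gauge at most 1 lies below \<open>(1 + d) * g\<close> for some
  \<open>g \<in> G\<close>, which gives one inequality. For the other, \<open>integ_approx\<close>
  supplies functions below \<open>g\<close>, whose gauge is at most 1.\<close>

lemma dual_norm_gauge:
  assumes \<phi>: "\<phi> \<in> dual"
  shows "dual_norm (C0 T) (gauge_norm G) \<phi> = (SUP g\<in>G. integ \<phi> g)" (is "?L = ?R")
proof (rule antisym)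
  have upper: "\<bar>\<phi> f\<bar> \<le> ?R" if f: "f \<in> C0 T" "gauge_norm G f \<le> 1" for f
  proof -
    have R0: "0 \<le> ?R"
    proof -
      have "0 \<le> integ \<phi> (indicator T)" unfolding integ_def by (intro infsum_nonneg) auto
      also have "\<dots> \<le> ?R" using G_one integ_bdd[OF \<phi>] by (intro cSUP_upper) auto
      finally show ?thesis .
    qed
    have "\<bar>\<phi> f\<bar> \<le> ?R + e" if e: "e > 0" for e
    proof -
      \<comment> \<open>Chosen so that \<open>d * ?R \<le> e\<close>; the 1 covers the case
        \<open>?R = 0\<close>.\<close>
      define d where "d = e / (?R + 1)"
      have d: "d > 0" "d * ?R \<le> e" using e R0 by (auto simp: d_def field_simps intro: add_nonneg_pos)
      have "gauge_norm G f < 1 + d" using f(2) d(1) by simp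
      from gauge_less[OF f(1) this] obtain g where g: "g \<in> G" "\<And>t. \<bar>f t\<bar> \<le> (1 + d) * g t" by blast
      have "\<bar>\<phi> f\<bar> \<le> integ \<phi> (\<lambda>t. (1 + d) * g t)"
        using g(2) G_le[OF g(1)] d(1) by (intro abs_dual_le_integ[OF \<phi> f(1), of _ "(1 + d) * M"]) (auto intro: mult_left_mono)
      also have "\<dots> = (1 + d) * integ \<phi> g" by (rule integ_scale)
      also have "\<dots> \<le> (1 + d) * ?R"
        using d(1) g(1) integ_bdd[OF \<phi>] by (intro mult_left_mono cSUP_upper) auto
      also have "\<dots> \<le> ?R + e" using d(2) by (simp add: distrib_right)
      finally show ?thesis .
    qed
    then show ?thesis by (rule field_le_epsilon)
  qed
  have zero: "(\<lambda>_. 0) \<in> {f \<in> C0 T. gauge_norm G f \<le> 1}"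
    using zero_C0 gauge_scale[OF zero_C0, of 0] by simp
  show "?L \<le> ?R"
    unfolding dual_norm_def using upper zero by (intro cSUP_least) auto
  have bdd: "bdd_above ((\<lambda>f. \<bar>\<phi> f\<bar>) ` {f \<in> C0 T. gauge_norm G f \<le> 1})"
    using upper by (intro bdd_aboveI2[of _ _ ?R]) auto
  show "?R \<le> ?L"
  proof (rule cSUP_least)
    show "G \<noteq> {}" using G_one by blast
    fix g assume g: "g \<in> G"
    show "integ \<phi> g \<le> ?L"
    proof (rule field_le_epsilon)
      fix e :: real assume "e > 0"
      from integ_approx[OF \<phi> G_lsc[OF g] G_nonneg[OF g] G_le[OF g] this] obtain f
        where f: "f \<in> C0 T" "\<And>t. \<bar>f t\<bar> \<le> g t" "integ \<phi> g - e \<le> \<phi> f" by blast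
      have "gauge_norm G f \<le> 1" using f(2) g by (intro gauge_le[of _ g]) auto
      then have "\<bar>\<phi> f\<bar> \<le> ?L" unfolding dual_norm_def using f(1) bdd by (intro cSUP_upper) auto
      then show "integ \<phi> g \<le> ?L + e" using f(3) by linarith
    qed
  qed
qed

end

end

section \<open>Strictly convex combinations of seminorms\<close>

lemma l2_le:
  fixes x a :: "'i \<Rightarrow> real"
  assumes F: "finite F" "F \<subseteq> I" and x: "(\<lambda>i. (x i)\<^sup>2) summable_on I" and a: "(\<Sum>i\<in>F. (a i)\<^sup>2) \<le> 1"
  shows "(\<Sum>i\<in>F. a i * x i) \<le> sqrt (\<Sum>\<^sub>\<infinity>i\<in>I. (x i)\<^sup>2)"
proof (rule real_le_rsqrt)
  have "(\<Sum>i\<in>F. a i * x i)\<^sup>2 \<le> (\<Sum>i\<in>F. (a i)\<^sup>2) * (\<Sum>i\<in>F. (x i)\<^sup>2)"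
    by (rule Cauchy_Schwarz_ineq_sum)
  also have "\<dots> \<le> 1 * (\<Sum>i\<in>F. (x i)\<^sup>2)" using a by (intro mult_right_mono sum_nonneg) auto
  also have "\<dots> \<le> (\<Sum>\<^sub>\<infinity>i\<in>I. (x i)\<^sup>2)" using finite_sum_le_infsum[OF x F] by simp
  finally show "(\<Sum>i\<in>F. a i * x i)\<^sup>2 \<le> (\<Sum>\<^sub>\<infinity>i\<in>I. (x i)\<^sup>2)" .
qed

lemma l2_approx:
  fixes x :: "'i \<Rightarrow> real"
  assumes x: "(\<lambda>i. (x i)\<^sup>2) summable_on I" and x0: "\<And>i. 0 \<le> x i" and e: "e > 0"
  shows "\<exists>F a. finite F \<and> F \<subseteq> I \<and> (\<forall>i. 0 \<le> a i) \<and> (\<Sum>i\<in>F. (a i)\<^sup>2) \<le> 1 \<and>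
    sqrt (\<Sum>\<^sub>\<infinity>i\<in>I. (x i)\<^sup>2) - e \<le> (\<Sum>i\<in>F. a i * x i)"
proof -
  let ?S = "\<Sum>\<^sub>\<infinity>i\<in>I. (x i)\<^sup>2"
  obtain F where F: "finite F" "F \<subseteq> I" "dist (\<Sum>i\<in>F. (x i)\<^sup>2) ?S \<le> e\<^sup>2"
    using infsum_finite_approximation[OF x, of "e\<^sup>2"] e by auto
  define s where "s = (\<Sum>i\<in>F. (x i)\<^sup>2)"
  have s0: "0 \<le> s" unfolding s_def by (intro sum_nonneg) auto
  \<comment> \<open>The norming vector for the finite part. If \<open>s = 0\<close>, division by
    zero makes all coefficients 0, and the estimates remain valid.\<close>
  define a where "a i = x i / sqrt s" for i
  have "(\<Sum>i\<in>F. (a i)\<^sup>2) = s / s"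
    using s0 unfolding a_def power_divide sum_divide_distrib[symmetric] by (simp add: s_def)
  then have "(\<Sum>i\<in>F. (a i)\<^sup>2) \<le> 1" by simp
  moreover have "(\<Sum>i\<in>F. a i * x i) = s / sqrt s"
    unfolding a_def times_divide_eq_left sum_divide_distrib[symmetric] by (simp add: s_def power2_eq_square)
  then have "(\<Sum>i\<in>F. a i * x i) = sqrt s" using s0 by (simp add: real_div_sqrt)
  moreover have "sqrt ?S \<le> sqrt (s + e\<^sup>2)"
    using F(3) by (simp add: s_def dist_real_def abs_le_iff)
  then have "sqrt ?S \<le> sqrt s + e"
    using sqrt_add_le_add_sqrt[of s "e\<^sup>2"] s0 e by (simp del: real_sqrt_le_iff)
  moreover have "0 \<le> a i" for i using x0[of i] s0 by (simp add: a_def)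
  ultimately show ?thesis using F by (intro exI[of _ F] exI[of _ a]) simp
qed

text \<open>By the parallelogram identity the sums of \<open>(x i - y i)\<^sup>2\<close> and of
  \<open>(x i + y i)\<^sup>2 - (z i)\<^sup>2\<close> add up to 0. Their terms are nonnegative, so
  all of them vanish. The sequence \<open>z\<close> need only be dominated by \<open>x + y\<close>,
  as happens for seminorms of a sum.\<close>

lemma l2_strict:
  fixes x y z :: "'i \<Rightarrow> real"
  assumes x: "(\<lambda>i. (x i)\<^sup>2) summable_on I" and y: "(\<lambda>i. (y i)\<^sup>2) summable_on I"
    and z: "\<And>i. i \<in> I \<Longrightarrow> 0 \<le> z i" "\<And>i. i \<in> I \<Longrightarrow> z i \<le> x i + y i"
    and eq: "sqrt (\<Sum>\<^sub>\<infinity>i\<in>I. (x i)\<^sup>2) = sqrt (\<Sum>\<^sub>\<infinity>i\<in>I. (z i)\<^sup>2) / 2"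
      "sqrt (\<Sum>\<^sub>\<infinity>i\<in>I. (z i)\<^sup>2) / 2 = sqrt (\<Sum>\<^sub>\<infinity>i\<in>I. (y i)\<^sup>2)"
    and i: "i \<in> I"
  shows "x i = y i" "z i = x i + y i"
proof -
  define S where "S = (\<Sum>\<^sub>\<infinity>i\<in>I. (x i)\<^sup>2)"
  have sum: "(\<lambda>i. 2 * (x i)\<^sup>2 + 2 * (y i)\<^sup>2) summable_on I"
    using x y by (intro summable_on_add summable_on_cmult_right)
  have plus: "(\<lambda>i. (x i + y i)\<^sup>2) summable_on I"
  proof (rule summable_on_comparison_test[OF sum])
    show "(x i + y i)\<^sup>2 \<le> 2 * (x i)\<^sup>2 + 2 * (y i)\<^sup>2" for i
      using zero_le_power2[of "x i - y i"] by (simp add: power2_eq_square algebra_simps)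
  qed auto
  have minus: "(\<lambda>i. (x i - y i)\<^sup>2) summable_on I"
  proof (rule summable_on_comparison_test[OF sum])
    show "(x i - y i)\<^sup>2 \<le> 2 * (x i)\<^sup>2 + 2 * (y i)\<^sup>2" for i
      using zero_le_power2[of "x i + y i"] by (simp add: power2_eq_square algebra_simps)
  qed auto
  have zle: "(z i)\<^sup>2 \<le> (x i + y i)\<^sup>2" if "i \<in> I" for i
    using z[OF that] by (intro power_mono) auto
  have zs: "(\<lambda>i. (z i)\<^sup>2) summable_on I"
    by (rule summable_on_comparison_test[OF plus]) (use zle in auto)
  have diff: "(\<lambda>i. (x i + y i)\<^sup>2 - (z i)\<^sup>2) summable_on I"
    by (rule summable_on_comparison_test[OF plus]) (use zle in auto)
  have Sy: "S = (\<Sum>\<^sub>\<infinity>i\<in>I. (y i)\<^sup>2)" using eq by (simp add: S_def)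
  have Sz: "4 * S = (\<Sum>\<^sub>\<infinity>i\<in>I. (z i)\<^sup>2)"
  proof -
    have "0 \<le> (\<Sum>\<^sub>\<infinity>i\<in>I. (z i)\<^sup>2)" "0 \<le> S" unfolding S_def by (intro infsum_nonneg; simp)+
    moreover have "(2 * sqrt S)\<^sup>2 = (sqrt (\<Sum>\<^sub>\<infinity>i\<in>I. (z i)\<^sup>2))\<^sup>2"
      using eq(1) unfolding S_def by (intro arg_cong[of _ _ "\<lambda>r. r\<^sup>2"]) linarith
    ultimately show ?thesis by (simp add: power_mult_distrib)
  qed
  have "(\<Sum>\<^sub>\<infinity>i\<in>I. 2 * (x i)\<^sup>2 + 2 * (y i)\<^sup>2) = 2 * S + 2 * S"
    using x y by (simp add: infsum_add summable_on_cmult_right infsum_cmult_right' S_def[symmetric] Sy[symmetric])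
  moreover have "(\<lambda>i. 2 * (x i)\<^sup>2 + 2 * (y i)\<^sup>2) = (\<lambda>i. (x i - y i)\<^sup>2 + (x i + y i)\<^sup>2)"
    by (auto simp: power2_eq_square algebra_simps)
  ultimately have "(\<Sum>\<^sub>\<infinity>i\<in>I. (x i - y i)\<^sup>2) + (\<Sum>\<^sub>\<infinity>i\<in>I. (x i + y i)\<^sup>2) = 4 * S"
    using infsum_add[OF minus plus] by simp
  moreover have "(\<Sum>\<^sub>\<infinity>i\<in>I. (x i + y i)\<^sup>2) = (\<Sum>\<^sub>\<infinity>i\<in>I. (z i)\<^sup>2) + (\<Sum>\<^sub>\<infinity>i\<in>I. (x i + y i)\<^sup>2 - (z i)\<^sup>2)"
    using infsum_add[OF zs, of "\<lambda>i. (x i + y i)\<^sup>2 - (z i)\<^sup>2"] diff by simp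
  moreover have "0 \<le> (\<Sum>\<^sub>\<infinity>i\<in>I. (x i - y i)\<^sup>2)" by (intro infsum_nonneg) auto
  moreover have "0 \<le> (\<Sum>\<^sub>\<infinity>i\<in>I. (x i + y i)\<^sup>2 - (z i)\<^sup>2)" using zle by (intro infsum_nonneg) auto
  ultimately have 0: "(\<Sum>\<^sub>\<infinity>i\<in>I. (x i - y i)\<^sup>2) = 0" "(\<Sum>\<^sub>\<infinity>i\<in>I. (x i + y i)\<^sup>2 - (z i)\<^sup>2) = 0"
    using Sz by linarith+
  have "(x i - y i)\<^sup>2 = 0"
    using 0(1) minus i by (intro nonneg_infsum_le_0D[of "\<lambda>i. (x i - y i)\<^sup>2" I]) auto
  then show "x i = y i" by simp
  have "(x i + y i)\<^sup>2 - (z i)\<^sup>2 = 0"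
    using 0(2) diff zle i
    by (intro nonneg_infsum_le_0D[of "\<lambda>i. (x i + y i)\<^sup>2 - (z i)\<^sup>2" I]) auto
  then have "(z i)\<^sup>2 = (x i + y i)\<^sup>2" by simp
  moreover have "0 \<le> x i + y i" using z[OF i] by linarith
  ultimately show "z i = x i + y i" using z(1)[OF i] by (simp add: power2_eq_iff_nonneg)
qed

lemma l2_convex:
  fixes a b :: "'i \<Rightarrow> real"
  assumes "finite F" "finite G" "(\<Sum>i\<in>F. (a i)\<^sup>2) \<le> 1" "(\<Sum>i\<in>G. (b i)\<^sup>2) \<le> 1" "0 \<le> \<theta>" "\<theta> \<le> 1"
  shows "(\<Sum>i\<in>F \<union> G. (\<theta> * (if i \<in> F then a i else 0) + (1 - \<theta>) * (if i \<in> G then b i else 0))\<^sup>2) \<le> 1"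
proof -
  let ?a = "\<lambda>i. if i \<in> F then a i else 0" and ?b = "\<lambda>i. if i \<in> G then b i else 0"
  have sq: "(\<theta> * u + (1 - \<theta>) * v)\<^sup>2 \<le> \<theta> * u\<^sup>2 + (1 - \<theta>) * v\<^sup>2" for u v :: real
  proof -
    have "\<theta> * u\<^sup>2 + (1 - \<theta>) * v\<^sup>2 - (\<theta> * u + (1 - \<theta>) * v)\<^sup>2 = \<theta> * (1 - \<theta>) * (u - v)\<^sup>2"
      by (simp add: power2_eq_square algebra_simps)
    moreover have "0 \<le> \<theta> * (1 - \<theta>) * (u - v)\<^sup>2" using assms(5,6) by simp
    ultimately show ?thesis by linarith
  qed
  have "(\<Sum>i\<in>F \<union> G. (\<theta> * ?a i + (1 - \<theta>) * ?b i)\<^sup>2) \<le> (\<Sum>i\<in>F \<union> G. \<theta> * (?a i)\<^sup>2 + (1 - \<theta>) * (?b i)\<^sup>2)"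
    by (rule sum_mono) (rule sq)
  also have "\<dots> = \<theta> * (\<Sum>i\<in>F \<union> G. (?a i)\<^sup>2) + (1 - \<theta>) * (\<Sum>i\<in>F \<union> G. (?b i)\<^sup>2)"
    by (simp add: sum.distrib sum_distrib_left)
  also have "(\<Sum>i\<in>F \<union> G. (?a i)\<^sup>2) = (\<Sum>i\<in>F. (a i)\<^sup>2)"
    using assms(1,2) by (intro sum.mono_neutral_cong_right) auto
  also have "(\<Sum>i\<in>F \<union> G. (?b i)\<^sup>2) = (\<Sum>i\<in>G. (b i)\<^sup>2)"
    using assms(1,2) by (intro sum.mono_neutral_cong_right) auto
  also have "\<theta> * (\<Sum>i\<in>F. (a i)\<^sup>2) + (1 - \<theta>) * (\<Sum>i\<in>G. (b i)\<^sup>2) \<le> \<theta> * 1 + (1 - \<theta>) * 1"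
    using assms by (intro add_mono mult_left_mono) auto
  finally show ?thesis by simp
qed

lemma sum_half_powers_le: "finite F \<Longrightarrow> (\<Sum>n\<in>F. (1/2)^n) \<le> (2::real)"
  using sum_le_suminf[of "\<lambda>n. (1/2::real)^n" F] suminf_geometric[of "1/2::real"] by simp

section \<open>Square-summable combinations of countably many dual seminorms\<close>

context order_tree
begin

lemma dual_plus: "\<phi> \<in> dual \<Longrightarrow> \<psi> \<in> dual \<Longrightarrow> (\<lambda>f. \<phi> f + \<psi> f) \<in> dual"
proof -
  assume \<phi>: "\<phi> \<in> dual" and \<psi>: "\<psi> \<in> dual"
  obtain K where K: "\<And>f. f \<in> C0 T \<Longrightarrow> \<bar>\<phi> f\<bar> \<le> K * sup_norm f"
    using \<phi> unfolding dual_space_def by blast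
  obtain J where J: "\<And>f. f \<in> C0 T \<Longrightarrow> \<bar>\<psi> f\<bar> \<le> J * sup_norm f"
    using \<psi> unfolding dual_space_def by blast
  have "\<bar>\<phi> f + \<psi> f\<bar> \<le> (K + J) * sup_norm f" if "f \<in> C0 T" for f
    using K[OF that] J[OF that] abs_triangle_ineq[of "\<phi> f" "\<psi> f"] by (simp add: distrib_right)
  then have "\<exists>K. \<forall>f\<in>C0 T. \<bar>\<phi> f + \<psi> f\<bar> \<le> K * sup_norm f" by blast
  then show ?thesis using \<phi> \<psi> unfolding dual_space_def by (simp add: algebra_simps)
qed

lemma mass_plus:
  assumes "\<phi> \<in> dual" "\<psi> \<in> dual"
  shows "mass (\<lambda>f. \<phi> f + \<psi> f) t = mass \<phi> t + mass \<psi> t"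
proof (cases "t \<in> T")
  case True
  show ?thesis
    using tendsto_unique[OF at_low_nonbot[OF True] mass_tendsto[OF dual_plus[OF assms] True]
      tendsto_add[OF mass_tendsto[OF assms(1) True] mass_tendsto[OF assms(2) True]]] .
qed (simp add: mass_def)

lemma integ_nonneg: "(\<And>t. 0 \<le> g t) \<Longrightarrow> 0 \<le> integ \<phi> g"
  unfolding integ_def by (intro infsum_nonneg) auto

lemma integ_subadd:
  assumes "\<phi> \<in> dual" "\<psi> \<in> dual" "\<And>t. 0 \<le> g t" "\<And>t. g t \<le> M"
  shows "integ (\<lambda>f. \<phi> f + \<psi> f) g \<le> integ \<phi> g + integ \<psi> g"
proof -
  have b: "\<bar>g t\<bar> \<le> M" for t using assms(3,4) by simp
  note s = integ_summable[OF assms(1) b] integ_summable[OF assms(2) b]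
  have "integ (\<lambda>f. \<phi> f + \<psi> f) g \<le> (\<Sum>\<^sub>\<infinity>t. \<bar>mass \<phi> t\<bar> * g t + \<bar>mass \<psi> t\<bar> * g t)"
    unfolding integ_def
  proof (rule infsum_mono[OF integ_summable[OF dual_plus[OF assms(1,2)] b] summable_on_add[OF s]])
    fix t
    have "\<bar>mass \<phi> t + mass \<psi> t\<bar> * g t \<le> (\<bar>mass \<phi> t\<bar> + \<bar>mass \<psi> t\<bar>) * g t"
      using assms(3) by (intro mult_right_mono) auto
    then show "\<bar>mass (\<lambda>f. \<phi> f + \<psi> f) t\<bar> * g t \<le> \<bar>mass \<phi> t\<bar> * g t + \<bar>mass \<psi> t\<bar> * g t"
      using mass_plus[OF assms(1,2)] by (simp add: distrib_right)
  qed
  also have "\<dots> = integ \<phi> g + integ \<psi> g" unfolding integ_def by (rule infsum_add[OF s])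
  finally show ?thesis .
qed

context
  fixes \<L> :: "nat \<Rightarrow> ('a \<Rightarrow> real) set"
  assumes L_nonneg: "\<And>n L t. L \<in> \<L> n \<Longrightarrow> 0 \<le> L t"
    and L_le: "\<And>n L t. L \<in> \<L> n \<Longrightarrow> L t \<le> 1"
    and L_lsc: "\<And>n L. L \<in> \<L> n \<Longrightarrow> lsc L"
    and L_convex: "\<And>n L K \<theta>. L \<in> \<L> n \<Longrightarrow> K \<in> \<L> n \<Longrightarrow> 0 \<le> \<theta> \<Longrightarrow> \<theta> \<le> 1 \<Longrightarrow> (\<lambda>t. \<theta> * L t + (1 - \<theta>) * K t) \<in> \<L> n"
    and L_nonempty: "\<And>n. \<L> n \<noteq> {}"
    and L_one: "indicator T \<in> \<L> 0"
begin

text \<open>A set whose support function is the l2 norm of the sequence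
  \<open>(1/2)^n * weight n \<phi>\<close>. Finite sums suffice for this supremum and stay lower
  semicontinuous; the geometric factors make the members uniformly bounded.\<close>

definition l2_comb :: "('a \<Rightarrow> real) set" where
  "l2_comb = {g. \<exists>F a L. finite F \<and> (\<forall>n. 0 \<le> a n) \<and> (\<Sum>n\<in>F. (a n)\<^sup>2) \<le> 1 \<and> (\<forall>n. L n \<in> \<L> n) \<and>
     g = (\<lambda>t. \<Sum>n\<in>F. a n * ((1/2)^n * L n t))}"

definition weight :: "nat \<Rightarrow> (('a \<Rightarrow> real) \<Rightarrow> real) \<Rightarrow> real" where
  "weight n \<phi> = (SUP L\<in>\<L> n. integ \<phi> L)"

lemma l2_comb_props:
  assumes "g \<in> l2_comb"
  shows "0 \<le> g t" "g t \<le> 2" "lsc g"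
proof -
  obtain F a L where g: "finite F" "\<And>n. 0 \<le> a n" "(\<Sum>n\<in>F. (a n)\<^sup>2) \<le> 1" "\<And>n. L n \<in> \<L> n"
    "g = (\<lambda>t. \<Sum>n\<in>F. a n * ((1/2)^n * L n t))"
    using assms unfolding l2_comb_def by blast
  show "0 \<le> g t" using g(2) L_nonneg[OF g(4)] by (auto simp: g(5) intro!: sum_nonneg)
  have a1: "a n \<le> 1" if "n \<in> F" for n
  proof -
    have "(a n)\<^sup>2 \<le> (\<Sum>n\<in>F. (a n)\<^sup>2)" using that g(1) by (intro member_le_sum) auto
    then show ?thesis using g(3) by (intro power2_le_imp_le[of "a n" 1]) auto
  qed
  have "g t \<le> (\<Sum>n\<in>F. (1/2)^n)"
    unfolding g(5)
  proof (rule sum_mono)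
    fix n assume "n \<in> F"
    then have "a n * ((1/2)^n * L n t) \<le> 1 * ((1/2)^n * 1)"
      using a1 g(2) L_nonneg[OF g(4)] L_le[OF g(4)] by (intro mult_mono) auto
    then show "a n * ((1/2)^n * L n t) \<le> (1/2)^n" by simp
  qed
  then show "g t \<le> 2" using sum_half_powers_le[OF g(1)] by linarith
  show "lsc g" unfolding g(5) using g(1,2) L_lsc[OF g(4)] by (intro lsc_sum lsc_scale) auto
qed

lemma l2_comb_one: "indicator T \<in> l2_comb"
proof -
  have "\<forall>n. \<exists>L. L \<in> \<L> n" using L_nonempty by blast
  then obtain K where K: "\<And>n. K n \<in> \<L> n" by metis
  show ?thesis
    unfolding l2_comb_def mem_Collect_eq
    by (rule exI[of _ "{0}"], rule exI[of _ "\<lambda>_. 1"], rule exI[of _ "K(0 := indicator T)"])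
       (use K L_one in auto)
qed

lemma l2_comb_convex:
  assumes "g \<in> l2_comb" "h \<in> l2_comb" "0 \<le> \<theta>" "\<theta> \<le> 1"
  shows "(\<lambda>t. \<theta> * g t + (1 - \<theta>) * h t) \<in> l2_comb"
proof -
  obtain F a L where g: "finite F" "\<And>n. 0 \<le> a n" "(\<Sum>n\<in>F. (a n)\<^sup>2) \<le> 1" "\<And>n. L n \<in> \<L> n"
    "g = (\<lambda>t. \<Sum>n\<in>F. a n * ((1/2)^n * L n t))"
    using assms(1) unfolding l2_comb_def by blast
  obtain G b K where h: "finite G" "\<And>n. 0 \<le> b n" "(\<Sum>n\<in>G. (b n)\<^sup>2) \<le> 1" "\<And>n. K n \<in> \<L> n"
    "h = (\<lambda>t. \<Sum>n\<in>G. b n * ((1/2)^n * K n t))"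
    using assms(2) unfolding l2_comb_def by blast
  define u where "u n = \<theta> * (if n \<in> F then a n else 0)" for n
  define v where "v n = (1 - \<theta>) * (if n \<in> G then b n else 0)" for n
  \<comment> \<open>In each index the two functions are merged with their relative weights, which
    keeps them in the convex set \<open>\<L> n\<close>. If both weights vanish, any member will
    do.\<close>
  define J where "J n = (if u n + v n = 0 then L n
      else (\<lambda>t. (u n / (u n + v n)) * L n t + (1 - u n / (u n + v n)) * K n t))" for n
  have uv: "0 \<le> u n" "0 \<le> v n" for n using g(2) h(2) assms(3,4) by (auto simp: u_def v_def)
  have J: "J n \<in> \<L> n" for n
    using uv[of n] L_convex[OF g(4) h(4), of "u n / (u n + v n)" n] g(4) by (auto simp: J_def field_simps)
  have uJ: "(u n + v n) * J n t = u n * L n t + v n * K n t" for n t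
  proof (cases "u n + v n = 0")
    case True
    then have "u n = 0" "v n = 0" using uv[of n] by auto
    then show ?thesis by simp
  next
    case False
    have "(u n + v n) * J n t =
        ((u n + v n) * (u n / (u n + v n))) * L n t + ((u n + v n) * (1 - u n / (u n + v n))) * K n t"
      using False by (simp add: J_def distrib_left mult.assoc)
    moreover have "(u n + v n) * (u n / (u n + v n)) = u n" "(u n + v n) * (1 - u n / (u n + v n)) = v n"
      using False by (simp_all add: right_diff_distrib)
    ultimately show ?thesis by simp
  qed
  have "\<theta> * g t + (1 - \<theta>) * h t = (\<Sum>n\<in>F \<union> G. (u n + v n) * ((1/2)^n * J n t))" for t
  proof -
    have "\<theta> * g t = (\<Sum>n\<in>F \<union> G. u n * ((1/2)^n * L n t))"
      unfolding g(5) sum_distrib_left using g(1) h(1)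
      by (intro sum.mono_neutral_cong_left) (auto simp: u_def)
    moreover have "(1 - \<theta>) * h t = (\<Sum>n\<in>F \<union> G. v n * ((1/2)^n * K n t))"
      unfolding h(5) sum_distrib_left using g(1) h(1)
      by (intro sum.mono_neutral_cong_left) (auto simp: v_def)
    ultimately have "\<theta> * g t + (1 - \<theta>) * h t = (\<Sum>n\<in>F \<union> G. (1/2)^n * (u n * L n t + v n * K n t))"
      by (simp add: sum.distrib distrib_left mult.left_commute)
    then show ?thesis unfolding uJ[symmetric] by (simp add: mult.left_commute)
  qed
  moreover have "(\<Sum>n\<in>F \<union> G. (u n + v n)\<^sup>2) \<le> 1"
    using l2_convex[OF g(1) h(1) g(3) h(3) assms(3,4)] by (simp add: u_def v_def)
  ultimately show ?thesis
    unfolding l2_comb_def mem_Collect_eq using g(1) h(1) uv J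
    by (intro exI[of _ "F \<union> G"] exI[of _ "\<lambda>n. u n + v n"] exI[of _ J]) auto
qed

context
  fixes \<phi> assumes \<phi>: "\<phi> \<in> dual"
begin

lemma integ_L_le: "L \<in> \<L> n \<Longrightarrow> integ \<phi> L \<le> integ \<phi> (\<lambda>_. 1)"
  using L_nonneg L_le by (intro integ_mono[OF \<phi>, of _ _ 1]) auto

lemma integ_le_weight: "L \<in> \<L> n \<Longrightarrow> integ \<phi> L \<le> weight n \<phi>"
  unfolding weight_def using integ_L_le by (intro cSUP_upper bdd_aboveI2) auto

lemma weight_nonneg: "0 \<le> weight n \<phi>"
proof -
  obtain L where L: "L \<in> \<L> n" using L_nonempty by blast
  have "0 \<le> integ \<phi> L" using L_nonneg[OF L] by (rule integ_nonneg)
  then show ?thesis using integ_le_weight[OF L] by linarith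
qed

lemma weight_le: "weight n \<phi> \<le> integ \<phi> (\<lambda>_. 1)"
  unfolding weight_def using integ_L_le L_nonempty by (intro cSUP_least) auto

lemma weight_summable: "(\<lambda>n. ((1/2)^n * weight n \<phi>)\<^sup>2) summable_on UNIV"
proof (rule norm_summable_imp_summable_on)
  let ?t = "integ \<phi> (\<lambda>_. 1)"
  have "summable (\<lambda>n. ?t\<^sup>2 * (1/4::real)^n)" by (intro summable_mult summable_geometric) simp
  moreover have "norm (norm (((1/2)^n * weight n \<phi>)\<^sup>2)) \<le> ?t\<^sup>2 * (1/4::real)^n" for n
  proof -
    have "((1/2)^n * weight n \<phi>)\<^sup>2 = (weight n \<phi>)\<^sup>2 * (1/4::real)^n"
    proof -
      have "((1/2::real)^n)\<^sup>2 = (1/4)^n"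
        unfolding power2_eq_square power_mult_distrib[symmetric] by simp
      then show ?thesis by (simp only: power_mult_distrib mult.commute)
    qed
    also have "\<dots> \<le> ?t\<^sup>2 * (1/4::real)^n"
      using weight_nonneg weight_le by (intro mult_right_mono power_mono) auto
    finally show ?thesis by simp
  qed
  ultimately show "summable (\<lambda>n. norm (((1/2)^n * weight n \<phi>)\<^sup>2))"
    by (rule_tac summable_comparison_test[of _ "\<lambda>n. ?t\<^sup>2 * (1/4::real)^n"]) simp_all
qed

lemma SUP_l2_comb: "(SUP g\<in>l2_comb. integ \<phi> g) = sqrt (\<Sum>\<^sub>\<infinity>n. ((1/2)^n * weight n \<phi>)\<^sup>2)" (is "?L = ?R")
proof (rule antisym)
  have integ: "integ \<phi> (\<lambda>t. \<Sum>n\<in>F. a n * ((1/2)^n * L n t)) = (\<Sum>n\<in>F. a n * ((1/2)^n * integ \<phi> (L n)))"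
    if "finite F" "\<And>n. L n \<in> \<L> n" for F a L
  proof -
    have "\<bar>(1/2)^n * L n t\<bar> \<le> 1" for n t
      using L_nonneg[OF that(2)] L_le[OF that(2)] by (auto simp: abs_mult intro!: mult_le_one power_le_one)
    then show ?thesis using integ_sum[OF \<phi> that(1), of "\<lambda>n t. (1/2)^n * L n t" 1 a]
      by (simp add: integ_scale)
  qed
  have upper: "integ \<phi> g \<le> ?R" if mem: "g \<in> l2_comb" for g
  proof -
    obtain F a L where g: "finite F" "\<And>n. 0 \<le> a n" "(\<Sum>n\<in>F. (a n)\<^sup>2) \<le> 1" "\<And>n. L n \<in> \<L> n"
      "g = (\<lambda>t. \<Sum>n\<in>F. a n * ((1/2)^n * L n t))"
      using mem unfolding l2_comb_def by blast
    have "integ \<phi> g \<le> (\<Sum>n\<in>F. a n * ((1/2)^n * weight n \<phi>))"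
      unfolding g(5) integ[OF g(1,4)] using g(2) integ_le_weight[OF g(4)]
      by (intro sum_mono mult_left_mono) auto
    also have "\<dots> \<le> ?R" by (rule l2_le[OF g(1) _ weight_summable g(3)]) simp
    finally show ?thesis .
  qed
  then show "?L \<le> ?R" using l2_comb_one by (intro cSUP_least) auto
  have bdd: "bdd_above (integ \<phi> ` l2_comb)" using upper by (intro bdd_aboveI2) auto
  show "?R \<le> ?L"
  proof (rule field_le_epsilon)
    fix e :: real assume "e > 0"
    \<comment> \<open>One third is lost in \<open>l2_approx\<close>. Choosing each
      \<open>L n\<close> within one third of its supremum costs at most two thirds, as the factors
      \<open>(1/2)^n\<close> sum to at most 2.\<close>
    then have e: "e / 3 > 0" by simp
    have nn: "0 \<le> (1/2)^n * weight n \<phi>" for n using weight_nonneg by simp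
    obtain F a where Fa: "finite F" "\<And>n. 0 \<le> a n"
      "(\<Sum>n\<in>F. (a n)\<^sup>2) \<le> 1" "?R - e / 3 \<le> (\<Sum>n\<in>F. a n * ((1/2)^n * weight n \<phi>))"
      using l2_approx[OF weight_summable nn e] by (elim exE conjE) blast
    have "\<exists>L\<in>\<L> n. weight n \<phi> - e / 3 < integ \<phi> L" for n
    proof (rule ccontr)
      assume "\<not> ?thesis"
      then have "weight n \<phi> \<le> weight n \<phi> - e / 3"
        unfolding weight_def[of n \<phi>] using L_nonempty by (intro cSUP_least) (auto simp: not_less)
      then show False using e by simp
    qed
    then obtain L where L: "\<And>n. L n \<in> \<L> n" "\<And>n. weight n \<phi> - e / 3 < integ \<phi> (L n)" by metis
    have a1: "a n \<le> 1" if "n \<in> F" for n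
    proof -
      have "(a n)\<^sup>2 \<le> (\<Sum>n\<in>F. (a n)\<^sup>2)" using that Fa(1) by (intro member_le_sum) auto
      then show ?thesis using Fa(3) by (intro power2_le_imp_le[of "a n" 1]) auto
    qed
    let ?g = "\<lambda>t. \<Sum>n\<in>F. a n * ((1/2)^n * L n t)"
    have "(\<Sum>n\<in>F. a n * ((1/2)^n * weight n \<phi>)) \<le>
        (\<Sum>n\<in>F. a n * ((1/2)^n * integ \<phi> (L n)) + (1/2)^n * (e / 3))"
    proof (rule sum_mono)
      fix n assume n: "n \<in> F"
      have "a n * ((1/2)^n * weight n \<phi>) \<le> a n * ((1/2)^n * (integ \<phi> (L n) + e / 3))"
        using L(2)[of n] Fa(2) by (intro mult_left_mono) auto
      also have "\<dots> = a n * ((1/2)^n * integ \<phi> (L n)) + a n * ((1/2)^n * (e / 3))"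
        by (simp add: algebra_simps)
      also have "a n * ((1/2)^n * (e / 3)) \<le> 1 * ((1/2)^n * (e / 3))"
        using a1[OF n] e by (intro mult_right_mono) auto
      finally show "a n * ((1/2)^n * weight n \<phi>) \<le> a n * ((1/2)^n * integ \<phi> (L n)) + (1/2)^n * (e / 3)" by simp
    qed
    also have "\<dots> = integ \<phi> ?g + (\<Sum>n\<in>F. (1/2)^n) * (e / 3)"
      by (simp add: integ[OF Fa(1) L(1)] sum.distrib sum_distrib_right)
    also have "(\<Sum>n\<in>F. (1/2)^n) * (e / 3) \<le> 2 * (e / 3)"
      using sum_half_powers_le[OF Fa(1)] e by (intro mult_right_mono) auto
    finally have "?R \<le> integ \<phi> ?g + e" using Fa(4) by simp
    moreover have "?g \<in> l2_comb" unfolding l2_comb_def using Fa L(1) by blast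
    then have "integ \<phi> ?g \<le> ?L" using bdd by (intro cSUP_upper) auto
    ultimately show "?R \<le> ?L + e" by simp
  qed
qed

end

lemma weight_subadd:
  assumes "\<phi> \<in> dual" "\<psi> \<in> dual"
  shows "weight n (\<lambda>f. \<phi> f + \<psi> f) \<le> weight n \<phi> + weight n \<psi>"
  unfolding weight_def[of n "\<lambda>f. \<phi> f + \<psi> f"]
proof (rule cSUP_least[OF L_nonempty])
  fix L assume L: "L \<in> \<L> n"
  show "integ (\<lambda>f. \<phi> f + \<psi> f) L \<le> weight n \<phi> + weight n \<psi>"
    using integ_subadd[OF assms, of L 1] L_nonneg[OF L] L_le[OF L] integ_le_weight[OF assms(1) L]
      integ_le_weight[OF assms(2) L] by force
qed

text \<open>The dual norm is the l2 norm of the scaled weights, and each weight is subadditive, so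
  \<open>l2_strict\<close> applies to every index.\<close>

lemma weight_norm:
  "\<exists>N. equivalent_norm_on (C0 T) sup_norm N \<and> lattice_norm (C0 T) N \<and>
    (\<forall>\<phi>\<in>dual. \<forall>\<psi>\<in>dual.
      dual_norm (C0 T) N \<phi> = dual_norm (C0 T) N (\<lambda>f. \<phi> f + \<psi> f) / 2 \<longrightarrow>
      dual_norm (C0 T) N (\<lambda>f. \<phi> f + \<psi> f) / 2 = dual_norm (C0 T) N \<psi> \<longrightarrow>
      (\<forall>n. weight n \<phi> = weight n \<psi> \<and> weight n (\<lambda>f. \<phi> f + \<psi> f) = weight n \<phi> + weight n \<psi>))"
proof (intro exI[of _ "gauge_norm l2_comb"] conjI[of "equivalent_norm_on _ _ _"] conjI[of "lattice_norm _ _"] ballI impI allI)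
  note G = l2_comb_props l2_comb_convex l2_comb_one zero_less_numeral
  show "equivalent_norm_on (C0 T) sup_norm (gauge_norm l2_comb)"
    by (rule gauge_equivalent[of l2_comb 2]) (use G in auto)
  show "lattice_norm (C0 T) (gauge_norm l2_comb)"
    by (rule gauge_lattice[of l2_comb 2]) (use G in auto)
  have dn: "dual_norm (C0 T) (gauge_norm l2_comb) \<phi> = sqrt (\<Sum>\<^sub>\<infinity>n. ((1/2)^n * weight n \<phi>)\<^sup>2)"
    if "\<phi> \<in> dual" for \<phi>
  proof -
    have "dual_norm (C0 T) (gauge_norm l2_comb) \<phi> = (SUP g\<in>l2_comb. integ \<phi> g)"
      by (rule dual_norm_gauge[of l2_comb 2]) (use G that in auto)
    then show ?thesis using SUP_l2_comb[OF that] by simp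
  qed
  fix \<phi> \<psi> :: "('a \<Rightarrow> real) \<Rightarrow> real" and n :: nat
  let ?\<chi> = "\<lambda>f. \<phi> f + \<psi> f" and ?N = "gauge_norm l2_comb"
  assume \<phi>: "\<phi> \<in> dual" and \<psi>: "\<psi> \<in> dual"
    and eq: "dual_norm (C0 T) ?N \<phi> = dual_norm (C0 T) ?N ?\<chi> / 2"
      "dual_norm (C0 T) ?N ?\<chi> / 2 = dual_norm (C0 T) ?N \<psi>"
  note \<chi> = dual_plus[OF \<phi> \<psi>]
  have z: "0 \<le> (1/2)^n * weight n ?\<chi>" "(1/2)^n * weight n ?\<chi> \<le> (1/2)^n * weight n \<phi> + (1/2)^n * weight n \<psi>" for n
    using weight_nonneg[OF \<chi>, of n] weight_subadd[OF \<phi> \<psi>, of n]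
    by (auto simp: distrib_left[symmetric])
  note l2 = l2_strict[OF weight_summable[OF \<phi>] weight_summable[OF \<psi>] z
      eq[unfolded dn[OF \<phi>] dn[OF \<psi>] dn[OF \<chi>]] UNIV_I, of n]
  show "weight n \<phi> = weight n \<psi> \<and> weight n ?\<chi> = weight n \<phi> + weight n \<psi>"
    using l2 by (simp add: distrib_left[symmetric])
qed

end

end

section \<open>Seminorms from an open set and a disjoint family around it\<close>

context order_tree
begin

abbreviation opn :: "'a set \<Rightarrow> bool" where "opn \<equiv> openin (interval_topology T)"

lemma opnD:
  assumes "opn U" "t \<in> U"
  obtains A where "A \<in> lowers t" "seg t - A \<subseteq> U"
  using assms unfolding openin_interval_iff by blast

abbreviation vol :: "(('a \<Rightarrow> real) \<Rightarrow> real) \<Rightarrow> 'a set \<Rightarrow> real" where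
  "vol \<phi> S \<equiv> integ \<phi> (indicator S)"

lemma vol_infsum: "vol \<phi> S = (\<Sum>\<^sub>\<infinity>t\<in>S. \<bar>mass \<phi> t\<bar>)"
  unfolding integ_def by (rule infsum_cong_neutral) (auto simp: indicator_def)

lemma vol_nonneg: "0 \<le> vol \<phi> S"
  by (intro integ_nonneg) simp

definition admissible :: "'a set \<Rightarrow> 'a set set \<Rightarrow> bool" where
  "admissible R PP \<longleftrightarrow> opn R \<and> (\<forall>P\<in>PP. P \<inter> R = {} \<and> opn (R \<union> P)) \<and>
     (\<forall>P\<in>PP. \<forall>Q\<in>PP. P \<noteq> Q \<longrightarrow> P \<inter> Q = {})"

text \<open>Integrating \<open>\<bar>\<mu>\<bar>\<close> against these functions gives the seminorm
  \<open>\<bar>\<mu>\<bar>(R) + sqrt (\<Sum>P. \<bar>\<mu>\<bar>(P)\<^sup>2)\<close>; they are lower semicontinuous because the coefficients are at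
  most \<open>1\<close>, although the members of \<open>PP\<close> need not be open.\<close>

definition shape :: "'a set \<Rightarrow> 'a set set \<Rightarrow> ('a \<Rightarrow> real) set" where
  "shape R PP = {g. \<exists>F a. finite F \<and> F \<subseteq> PP \<and> (\<forall>P. 0 \<le> a P) \<and> (\<Sum>P\<in>F. (a P)\<^sup>2) \<le> 1 \<and>
     g = (\<lambda>t. indicator R t + (\<Sum>P\<in>F. a P * indicator P t))}"

context
  fixes R PP assumes adm: "admissible R PP"
begin

lemma
  shows opn_R: "opn R" and disjnt_R: "\<And>P. P \<in> PP \<Longrightarrow> P \<inter> R = {}" and opn_R_Un: "\<And>P. P \<in> PP \<Longrightarrow> opn (R \<union> P)"
    and disjnt_PP: "\<And>P Q. P \<in> PP \<Longrightarrow> Q \<in> PP \<Longrightarrow> P \<noteq> Q \<Longrightarrow> P \<inter> Q = {}"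
  using adm unfolding admissible_def by simp_all

lemma shape_sum:
  assumes "finite F" "F \<subseteq> PP" "P \<in> F" "t \<in> P"
  shows "(\<Sum>Q\<in>F. a Q * indicator Q t) = (a P :: real)"
proof -
  have "(\<Sum>Q\<in>F. a Q * indicator Q t) = (\<Sum>Q\<in>{P}. a Q * indicator Q t)"
  proof (rule sum.mono_neutral_right)
    show "\<forall>Q\<in>F - {P}. a Q * indicator Q t = 0"
    proof
      fix Q assume "Q \<in> F - {P}"
      then have "Q \<inter> P = {}" using disjnt_PP assms(2,3) by (metis DiffE insertI1 subsetD)
      then show "a Q * indicator Q t = 0" using assms(4) by (auto simp: indicator_def)
    qed
  qed (use assms in auto)
  then show ?thesis using assms(4) by simp
qed

lemma shape_props:
  assumes "g \<in> shape R PP"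
  shows "0 \<le> g t" "g t \<le> 1" "lsc g"
proof -
  obtain F a where g: "finite F" "F \<subseteq> PP" "\<And>P. 0 \<le> a P" "(\<Sum>P\<in>F. (a P)\<^sup>2) \<le> 1"
    "g = (\<lambda>t. indicator R t + (\<Sum>P\<in>F. a P * indicator P t))"
    using assms unfolding shape_def by blast
  show nonneg: "0 \<le> g t" for t unfolding g(5) using g(3) by (intro add_nonneg_nonneg sum_nonneg) auto
  have a1: "a P \<le> 1" if "P \<in> F" for P
  proof -
    have "(a P)\<^sup>2 \<le> (\<Sum>P\<in>F. (a P)\<^sup>2)" using that g(1) by (intro member_le_sum) auto
    then show ?thesis using g(4) by (intro power2_le_imp_le[of "a P" 1]) auto
  qed
  have gR: "g t = 1" if "t \<in> R" for t
  proof -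
    have "a P * indicator P t = 0" if "P \<in> F" for P
      using disjnt_R[of P] \<open>t \<in> R\<close> that g(2) by (auto simp: indicator_def)
    then have "(\<Sum>P\<in>F. a P * indicator P t) = 0" by (intro sum.neutral) blast
    then show ?thesis using that by (simp add: g(5))
  qed
  have gP: "g t = a P" if "P \<in> F" "t \<in> P" for P t
  proof -
    have "t \<notin> R" using disjnt_R[of P] that g(2) by blast
    then show ?thesis using shape_sum[OF g(1,2) that, of a] by (simp add: g(5))
  qed
  have g0: "g t = 0" if "t \<notin> R" "\<And>P. P \<in> F \<Longrightarrow> t \<notin> P" for t
    unfolding g(5) using that by (auto intro!: sum.neutral)
  show "g t \<le> 1"
  proof (cases "\<exists>P\<in>F. t \<in> P")
    case True
    then show ?thesis using gP a1 by metis
  next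
    case False
    then show ?thesis using gR[of t] g0[of t] by (cases "t \<in> R") auto
  qed
  show "lsc g"
    unfolding lsc_def
  proof (intro ballI allI impI)
    fix t and d :: real assume t: "t \<in> T" and d: "d > 0"
    consider P where "P \<in> F" "t \<in> P" | "t \<in> R" | "t \<notin> R" "\<And>P. P \<in> F \<Longrightarrow> t \<notin> P" by blast
    then show "\<exists>A\<in>lowers t. \<forall>s\<in>seg t - A. g t - d \<le> g s"
    proof cases
      \<comment> \<open>Near a point of \<open>P\<close> only points of \<open>R\<close> and of
        \<open>P\<close> occur, with values 1 and \<open>a P\<close>, and \<open>a P\<close> is at
        most 1.\<close>
      case 1
      then have "opn (R \<union> P)" "t \<in> R \<union> P" using opn_R_Un g(2) by auto
      then obtain A where A: "A \<in> lowers t" "seg t - A \<subseteq> R \<union> P" by (rule opnD)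
      have "g t - d \<le> g s" if "s \<in> seg t - A" for s
        using A(2) that gP[OF 1] gP[OF 1(1), of s] gR[of s] a1[OF 1(1)] d by auto
      then show ?thesis using A(1) by blast
    next
      case 2
      obtain A where A: "A \<in> lowers t" "seg t - A \<subseteq> R" by (rule opnD[OF opn_R 2])
      have "g t - d \<le> g s" if "s \<in> seg t - A" for s
        using A(2) that gR[OF 2] gR[of s] d by auto
      then show ?thesis using A(1) by blast
    next
      case 3
      then have "g t - d \<le> g s" for s using g0[OF 3] nonneg[of s] d by linarith
      then show ?thesis using empty_lowers by blast
    qed
  qed
qed

lemma shape_nonempty: "indicator R \<in> shape R PP"
  unfolding shape_def by (auto intro!: exI[of _ "{}"] exI[of _ "\<lambda>_. 0"])

lemma shape_convex:
  assumes "g \<in> shape R PP" "h \<in> shape R PP" "0 \<le> \<theta>" "\<theta> \<le> 1"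
  shows "(\<lambda>t. \<theta> * g t + (1 - \<theta>) * h t) \<in> shape R PP"
proof -
  obtain F a where g: "finite F" "F \<subseteq> PP" "\<And>P. 0 \<le> a P" "(\<Sum>P\<in>F. (a P)\<^sup>2) \<le> 1"
    "g = (\<lambda>t. indicator R t + (\<Sum>P\<in>F. a P * indicator P t))"
    using assms(1) unfolding shape_def by blast
  obtain G b where h: "finite G" "G \<subseteq> PP" "\<And>P. 0 \<le> b P" "(\<Sum>P\<in>G. (b P)\<^sup>2) \<le> 1"
    "h = (\<lambda>t. indicator R t + (\<Sum>P\<in>G. b P * indicator P t))"
    using assms(2) unfolding shape_def by blast
  define c where "c P = \<theta> * (if P \<in> F then a P else 0) + (1 - \<theta>) * (if P \<in> G then b P else 0)" for P
  have c: "0 \<le> c P" for P using g(3) h(3) assms(3,4) by (auto simp: c_def)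
  have "\<theta> * g t + (1 - \<theta>) * h t = indicator R t + (\<Sum>P\<in>F \<union> G. c P * indicator P t)" for t
  proof -
    have "(\<Sum>P\<in>F. a P * indicator P t) = (\<Sum>P\<in>F \<union> G. (if P \<in> F then a P else 0) * indicator P t)"
      using g(1) h(1) by (intro sum.mono_neutral_cong_left) auto
    moreover have "(\<Sum>P\<in>G. b P * indicator P t) = (\<Sum>P\<in>F \<union> G. (if P \<in> G then b P else 0) * indicator P t)"
      using g(1) h(1) by (intro sum.mono_neutral_cong_left) auto
    ultimately have "\<theta> * g t + (1 - \<theta>) * h t = (\<theta> + (1 - \<theta>)) * indicator R t +
        (\<theta> * (\<Sum>P\<in>F \<union> G. (if P \<in> F then a P else 0) * indicator P t) +
        (1 - \<theta>) * (\<Sum>P\<in>F \<union> G. (if P \<in> G then b P else 0) * indicator P t))"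
      unfolding g(5) h(5) by (simp only: distrib_left distrib_right add_ac)
    also have "\<theta> * (\<Sum>P\<in>F \<union> G. (if P \<in> F then a P else 0) * indicator P t) +
        (1 - \<theta>) * (\<Sum>P\<in>F \<union> G. (if P \<in> G then b P else 0) * indicator P t) = (\<Sum>P\<in>F \<union> G. c P * indicator P t)"
      unfolding c_def distrib_right sum.distrib sum_distrib_left by (simp only: mult.assoc)
    finally show ?thesis by simp
  qed
  moreover have "(\<Sum>P\<in>F \<union> G. (c P)\<^sup>2) \<le> 1"
    using l2_convex[OF g(1) h(1) g(4) h(4) assms(3,4)] by (simp add: c_def)
  ultimately show ?thesis
    unfolding shape_def mem_Collect_eq using g(1,2) h(1,2) c
    by (intro exI[of _ "F \<union> G"] exI[of _ c]) auto
qed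

context
  fixes \<phi> assumes \<phi>: "\<phi> \<in> dual"
begin

lemma integ_shape:
  assumes "finite F"
  shows "integ \<phi> (\<lambda>t. indicator R t + (\<Sum>P\<in>F. a P * indicator P t)) = vol \<phi> R + (\<Sum>P\<in>F. a P * vol \<phi> P)"
proof -
  have "integ \<phi> (\<lambda>t. \<Sum>P\<in>F. a P * indicator P t) = (\<Sum>P\<in>F. a P * vol \<phi> P)"
    using integ_sum[OF \<phi> assms, of indicator 1 a] by simp
  moreover have "\<bar>\<Sum>P\<in>F. a P * indicator P t\<bar> \<le> (\<Sum>P\<in>F. \<bar>a P\<bar>)" for t
    by (rule order_trans[OF sum_abs]) (auto simp: indicator_def intro!: sum_mono)
  then have "(\<lambda>t. \<bar>mass \<phi> t\<bar> * (\<Sum>P\<in>F. a P * indicator P t)) summable_on UNIV"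
    by (rule integ_summable[OF \<phi>])
  moreover have "(\<lambda>t. \<bar>mass \<phi> t\<bar> * indicator R t) summable_on UNIV"
    by (rule integ_summable[OF \<phi>, of _ 1]) simp
  ultimately show ?thesis
    by (simp add: integ_def distrib_left infsum_add)
qed

lemma vol_sum_le:
  assumes "finite F" "F \<subseteq> PP"
  shows "(\<Sum>P\<in>F. vol \<phi> P) \<le> integ \<phi> (\<lambda>_. 1)"
proof -
  have "(\<Sum>P\<in>F. vol \<phi> P) = (\<Sum>P\<in>F. 1 * vol \<phi> P)" by simp
  also have "\<dots> = integ \<phi> (\<lambda>t. \<Sum>P\<in>F. 1 * indicator P t)"
    using integ_sum[OF \<phi> assms(1), of indicator 1 "\<lambda>_. 1"] by simp
  also have "\<dots> \<le> integ \<phi> (\<lambda>_. 1)"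
  proof (rule integ_mono[OF \<phi>, of _ _ 1])
    show "0 \<le> (\<Sum>P\<in>F. 1 * indicator P t :: real)" for t by (intro sum_nonneg) simp
    show "(\<Sum>P\<in>F. 1 * indicator P t :: real) \<le> 1" for t
    proof (cases "\<exists>P\<in>F. t \<in> P")
      case True
      then obtain P where "P \<in> F" "t \<in> P" by blast
      from shape_sum[OF assms this, of "\<lambda>_. 1"] show ?thesis by simp
    next
      case False
      then have "(\<Sum>P\<in>F. 1 * indicator P t :: real) = 0" by (intro sum.neutral) auto
      then show ?thesis by simp
    qed
  qed simp
  finally show ?thesis .
qed

lemma vol_square_summable: "(\<lambda>P. (vol \<phi> P)\<^sup>2) summable_on PP"
proof (rule nonneg_bdd_above_summable_on)
  let ?t = "integ \<phi> (\<lambda>_. 1)"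
  show "bdd_above (sum (\<lambda>P. (vol \<phi> P)\<^sup>2) ` {F. F \<subseteq> PP \<and> finite F})"
  proof (rule bdd_aboveI2)
    fix F assume F: "F \<in> {F. F \<subseteq> PP \<and> finite F}"
    have "(\<Sum>P\<in>F. (vol \<phi> P)\<^sup>2) \<le> (\<Sum>P\<in>F. ?t * vol \<phi> P)"
    proof (rule sum_mono)
      fix P
      have "vol \<phi> P \<le> ?t" by (rule integ_mono[OF \<phi>, of _ _ 1]) auto
      then show "(vol \<phi> P)\<^sup>2 \<le> ?t * vol \<phi> P"
        unfolding power2_eq_square by (intro mult_right_mono vol_nonneg)
    qed
    also have "\<dots> = ?t * (\<Sum>P\<in>F. vol \<phi> P)" by (simp add: sum_distrib_left)
    also have "\<dots> \<le> ?t * ?t" using vol_sum_le F by (intro mult_left_mono integ_nonneg) auto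
    finally show "(\<Sum>P\<in>F. (vol \<phi> P)\<^sup>2) \<le> ?t * ?t" .
  qed
qed simp

lemma SUP_shape: "(SUP g\<in>shape R PP. integ \<phi> g) = vol \<phi> R + sqrt (\<Sum>\<^sub>\<infinity>P\<in>PP. (vol \<phi> P)\<^sup>2)" (is "?L = ?R")
proof (rule antisym)
  have upper: "integ \<phi> g \<le> ?R" if mem: "g \<in> shape R PP" for g
  proof -
    obtain F a where g: "finite F" "F \<subseteq> PP" "\<And>P. 0 \<le> a P" "(\<Sum>P\<in>F. (a P)\<^sup>2) \<le> 1"
      "g = (\<lambda>t. indicator R t + (\<Sum>P\<in>F. a P * indicator P t))"
      using mem unfolding shape_def by blast
    show ?thesis unfolding g(5) integ_shape[OF g(1)]
      using l2_le[OF g(1,2) vol_square_summable g(4)] by simp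
  qed
  then show "?L \<le> ?R" using shape_nonempty by (intro cSUP_least) auto
  have bdd: "bdd_above (integ \<phi> ` shape R PP)" using upper by (intro bdd_aboveI2) auto
  show "?R \<le> ?L"
  proof (rule field_le_epsilon)
    fix e :: real assume e: "e > 0"
    obtain F a where Fa: "finite F" "F \<subseteq> PP" "\<And>P. 0 \<le> a P" "(\<Sum>P\<in>F. (a P)\<^sup>2) \<le> 1"
      "sqrt (\<Sum>\<^sub>\<infinity>P\<in>PP. (vol \<phi> P)\<^sup>2) - e \<le> (\<Sum>P\<in>F. a P * vol \<phi> P)"
      using l2_approx[OF vol_square_summable vol_nonneg e] by (elim exE conjE) blast
    have "(\<lambda>t. indicator R t + (\<Sum>P\<in>F. a P * indicator P t)) \<in> shape R PP"
      unfolding shape_def using Fa by blast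
    from cSUP_upper[OF this bdd] have "vol \<phi> R + (\<Sum>P\<in>F. a P * vol \<phi> P) \<le> ?L"
      unfolding integ_shape[OF Fa(1)] .
    then show "?R \<le> ?L + e" using Fa(5) by simp
  qed
qed

end

end

lemma indicator_singleton_shape: "indicator P \<in> shape {} {P}"
  unfolding shape_def by (auto intro!: exI[of _ "{P}"] exI[of _ "\<lambda>_. 1"])

text \<open>By \<open>single\<close> the mass of each open set \<open>fst (Q n)\<close> is itself
  one of the weights. Subtracting it leaves equality for the square roots alone, to which
  \<open>l2_strict\<close> applies a second time, now over the members of one family. The hypothesis
  \<open>Q0\<close> provides \<open>indicator T\<close>, which the gauge needs in order to be
  equivalent to the sup norm.\<close>

proposition norm_for_families:
  fixes Q :: "nat \<Rightarrow> 'a set \<times> 'a set set"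
  assumes adm: "\<And>n. admissible (fst (Q n)) (snd (Q n))"
    and Q0: "Q 0 = ({}, {T})" and single: "\<And>n. \<exists>m. Q m = ({}, {fst (Q n)})"
  shows "\<exists>N. equivalent_norm_on (C0 T) sup_norm N \<and> lattice_norm (C0 T) N \<and>
    (\<forall>\<phi>\<in>dual. \<forall>\<psi>\<in>dual.
      dual_norm (C0 T) N \<phi> = dual_norm (C0 T) N (\<lambda>f. \<phi> f + \<psi> f) / 2 \<longrightarrow>
      dual_norm (C0 T) N (\<lambda>f. \<phi> f + \<psi> f) / 2 = dual_norm (C0 T) N \<psi> \<longrightarrow>
      (\<forall>n. \<forall>P\<in>snd (Q n). vol \<phi> P = vol \<psi> P \<and> vol (\<lambda>f. \<phi> f + \<psi> f) P = vol \<phi> P + vol \<psi> P))"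
proof -
  define \<L> where "\<L> n = shape (fst (Q n)) (snd (Q n))" for n
  have ne: "\<L> n \<noteq> {}" for n using shape_nonempty[OF adm] unfolding \<L>_def by blast
  have one: "indicator T \<in> \<L> 0" using indicator_singleton_shape by (simp add: \<L>_def Q0)
  note L = shape_props[OF adm, folded \<L>_def] shape_convex[OF adm, folded \<L>_def] ne one
  have w: "weight \<L> n \<phi> = vol \<phi> (fst (Q n)) + sqrt (\<Sum>\<^sub>\<infinity>P\<in>snd (Q n). (vol \<phi> P)\<^sup>2)" if "\<phi> \<in> dual" for n \<phi>
  proof -
    have "weight \<L> n \<phi> = (SUP L\<in>\<L> n. integ \<phi> L)"
      by (rule weight_def) (rule L; assumption)+
    then show ?thesis using SUP_shape[OF adm that] by (simp add: \<L>_def)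
  qed
  have "\<exists>N. equivalent_norm_on (C0 T) sup_norm N \<and> lattice_norm (C0 T) N \<and>
    (\<forall>\<phi>\<in>dual. \<forall>\<psi>\<in>dual.
      dual_norm (C0 T) N \<phi> = dual_norm (C0 T) N (\<lambda>f. \<phi> f + \<psi> f) / 2 \<longrightarrow>
      dual_norm (C0 T) N (\<lambda>f. \<phi> f + \<psi> f) / 2 = dual_norm (C0 T) N \<psi> \<longrightarrow>
      (\<forall>n. weight \<L> n \<phi> = weight \<L> n \<psi> \<and> weight \<L> n (\<lambda>f. \<phi> f + \<psi> f) = weight \<L> n \<phi> + weight \<L> n \<psi>))"
  proof (rule weight_norm)
    show "0 \<le> L t" "L t \<le> 1" "lsc L" if "L \<in> \<L> n" for n L t using L(1-3)[OF that] .
    show "(\<lambda>t. \<theta> * L t + (1 - \<theta>) * K t) \<in> \<L> n" if "L \<in> \<L> n" "K \<in> \<L> n" "0 \<le> \<theta>" "\<theta> \<le> 1" for n L K \<theta>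
      using L(4)[OF that] .
  qed (rule ne, rule one)
  then obtain N where N: "equivalent_norm_on (C0 T) sup_norm N" "lattice_norm (C0 T) N"
    "\<And>\<phi> \<psi> n. \<phi> \<in> dual \<Longrightarrow> \<psi> \<in> dual \<Longrightarrow>
      dual_norm (C0 T) N \<phi> = dual_norm (C0 T) N (\<lambda>f. \<phi> f + \<psi> f) / 2 \<Longrightarrow>
      dual_norm (C0 T) N (\<lambda>f. \<phi> f + \<psi> f) / 2 = dual_norm (C0 T) N \<psi> \<Longrightarrow>
      weight \<L> n \<phi> = weight \<L> n \<psi> \<and> weight \<L> n (\<lambda>f. \<phi> f + \<psi> f) = weight \<L> n \<phi> + weight \<L> n \<psi>"
    by blast
  show ?thesis
  proof (intro exI[of _ N] conjI[of "equivalent_norm_on _ _ _"] conjI[of "lattice_norm _ _"] N(1,2) ballI impI allI)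
    fix \<phi> \<psi> :: "('a \<Rightarrow> real) \<Rightarrow> real" and n P
    let ?\<chi> = "\<lambda>f. \<phi> f + \<psi> f"
    assume \<phi>: "\<phi> \<in> dual" and \<psi>: "\<psi> \<in> dual"
      and eq: "dual_norm (C0 T) N \<phi> = dual_norm (C0 T) N ?\<chi> / 2" "dual_norm (C0 T) N ?\<chi> / 2 = dual_norm (C0 T) N \<psi>"
      and P: "P \<in> snd (Q n)"
    note \<chi> = dual_plus[OF \<phi> \<psi>]
    note W = N(3)[OF \<phi> \<psi> eq]
    obtain m where m: "Q m = ({}, {fst (Q n)})" using single by blast
    have zero: "vol \<xi> {} = 0" for \<xi> by (simp add: integ_def)
    have wm: "weight \<L> m \<xi> = vol \<xi> (fst (Q n))" if "\<xi> \<in> dual" for \<xi>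
      using w[OF that, of m] m zero vol_nonneg by simp
    have R: "vol \<phi> (fst (Q n)) = vol \<psi> (fst (Q n))"
      "vol ?\<chi> (fst (Q n)) = vol \<phi> (fst (Q n)) + vol \<psi> (fst (Q n))"
      using W[of m] wm[OF \<phi>] wm[OF \<psi>] wm[OF \<chi>] by auto
    have sub: "vol ?\<chi> P \<le> vol \<phi> P + vol \<psi> P" for P
      by (rule integ_subadd[OF \<phi> \<psi>, of _ 1]) auto
    have e1: "sqrt (\<Sum>\<^sub>\<infinity>P\<in>snd (Q n). (vol \<phi> P)\<^sup>2) = sqrt (\<Sum>\<^sub>\<infinity>P\<in>snd (Q n). (vol ?\<chi> P)\<^sup>2) / 2"
      and e2: "sqrt (\<Sum>\<^sub>\<infinity>P\<in>snd (Q n). (vol ?\<chi> P)\<^sup>2) / 2 = sqrt (\<Sum>\<^sub>\<infinity>P\<in>snd (Q n). (vol \<psi> P)\<^sup>2)"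
      using W[of n] R unfolding w[OF \<phi>] w[OF \<psi>] w[OF \<chi>] by linarith+
    from l2_strict[OF vol_square_summable[OF adm \<phi>] vol_square_summable[OF adm \<psi>] vol_nonneg sub e1 e2 P]
    show "vol \<phi> P = vol \<psi> P \<and> vol ?\<chi> P = vol \<phi> P + vol \<psi> P" by blast
  qed
qed

end

section \<open>Separating the points of the tree by cells\<close>

context order_tree
begin

definition isolated :: "'a \<Rightarrow> bool" where
  "isolated c \<longleftrightarrow> c \<in> T \<and> (\<exists>A\<in>lowers c. seg c - A = {c})"

lemma not_isolatedD:
  assumes "x \<in> T" "\<not> isolated x" "A \<in> lowers x"
  obtains w where "w \<in> seg x - A" "w < x"
proof -
  have "x \<in> seg x - A" using assms not_mem_lowers by (auto simp: mem_seg)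
  moreover have "seg x - A \<noteq> {x}" using assms unfolding isolated_def by blast
  ultimately obtain w where "w \<in> seg x - A" "w \<noteq> x" by blast
  then show ?thesis using that by (auto simp: mem_seg less_le)
qed

lemma lowers_relocate:
  assumes "t \<in> T" "A \<in> lowers t" "z \<in> seg t" "z \<notin> A"
  shows "A \<in> lowers z"
  using assms(2)
proof (cases rule: lowers_cases)
  case (seg s)
  then have "s \<in> seg t" by (simp add: mem_seg)
  then have "s < z" using seg_linear[OF assms(1) _ assms(3)] assms(3,4) seg by (auto simp: mem_seg less_le)
  then show ?thesis using seg seg_lowers by simp
qed simp

context
  fixes feat :: "real \<times> real \<Rightarrow> 'a \<Rightarrow> real set \<times> bool"
begin

text \<open>Constancy is required on the whole interval from \<open>c\<close> to \<open>x\<close>,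
  so a cell is connected downwards to its starting point. A set of indices, rather than a single
  one, makes intersections of cells into cells.\<close>

definition cell :: "(real \<times> real) set \<Rightarrow> 'a \<Rightarrow> 'a set" where
  "cell \<sigma> c = {x \<in> T. c \<le> x \<and> (\<forall>w\<in>T. c \<le> w \<and> w \<le> x \<longrightarrow> (\<forall>i\<in>\<sigma>. feat i w = feat i c))}"

text \<open>Isolated starting points make cells open; keeping only the earliest ones makes cells
  with different roots disjoint.\<close>

definition root :: "(real \<times> real) set \<Rightarrow> 'a \<Rightarrow> bool" where
  "root \<sigma> c \<longleftrightarrow> isolated c \<and> (\<forall>c'. isolated c' \<longrightarrow> c' < c \<longrightarrow> c \<notin> cell \<sigma> c')"

lemma cellD:
  assumes "x \<in> cell \<sigma> c"
  shows "x \<in> T" "c \<le> x" "\<And>w i. w \<in> T \<Longrightarrow> c \<le> w \<Longrightarrow> w \<le> x \<Longrightarrow> i \<in> \<sigma> \<Longrightarrow> feat i w = feat i c"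
  using assms unfolding cell_def by blast+

lemma root_mem: "root \<sigma> c \<Longrightarrow> c \<in> T"
  by (simp add: root_def isolated_def)

lemma cell_between: "x \<in> cell \<sigma> c \<Longrightarrow> w \<in> T \<Longrightarrow> c \<le> w \<Longrightarrow> w \<le> x \<Longrightarrow> w \<in> cell \<sigma> c"
  unfolding cell_def by (blast intro: order_trans)

lemma opn_cell:
  assumes "isolated c"
  shows "opn (cell \<sigma> c)"
  unfolding openin_interval_iff
proof (intro conjI ballI)
  fix x assume x: "x \<in> cell \<sigma> c"
  have xT: "x \<in> T" and cx: "c \<le> x" using cellD(1,2)[OF x] .
  obtain A where A: "A \<in> lowers c" "seg c - A = {c}" using assms unfolding isolated_def by blast
  have "w \<in> cell \<sigma> c" if w: "w \<in> seg x - A" for w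
  proof -
    have "c \<in> seg x" using cx assms by (simp add: mem_seg isolated_def)
    then have "w \<le> c \<or> c \<le> w" using seg_linear[OF xT] w by blast
    then have "c \<le> w"
    proof
      assume "w \<le> c"
      then have "w \<in> seg c - A" using w by (simp add: mem_seg)
      then show ?thesis using A(2) by simp
    qed
    then show ?thesis using cell_between[OF x] w by (simp add: mem_seg)
  qed
  then show "\<exists>A\<in>lowers x. seg x - A \<subseteq> cell \<sigma> c" using lowers_trans[OF A(1) cx] by blast
qed (auto simp: cell_def)

lemma cell_trans:
  assumes "c \<in> T" and d: "d \<in> cell \<sigma> c" and x: "x \<in> cell \<sigma> d"
  shows "x \<in> cell \<sigma> c"
  unfolding cell_def
proof (intro CollectI conjI ballI impI)
  show xT: "x \<in> T" using cellD(1)[OF x] .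
  show "c \<le> x" using cellD(2)[OF d] cellD(2)[OF x] by (rule order_trans)
  have dx: "d \<in> seg x" using cellD(2)[OF x] cellD(1)[OF d] by (simp add: mem_seg)
  fix w i assume w: "w \<in> T" "c \<le> w \<and> w \<le> x" and i: "i \<in> \<sigma>"
  have "w \<le> d \<or> d \<le> w" using seg_linear[OF xT _ dx, of w] w by (simp add: mem_seg)
  then show "feat i w = feat i c"
  proof
    assume "w \<le> d"
    then show ?thesis using cellD(3)[OF d w(1)] w(2) i by blast
  next
    assume "d \<le> w"
    then have "feat i w = feat i d" using cellD(3)[OF x w(1)] w(2) i by blast
    also have "\<dots> = feat i c" using cellD(3)[OF d cellD(1,2)[OF d] order_refl i] .
    finally show ?thesis .
  qed
qed

lemma cells_disjoint:
  assumes "root \<sigma> c" "root \<sigma> d" "cell \<sigma> c \<inter> cell \<sigma> d \<noteq> {}"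
  shows "c = d"
proof -
  obtain x where x: "x \<in> cell \<sigma> c" "x \<in> cell \<sigma> d" using assms(3) by blast
  have not: "\<not> c < d" if "root \<sigma> c" "root \<sigma> d" "x \<in> cell \<sigma> c" "d \<le> x" for c d
  proof
    assume "c < d"
    then have "d \<in> cell \<sigma> c"
      using cell_between[OF that(3) root_mem[OF that(2)]] that(4) by (simp add: less_imp_le)
    then show False using \<open>c < d\<close> that(1,2) unfolding root_def by blast
  qed
  have "c \<in> seg x" "d \<in> seg x"
    using root_mem[OF assms(1)] root_mem[OF assms(2)] cellD(2)[OF x(1)] cellD(2)[OF x(2)]
    by (auto simp: mem_seg)
  then have "c \<le> d \<or> d \<le> c" using seg_linear[OF cellD(1)[OF x(1)]] by blast
  then show ?thesis
    using not[OF assms(1,2) x(1) cellD(2)[OF x(2)]] not[OF assms(2,1) x(2) cellD(2)[OF x(1)]]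
    by (auto simp: less_le)
qed

text \<open>The roots of two meeting cells are comparable, and the intersection is the joint cell of
  the larger one, which remains a root because joint cells are smaller. This closure is what
  \<open>separated_zero\<close> asks for.\<close>

lemma cell_Int:
  assumes c: "root \<sigma> c" and d: "root \<tau> d" and ne: "cell \<sigma> c \<inter> cell \<tau> d \<noteq> {}"
  shows "\<exists>e. root (\<sigma> \<union> \<tau>) e \<and> cell \<sigma> c \<inter> cell \<tau> d = cell (\<sigma> \<union> \<tau>) e"
proof -
  have le: "\<exists>e. root (\<sigma> \<union> \<tau>) e \<and> cell \<sigma> c \<inter> cell \<tau> d = cell (\<sigma> \<union> \<tau>) e"
    if c: "root \<sigma> c" and d: "root \<tau> d" and cd: "c \<le> d" and x: "x \<in> cell \<sigma> c" "x \<in> cell \<tau> d" for \<sigma> \<tau> c d x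
  proof -
    have dT: "d \<in> T" using d by (rule root_mem)
    have dc: "d \<in> cell \<sigma> c" using cell_between[OF x(1) dT cd] x(2) by (simp add: cell_def)
    have "root (\<sigma> \<union> \<tau>) d"
      using d unfolding root_def cell_def by blast
    moreover have "cell \<sigma> c \<inter> cell \<tau> d = cell (\<sigma> \<union> \<tau>) d"
    proof (intro equalityI subsetI)
      fix z assume z: "z \<in> cell \<sigma> c \<inter> cell \<tau> d"
      have "feat i w = feat i d" if w: "w \<in> T" "d \<le> w \<and> w \<le> z" and i: "i \<in> \<sigma> \<union> \<tau>" for w i
      proof (cases "i \<in> \<tau>")
        case True
        then show ?thesis using z w by (simp add: cell_def)
      next
        case False
        then have "i \<in> \<sigma>" using i by blast
        moreover have "c \<le> w" using cd w(2) by (meson order_trans)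
        ultimately have "feat i w = feat i c" using z w by (simp add: cell_def)
        moreover have "feat i d = feat i c" using dc \<open>i \<in> \<sigma>\<close> cd dT by (simp add: cell_def)
        ultimately show ?thesis by simp
      qed
      then show "z \<in> cell (\<sigma> \<union> \<tau>) d" using z by (simp add: cell_def)
    next
      fix z assume z: "z \<in> cell (\<sigma> \<union> \<tau>) d"
      then have "z \<in> cell \<sigma> d" "z \<in> cell \<tau> d" by (auto simp: cell_def)
      then show "z \<in> cell \<sigma> c \<inter> cell \<tau> d" using cell_trans[OF root_mem[OF c] dc] by blast
    qed
    ultimately show ?thesis by blast
  qed
  obtain x where x: "x \<in> cell \<sigma> c" "x \<in> cell \<tau> d" using ne by blast
  then have "c \<le> d \<or> d \<le> c"
    using seg_linear[of x c d] root_mem[OF c] root_mem[OF d] by (simp add: cell_def mem_seg)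
  then show ?thesis
  proof
    assume "c \<le> d"
    then show ?thesis using le[OF c d _ x] by blast
  next
    assume "d \<le> c"
    then show ?thesis using le[OF d c _ x(2,1)] by (simp add: Int_commute Un_commute)
  qed
qed

lemma root_exists:
  assumes "isolated c'" "x \<in> cell \<sigma> c'"
  obtains c where "root \<sigma> c" "x \<in> cell \<sigma> c" "c \<le> c'"
proof -
  have xT: "x \<in> T" and c': "c' \<in> seg x"
    using cellD(1,2)[OF assms(2)] assms(1) by (simp_all add: mem_seg isolated_def)
  let ?S = "{c \<in> seg x. isolated c \<and> x \<in> cell \<sigma> c}"
  have "c' \<in> ?S" using assms c' by blast
  then obtain c where c: "c \<in> ?S" "\<And>d. d \<in> ?S \<Longrightarrow> c \<le> d"
    using seg_least[OF xT, of ?S] by blast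
  have "c \<notin> cell \<sigma> d" if d: "isolated d" "d < c" for d
  proof
    assume "c \<in> cell \<sigma> d"
    then have "x \<in> cell \<sigma> d" using cell_trans[of d c] c(1) d(1) by (simp add: isolated_def)
    moreover have "d \<in> seg x" using d c(1) by (auto simp: mem_seg isolated_def)
    ultimately have "c \<le> d" using c(2)[of d] d(1) by blast
    then show False using d(2) by simp
  qed
  then show ?thesis using that[of c] c \<open>c' \<in> ?S\<close> by (auto simp: root_def)
qed

text \<open>At an exit point \<open>x\<close> the feature is constant on a punctured neighbourhood of \<open>x\<close> but not at \<open>x\<close>.
  Exit points are isolated in the complement of the open set \<open>tame i\<close>.\<close>

definition tame :: "real \<times> real \<Rightarrow> 'a set" where
  "tame i = {z \<in> T. \<exists>A\<in>lowers z. \<forall>w\<in>seg z - A. feat i w = feat i z}"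

definition exits :: "real \<times> real \<Rightarrow> 'a set" where
  "exits i = {x \<in> T - tame i. opn (tame i \<union> {x})}"

lemma opn_tame: "opn (tame i)"
  unfolding openin_interval_iff
proof (intro conjI ballI)
  fix t assume "t \<in> tame i"
  then obtain A where t: "t \<in> T" and A: "A \<in> lowers t" "\<forall>w\<in>seg t - A. feat i w = feat i t"
    by (auto simp: tame_def)
  have "z \<in> tame i" if z: "z \<in> seg t - A" for z
  proof -
    have "A \<in> lowers z" using lowers_relocate[OF t A(1)] z by blast
    moreover have "seg z - A \<subseteq> seg t - A" using z seg_mono[of z t] by (auto simp: mem_seg)
    ultimately have "\<forall>w\<in>seg z - A. feat i w = feat i z" using A(2) z by (metis subsetD)
    moreover have "z \<in> T" using z seg_subset by blast
    ultimately show ?thesis using \<open>A \<in> lowers z\<close> unfolding tame_def by blast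
  qed
  then show "\<exists>A\<in>lowers t. seg t - A \<subseteq> tame i" using A(1) by blast
qed (auto simp: tame_def)

text \<open>Constancy on the open interval below \<open>x\<close> makes its points tame, so
  \<open>x\<close> is either tame or an exit point. The latter is excluded, and at a tame point that
  is not isolated the value is the one taken just below.\<close>

lemma feat_limit:
  assumes x: "x \<in> T" "\<not> isolated x" "x \<notin> exits i" and w0: "w0 \<in> T" "w0 < x"
    and const: "\<And>w. w \<in> T \<Longrightarrow> w0 < w \<Longrightarrow> w < x \<Longrightarrow> feat i w = v"
  shows "feat i x = v"
proof -
  have low: "seg w0 \<in> lowers x" using w0 seg_lowers by blast
  have gt: "w0 < w" if "w \<in> seg x - seg w0" for w
    using seg_linear[OF x(1), of w w0] that w0 by (auto simp: mem_seg less_le)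
  have tame: "w \<in> tame i" if w: "w \<in> seg x - seg w0" "w < x" for w
  proof -
    have wT: "w \<in> T" using w by (simp add: mem_seg)
    have "feat i z = feat i w" if "z \<in> seg w - seg w0" for z
    proof -
      have z: "z \<in> T" "z \<le> w" "z \<in> seg x - seg w0" using that w by (auto simp: mem_seg)
      then have "z < x" using w(2) by simp
      then show ?thesis using const[OF z(1) gt[OF z(3)]] const[OF wT gt[OF w(1)] w(2)] by simp
    qed
    moreover have "seg w0 \<in> lowers w" using lowers_relocate[OF x(1) low] w by blast
    ultimately show ?thesis using wT unfolding tame_def by blast
  qed
  have "opn (tame i \<union> {x})"
    unfolding openin_interval_iff
  proof (intro conjI ballI)
    fix t assume t: "t \<in> tame i \<union> {x}"
    show "\<exists>A\<in>lowers t. seg t - A \<subseteq> tame i \<union> {x}"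
    proof (cases "t = x")
      case True
      have "w \<in> tame i \<union> {x}" if "w \<in> seg x - seg w0" for w
        using tame[OF that] that by (cases "w = x") (auto simp: mem_seg less_le)
      then show ?thesis using True low by blast
    next
      case False
      then obtain A where "A \<in> lowers t" "seg t - A \<subseteq> tame i"
        using t opn_tame[of i] unfolding openin_interval_iff by blast
      then show ?thesis by blast
    qed
  qed (use x in \<open>auto simp: tame_def\<close>)
  then have "x \<in> tame i" using x unfolding exits_def by blast
  then obtain A where A: "A \<in> lowers x" "\<forall>w\<in>seg x - A. feat i w = feat i x" by (auto simp: tame_def)
  obtain w where "w \<in> seg x - (A \<union> seg w0)" "w < x"
    using not_isolatedD[OF x(1,2) lowers_Un[OF x(1) A(1) low]] by blast
  then show ?thesis using A(2) const[of w] gt[of w] by (auto simp: mem_seg)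
qed

end

end

text \<open>The first component is the truncation at height \<open>fst i\<close>. The second tells
  whether there is an element shortly above it: a node that has gained an element in
  \<open>{p<..q}\<close> is thereby distinguished from an earlier node with the same truncation at
  \<open>p\<close> and nothing in this gap.\<close>

definition cut_feat :: "('a \<Rightarrow> real set) \<Rightarrow> real \<times> real \<Rightarrow> 'a \<Rightarrow> real set \<times> bool" where
  "cut_feat K i w = (K w \<inter> {..fst i}, K w \<inter> {fst i<..snd i} = {})"

text \<open>\<open>d\<close> and \<open>d'\<close> are the first places where \<open>K\<close> and
  \<open>K'\<close> depart from \<open>L\<close>. If \<open>d < d'\<close>, then \<open>K'\<close>
  agrees with \<open>L\<close> at \<open>d\<close> and so misses it, which forces the first
  difference \<open>b\<close> of \<open>K\<close> and \<open>K'\<close> below \<open>d\<close>. But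
  there both agree with \<open>L\<close>.\<close>

lemma lex_less_first_mono:
  assumes d: "d \<in> K" "d \<notin> L" "L \<inter> {..<d} = K \<inter> {..<d}"
    and d': "d' \<in> K'" "d' \<notin> L" "L \<inter> {..<d'} = K' \<inter> {..<d'}"
    and "lex_less K K'"
  shows "d' \<le> (d::real)"
proof (rule ccontr)
  assume "\<not> d' \<le> d"
  then have lt: "d < d'" by simp
  obtain b where b: "b \<in> K'" "b \<notin> K" "K \<inter> {..<b} = K' \<inter> {..<b}"
    using assms(7) unfolding lex_less_def by blast
  have agree: "z \<in> L \<longleftrightarrow> z \<in> K" if "z < d" for z using d(3) that by blast
  have agree': "z \<in> L \<longleftrightarrow> z \<in> K'" if "z < d'" for z using d'(3) that by blast
  have agreeb: "z \<in> K \<longleftrightarrow> z \<in> K'" if "z < b" for z using b(3) that by blast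
  have "d \<notin> K'" using agree'[OF lt] d(2) by blast
  then have "\<not> d < b" using agreeb[of d] d(1) by blast
  then have "b < d" using b(2) d(1) by (metis linorder_neqE_linordered_idom)
  then show False using agree[of b] agree'[of b] b(1,2) lt by simp
qed

context order_tree
begin

context
  fixes K :: "'a \<Rightarrow> real set"
  assumes K_wo: "\<And>t. t \<in> T \<Longrightarrow> compact_wo (K t)"
    and K_less: "\<And>s t. s \<in> T \<Longrightarrow> t \<in> T \<Longrightarrow> s < t \<Longrightarrow> lex_less (K s) (K t)"
begin

text \<open>The points whose masses are controlled by their singletons: a singleton is open by
  itself, or together with an open set \<open>tame\<close>. All other points have to be separated by
  cells.\<close>

definition special :: "'a \<Rightarrow> bool" where
  "special x \<longleftrightarrow> isolated x \<or> (\<exists>p\<in>\<rat>. \<exists>q\<in>\<rat>. x \<in> exits (cut_feat K) (p, q))"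

text \<open>\<open>A\<close> is empty or the segment below some \<open>r < x\<close>; then \<open>L\<close> is empty or the value at \<open>r\<close>.
  The number \<open>first w\<close> is the first place where \<open>L\<close> and the value at \<open>w\<close> differ; it decreases with
  \<open>w\<close>, so it finally stays in one gap of the well-ordered set \<open>L\<close>.\<close>

lemma cell_above:
  assumes x: "x \<in> T" "\<not> special x" and A: "A \<in> lowers x"
  obtains p q c where "p \<in> \<rat>" "q \<in> \<rat>" "root (cut_feat K) {(p, q)} c"
    "x \<in> cell (cut_feat K) {(p, q)} c" "c \<notin> A"
proof -
  have iso: "\<not> isolated x" and exits: "\<And>p q. p \<in> \<rat> \<Longrightarrow> q \<in> \<rat> \<Longrightarrow> x \<notin> exits (cut_feat K) (p, q)"
    using x(2) unfolding special_def by blast+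
  define L where "L = (if A = {} then {} else K (SOME r. r \<in> T \<and> r < x \<and> A = seg r))"
  have LA: "(A = {} \<and> L = {}) \<or> (\<exists>r. r \<in> T \<and> r < x \<and> A = seg r \<and> L = K r)"
  proof (cases "A = {}")
    case False
    then have "\<exists>r. r \<in> T \<and> r < x \<and> A = seg r" using A by (auto simp: lowers_def)
    then show ?thesis using someI_ex[of "\<lambda>r. r \<in> T \<and> r < x \<and> A = seg r"] False by (auto simp: L_def)
  qed (simp add: L_def)
  have "\<exists>d. d \<in> K w \<and> d \<notin> L \<and> L \<inter> {..<d} = K w \<inter> {..<d}" if w: "w \<in> seg x - A" for w
  proof -
    have wT: "w \<in> T" using w by (simp add: mem_seg)
    from LA show ?thesis
    proof (elim disjE exE conjE)
      assume "L = {}"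
      obtain d where "d \<in> K w" "\<And>y. y \<in> K w \<Longrightarrow> d \<le> y"
        using K_wo[OF wT] unfolding compact_wo_def by blast
      then show ?thesis using \<open>L = {}\<close> by (intro exI[of _ d]) (auto simp: not_less[symmetric])
    next
      fix r assume r: "r \<in> T" "r < x" "A = seg r" "L = K r"
      have "r \<in> seg x" using r by (simp add: mem_seg)
      then have "r < w" using seg_linear[OF x(1), of r w] w r by (auto simp: mem_seg less_le)
      then show ?thesis using K_less[OF r(1) wT] r(4) unfolding lex_less_def by blast
    qed
  qed
  then obtain first where first: "\<And>w. w \<in> seg x - A \<Longrightarrow> first w \<in> K w"
    "\<And>w. w \<in> seg x - A \<Longrightarrow> first w \<notin> L" "\<And>w. w \<in> seg x - A \<Longrightarrow> L \<inter> {..<first w} = K w \<inter> {..<first w}"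
    by metis
  have anti: "first w' \<le> first w" if "w \<in> seg x - A" "w' \<in> seg x - A" "w < w'" for w w'
    using lex_less_first_mono[OF first(1,2,3)[OF that(1)] first(1,2,3)[OF that(2)]] K_less[of w w'] that
    by (simp add: mem_seg)
  have xA: "x \<in> seg x - A" using x not_mem_lowers[OF A] by (simp add: mem_seg)
  let ?S = "{w \<in> seg x - A. w < x}"
  have wx: "first x \<le> first w" if "w \<in> ?S" for w using anti[of w x] that xA by blast
  \<comment> \<open>\<open>e\<close> is the least element of \<open>L\<close> that
    \<open>first\<close> drops below before \<open>x\<close>, or just a number above
    \<open>first w0\<close> if there is none. From \<open>w0\<close> on, \<open>first\<close> stays
    below \<open>e\<close> and above all elements of \<open>L\<close> smaller than
    \<open>e\<close>.\<close>
  have "\<exists>w0 e. w0 \<in> ?S \<and> first w0 < e \<and> (\<forall>a\<in>L. a < e \<longrightarrow> (\<forall>w\<in>?S. a < first w))"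
  proof -
    let ?B = "{a \<in> L. \<exists>w\<in>?S. first w < a}"
    have ok: "a < first w" if "a \<in> L" "a \<notin> ?B" "w \<in> ?S" for a w
      using that first(2)[of w] by (metis (mono_tags, lifting) linorder_less_linear mem_Collect_eq)
    show ?thesis
    proof (cases "?B = {}")
      case True
      obtain w0 where "w0 \<in> ?S" using not_isolatedD[OF x(1) iso A] by blast
      then show ?thesis using ok True by (intro exI[of _ w0] exI[of _ "first w0 + 1"]) auto
    next
      case False
      then obtain r where "r \<in> T" "L = K r" using LA by blast
      then have "compact_wo L" using K_wo by simp
      then obtain e where e: "e \<in> ?B" "\<And>a. a \<in> ?B \<Longrightarrow> e \<le> a"
        using False unfolding compact_wo_def by (metis (mono_tags, lifting) mem_Collect_eq subsetI)
      from e(1) obtain w0 where "w0 \<in> ?S" "first w0 < e" by blast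
      have "a < first w" if "a \<in> L" "a < e" "w \<in> ?S" for a w
      proof -
        have "a \<notin> ?B" using e(2)[of a] that(2) by (meson linorder_not_le)
        then show ?thesis using ok that by blast
      qed
      then show ?thesis using \<open>w0 \<in> ?S\<close> \<open>first w0 < e\<close> by blast
    qed
  qed
  then obtain w0 e where w0: "w0 \<in> ?S" "first w0 < e" and below_e: "\<And>a w. a \<in> L \<Longrightarrow> a < e \<Longrightarrow> w \<in> ?S \<Longrightarrow> a < first w"
    by blast
  have w0T: "w0 \<in> T" "w0 < x" "w0 \<notin> A" using w0 by (auto simp: mem_seg)
  have later: "w \<in> ?S" "first w \<le> first w0" if "w \<in> T" "w0 < w" "w < x" for w
  proof -
    show S: "w \<in> ?S" using that w0 lowers_down[OF A, of w w0] by (auto simp: mem_seg less_imp_le)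
    show "first w \<le> first w0" using anti[of w0 w] w0 S that(2) by blast
  qed
  text \<open>Otherwise the value at \<open>x\<close> would fall behind some element of \<open>L\<close> that survives at all
    \<open>w < x\<close>, and \<open>x\<close> would be an exit point.\<close>
  have gap: "a < first x" if a: "a \<in> L" "a < e" for a
  proof (rule ccontr)
    assume "\<not> a < first x"
    then have "first x < a" using first(2)[OF xA] a(1) by (metis linorder_neqE_linordered_idom)
    then obtain g where g: "g \<in> \<rat>" "first x < g" "g < a" using Rats_dense_in_real by blast
    have "cut_feat K (g, g) w = (L \<inter> {..g}, True)" if w: "w \<in> T" "w0 < w" "w < x" for w
    proof -
      have "g < first w" using below_e[OF a later(1)[OF w]] g(3) by simp
      then have "K w \<inter> {..g} = L \<inter> {..g}" using first(3)[of w] later(1)[OF w] by fastforce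
      then show ?thesis by (simp add: cut_feat_def)
    qed
    from feat_limit[OF x(1) iso exits[OF g(1) g(1)] w0T(1,2) this]
    have "K x \<inter> {..g} = L \<inter> {..g}" by (simp add: cut_feat_def)
    moreover have "first x \<in> K x \<inter> {..g}" using first(1)[OF xA] g(2) by simp
    ultimately show False using first(2)[OF xA] by blast
  qed
  \<comment> \<open>The elements of \<open>L\<close> below \<open>e\<close> have a maximum, if there
    are any, because \<open>L\<close> is compact; by \<open>gap\<close> it is smaller than
    \<open>first x\<close>, which leaves room for a rational.\<close>
  obtain p where p: "p \<in> \<rat>" "p < first x" "\<And>a. a \<in> L \<Longrightarrow> a < e \<Longrightarrow> a < p"
  proof (cases "L \<inter> {..first w0} = {}")
    case True
    obtain p where p: "p \<in> \<rat>" "p < first x" using Rats_dense_in_real[of "first x - 1" "first x"] by auto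
    show ?thesis
    proof (rule that[OF p])
      fix a assume "a \<in> L" "a < e"
      then have "a \<in> L \<inter> {..first w0}" using below_e[of a w0] w0(1) by (simp add: less_imp_le)
      then show "a < p" using True by blast
    qed
  next
    case False
    then obtain r where "r \<in> T" "L = K r" using LA by blast
    then have "compact L" using K_wo by (simp add: compact_wo_def)
    then have "compact (L \<inter> {..first w0})" by (intro compact_Int_closed) auto
    then obtain m where m: "m \<in> L" "m \<le> first w0" "\<And>a. a \<in> L \<Longrightarrow> a \<le> first w0 \<Longrightarrow> a \<le> m"
      using compact_attains_sup[OF _ False] by (metis IntD1 IntD2 IntI atMost_iff)
    have "m < first x" using gap[OF m(1)] m(2) w0(2) by simp
    then obtain p where p: "p \<in> \<rat>" "m < p" "p < first x" using Rats_dense_in_real by blast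
    show ?thesis
    proof (rule that[OF p(1,3)])
      fix a assume "a \<in> L" "a < e"
      then have "a \<le> m" using m(3) below_e[of a w0] w0(1) by (simp add: less_imp_le)
      then show "a < p" using p(2) by simp
    qed
  qed
  \<comment> \<open>Now \<open>L\<close> has no element in \<open>{p<..q}\<close>, whereas
    \<open>K w\<close> contains \<open>first w\<close> there for every \<open>w\<close> strictly
    between \<open>w0\<close> and \<open>x\<close>.\<close>
  obtain q where q: "q \<in> \<rat>" "first w0 < q" "q < e" using Rats_dense_in_real[OF w0(2)] by blast
  let ?i = "(p, q)" and ?v = "(L \<inter> {..p}, False)"
  have const: "cut_feat K ?i w = ?v" if w: "w \<in> T" "w0 < w" "w < x" for w
  proof -
    have "p < first w" using wx[OF later(1)[OF w]] p(2) by simp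
    moreover have "K w \<inter> {..p} = L \<inter> {..p}" using first(3)[of w] later(1)[OF w] calculation by fastforce
    moreover have "first w \<in> K w \<inter> {p<..q}"
      using first(1)[of w] later[OF w] calculation(1) q(2) by auto
    ultimately show ?thesis by (auto simp: cut_feat_def)
  qed
  have fx: "cut_feat K ?i x = ?v" by (rule feat_limit[OF x(1) iso exits[OF p(1) q(1)] w0T(1,2) const])
  have const': "cut_feat K ?i w = ?v" if "w \<in> T" "w0 < w" "w \<le> x" for w
    using const fx that by (cases "w = x") (auto simp: less_le)
  have ne: "seg x - seg w0 \<noteq> {}" using w0T x(1) by (auto simp: mem_seg)
  \<comment> \<open>The node right after \<open>w0\<close> on the way to \<open>x\<close>. It is
    isolated and can therefore start a cell.\<close>
  obtain c' where c': "c' \<in> seg x - seg w0" "\<And>w. w \<in> seg x - seg w0 \<Longrightarrow> c' \<le> w"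
    using seg_least[OF x(1) _ ne] by blast
  have c'T: "c' \<in> T" "c' \<le> x" using c'(1) by (auto simp: mem_seg)
  have "w0 \<in> seg x" using w0T by (simp add: mem_seg)
  then have w0c: "w0 < c'" using seg_linear[OF x(1), of w0 c'] c'(1) w0T by (auto simp: mem_seg less_le)
  have "isolated c'"
    unfolding isolated_def
  proof (intro conjI bexI)
    show "seg w0 \<in> lowers c'" using w0T(1) w0c by (rule seg_lowers)
    have "w = c'" if "w \<in> seg c' - seg w0" for w
    proof -
      have "w \<in> seg x - seg w0" using that c'T seg_mono by blast
      then show ?thesis using c'(2)[of w] that by (auto simp: mem_seg)
    qed
    then show "seg c' - seg w0 = {c'}" using c' c'T by (auto simp: mem_seg)
  qed fact
  moreover have "x \<in> cell (cut_feat K) {?i} c'"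
    unfolding cell_def using x(1) c'T const' w0c by (auto dest: less_le_trans)
  ultimately obtain c where c: "root (cut_feat K) {?i} c" "x \<in> cell (cut_feat K) {?i} c" "c \<le> c'"
    by (rule root_exists)
  \<comment> \<open>Otherwise the node \<open>r\<close> with \<open>L = K r\<close> would lie
    between \<open>c\<close> and \<open>x\<close>, hence in the cell, although \<open>L\<close> has
    no element in \<open>{p<..q}\<close>.\<close>
  have "c \<notin> A"
  proof
    assume cA: "c \<in> A"
    then obtain r where r: "r \<in> T" "r < x" "A = seg r" "L = K r" using LA by blast
    have "c \<le> r" using cA r by (simp add: mem_seg)
    then have "cut_feat K ?i r = cut_feat K ?i c" using c(2) r by (simp add: cell_def)
    moreover have "cut_feat K ?i c' = cut_feat K ?i c" using c c'T by (simp add: cell_def)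
    ultimately have "cut_feat K ?i r = ?v" using const'[OF c'T(1) w0c c'T(2)] by simp
    then obtain a where "a \<in> L" "p < a" "a \<le> q" using r(4) by (auto simp: cut_feat_def)
    then show False using p(3)[of a] q(3) by simp
  qed
  then show ?thesis using that p(1) q(1) c(1,2) by blast
qed

text \<open>If \<open>x\<close> is not below \<open>y\<close>, take a cell around \<open>x\<close>
  whose root lies outside the common part of the two segments. A root of a cell containing both
  points would lie in that part.\<close>

lemma cells_separate:
  assumes "x \<in> T" "y \<in> T" "\<not> special x" "\<not> special y" "x \<noteq> y"
  obtains p q c where "p \<in> \<rat>" "q \<in> \<rat>" "root (cut_feat K) {(p, q)} c"
    "x \<in> cell (cut_feat K) {(p, q)} c \<longleftrightarrow> y \<notin> cell (cut_feat K) {(p, q)} c"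
proof -
  have main: "\<exists>p q c. p \<in> \<rat> \<and> q \<in> \<rat> \<and> root (cut_feat K) {(p, q)} c \<and>
      x \<in> cell (cut_feat K) {(p, q)} c \<and> y \<notin> cell (cut_feat K) {(p, q)} c"
    if xy: "x \<in> T" "y \<in> T" "\<not> special x" "\<not> x \<le> y" for x y
  proof -
    obtain p q c where c: "p \<in> \<rat>" "q \<in> \<rat>" "root (cut_feat K) {(p, q)} c"
      "x \<in> cell (cut_feat K) {(p, q)} c" "c \<notin> seg x \<inter> seg y"
      by (rule cell_above[OF xy(1,3) seg_Int_lowers[OF xy(1,2,4)]])
    have "y \<notin> cell (cut_feat K) {(p, q)} c"
    proof
      assume y: "y \<in> cell (cut_feat K) {(p, q)} c"
      have "c \<in> seg x \<inter> seg y"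
        using cellD(2)[OF c(4)] cellD(2)[OF y] root_mem[OF c(3)] by (simp add: mem_seg)
      then show False using c(5) by blast
    qed
    then show ?thesis using c by blast
  qed
  have "\<not> x \<le> y \<or> \<not> y \<le> x" using assms(5) by auto
  then have "\<exists>p q c. p \<in> \<rat> \<and> q \<in> \<rat> \<and> root (cut_feat K) {(p, q)} c \<and>
      (x \<in> cell (cut_feat K) {(p, q)} c \<longleftrightarrow> y \<notin> cell (cut_feat K) {(p, q)} c)"
  proof
    assume "\<not> x \<le> y"
    from main[OF assms(1,2,3) this] show ?thesis by blast
  next
    assume "\<not> y \<le> x"
    from main[OF assms(2,1,4) this] show ?thesis by blast
  qed
  then show ?thesis using that by blast
qed

end

end

section \<open>From equality on the families to strict convexity\<close>

context order_tree
begin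

text \<open>Sums of \<delta> vanish on the sets obtained by successively intersecting with members
  of the family or removing them. Such a set can contain \<open>x\<close> and avoid finitely many
  other points of the support, so that the remaining mass is too small to cancel the value at
  \<open>x\<close>.\<close>

lemma separated_zero:
  fixes \<delta> :: "'a \<Rightarrow> real"
  assumes sum: "(\<lambda>t. \<bar>\<delta> t\<bar>) summable_on UNIV"
    and G: "\<And>G. G \<in> \<G> \<Longrightarrow> (\<Sum>\<^sub>\<infinity>t\<in>G. \<delta> t) = 0" and univ: "(\<Sum>\<^sub>\<infinity>t. \<delta> t) = 0"
    and Int: "\<And>G H. G \<in> \<G> \<Longrightarrow> H \<in> \<G> \<Longrightarrow> G \<inter> H \<noteq> {} \<Longrightarrow> G \<inter> H \<in> \<G>"
    and sep: "\<And>x y. \<delta> x \<noteq> 0 \<Longrightarrow> \<delta> y \<noteq> 0 \<Longrightarrow> x \<noteq> y \<Longrightarrow> \<exists>G\<in>\<G>. x \<in> G \<longleftrightarrow> y \<notin> G"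
  shows "\<delta> x = 0"
proof (rule ccontr)
  assume x: "\<delta> x \<noteq> 0"
  have sabs: "(\<lambda>t. \<bar>\<delta> t\<bar>) summable_on S" for S using summable_on_subset_banach[OF sum] by blast
  have s: "\<delta> summable_on S" for S using abs_summable_real[OF sabs] .
  \<comment> \<open>Requiring zero sums also after intersection with each member makes \<D> stable
    under both intersecting with members and removing them.\<close>
  define \<D> where "\<D> = {H. \<forall>G\<in>insert UNIV \<G>. (\<Sum>\<^sub>\<infinity>t\<in>H \<inter> G. \<delta> t) = 0}"
  have D: "(\<Sum>\<^sub>\<infinity>t\<in>H. \<delta> t) = 0" if "H \<in> \<D>" for H using that unfolding \<D>_def by auto
  have D_Int: "H \<inter> G \<in> \<D>" if H: "H \<in> \<D>" and G': "G \<in> \<G>" for H G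
  proof -
    have "(\<Sum>\<^sub>\<infinity>t\<in>(H \<inter> G) \<inter> F. \<delta> t) = 0" if F: "F \<in> insert UNIV \<G>" for F
    proof (cases "G \<inter> F = {}")
      case True
      then have "(H \<inter> G) \<inter> F = {}" by blast
      then show ?thesis by simp
    next
      case False
      then have "G \<inter> F \<in> insert UNIV \<G>" using Int[OF G'] F G' by auto
      then have "(\<Sum>\<^sub>\<infinity>t\<in>H \<inter> (G \<inter> F). \<delta> t) = 0" using H unfolding \<D>_def by blast
      then show ?thesis by (simp only: Int_assoc)
    qed
    then show ?thesis unfolding \<D>_def by blast
  qed
  have D_Diff: "H - G \<in> \<D>" if H: "H \<in> \<D>" and G': "G \<in> \<G>" for H G
  proof -
    have "(\<Sum>\<^sub>\<infinity>t\<in>(H - G) \<inter> F. \<delta> t) = 0" if F: "F \<in> insert UNIV \<G>" for F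
    proof -
      have "(\<Sum>\<^sub>\<infinity>t\<in>H \<inter> F. \<delta> t) = 0" "(\<Sum>\<^sub>\<infinity>t\<in>H \<inter> G \<inter> F. \<delta> t) = 0"
        using H D_Int[OF H G'] F unfolding \<D>_def by blast+
      moreover have "H \<inter> F = (H - G) \<inter> F \<union> H \<inter> G \<inter> F" by blast
      moreover have "((H - G) \<inter> F) \<inter> (H \<inter> G \<inter> F) = {}" by blast
      ultimately show ?thesis using infsum_Un_disjoint[OF s s, of "(H - G) \<inter> F" "H \<inter> G \<inter> F"] by simp
    qed
    then show ?thesis unfolding \<D>_def by blast
  qed
  have avoid: "\<exists>H\<in>\<D>. x \<in> H \<and> H \<inter> F = {}" if "finite F" "\<And>y. y \<in> F \<Longrightarrow> \<delta> y \<noteq> 0 \<and> y \<noteq> x" for F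
    using that
  proof (induction F rule: finite_induct)
    case empty
    have "UNIV \<in> \<D>" using G univ unfolding \<D>_def by auto
    then show ?case by blast
  next
    case (insert y F)
    have "\<exists>H\<in>\<D>. x \<in> H \<and> H \<inter> F = {}" by (rule insert.IH) (use insert.prems in blast)
    then obtain H where H: "H \<in> \<D>" "x \<in> H" "H \<inter> F = {}" by blast
    have "\<delta> y \<noteq> 0" "x \<noteq> y" using insert.prems by auto
    then obtain G where G': "G \<in> \<G>" "x \<in> G \<longleftrightarrow> y \<notin> G" using sep[OF x] by blast
    show ?case
    proof (cases "x \<in> G")
      case True
      then show ?thesis using D_Int[OF H(1) G'(1)] H(2,3) G'(2) by (intro bexI[of _ "H \<inter> G"]) auto
    next
      case False
      then show ?thesis using D_Diff[OF H(1) G'(1)] H(2,3) G'(2) by (intro bexI[of _ "H - G"]) auto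
    qed
  qed
  have half: "\<bar>\<delta> x\<bar> / 2 > 0" using x by simp
  obtain F where F: "finite F" "F \<subseteq> UNIV"
    "\<And>B. B \<subseteq> UNIV - F \<Longrightarrow> (\<Sum>\<^sub>\<infinity>t\<in>B. \<bar>\<delta> t\<bar>) \<le> \<bar>\<delta> x\<bar> / 2"
    using abs_summable_tail[OF sum half] by metis
  let ?F = "{y \<in> F. \<delta> y \<noteq> 0 \<and> y \<noteq> x}"
  obtain H where H: "H \<in> \<D>" "x \<in> H" "H \<inter> ?F = {}"
  proof -
    have "\<exists>H\<in>\<D>. x \<in> H \<and> H \<inter> ?F = {}" by (rule avoid) (use F(1) in auto)
    then show ?thesis using that by blast
  qed
  have "{x} \<union> (H - {x}) = H" using H(2) by blast
  then have "(\<Sum>\<^sub>\<infinity>t\<in>H. \<delta> t) = \<delta> x + (\<Sum>\<^sub>\<infinity>t\<in>H - {x}. \<delta> t)"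
    using infsum_Un_disjoint[OF s s, of "{x}" "H - {x}"] by simp
  then have "\<bar>\<delta> x\<bar> \<le> \<bar>\<Sum>\<^sub>\<infinity>t\<in>H - {x}. \<delta> t\<bar>" using D[OF H(1)] by simp
  also have "\<dots> \<le> (\<Sum>\<^sub>\<infinity>t\<in>H - {x}. \<bar>\<delta> t\<bar>)" by (rule abs_infsum_le[OF sabs])
  also have "\<dots> = (\<Sum>\<^sub>\<infinity>t\<in>(H - {x}) - F. \<bar>\<delta> t\<bar>)"
    using H(3) by (intro infsum_cong_neutral) auto
  also have "\<dots> \<le> \<bar>\<delta> x\<bar> / 2" by (rule F(3)) blast
  finally show False using x by simp
qed

lemma vol_singleton: "vol \<phi> {x} = \<bar>mass \<phi> x\<bar>"
  by (simp add: vol_infsum)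

lemma vol_UNIV: "vol \<phi> T = (\<Sum>\<^sub>\<infinity>t. \<bar>mass \<phi> t\<bar>)"
  unfolding vol_infsum by (rule infsum_cong_neutral) (auto simp: mass_def)

text \<open>Additivity of the total mass forces equality in the triangle inequality at every atom,
  so the two masses there have no opposite signs; with equal absolute values they coincide.\<close>

lemma dual_eqI:
  assumes \<phi>: "\<phi> \<in> dual" and \<psi>: "\<psi> \<in> dual" and eq: "\<And>t. \<bar>mass \<phi> t\<bar> = \<bar>mass \<psi> t\<bar>"
    and tot: "vol (\<lambda>f. \<phi> f + \<psi> f) T = vol \<phi> T + vol \<psi> T"
  shows "\<phi> = \<psi>"
proof -
  note s = mass_summable[OF \<phi>] mass_summable[OF \<psi>] mass_summable[OF dual_plus[OF \<phi> \<psi>]]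
  let ?d = "\<lambda>t. \<bar>mass \<phi> t\<bar> + \<bar>mass \<psi> t\<bar> - \<bar>mass (\<lambda>f. \<phi> f + \<psi> f) t\<bar>"
  have nonneg: "0 \<le> ?d t" for t using mass_plus[OF \<phi> \<psi>, of t] by simp
  have le: "?d t \<le> \<bar>mass \<phi> t\<bar> + \<bar>mass \<psi> t\<bar>" for t by simp
  have sd: "?d summable_on UNIV"
    by (rule summable_on_comparison_test[OF summable_on_add[OF s(1,2)]]) (use nonneg le in auto)
  have "(\<Sum>\<^sub>\<infinity>t. ?d t) + (\<Sum>\<^sub>\<infinity>t. \<bar>mass (\<lambda>f. \<phi> f + \<psi> f) t\<bar>) = (\<Sum>\<^sub>\<infinity>t. \<bar>mass \<phi> t\<bar>) + (\<Sum>\<^sub>\<infinity>t. \<bar>mass \<psi> t\<bar>)"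
    using infsum_add[OF sd s(3)] infsum_add[OF s(1,2)] by simp
  then have "(\<Sum>\<^sub>\<infinity>t. ?d t) = 0" using tot unfolding vol_UNIV by simp
  then have d0: "?d t = 0" for t
    using sd nonneg by (intro nonneg_infsum_le_0D[of ?d UNIV]) auto
  have "mass \<phi> t = mass \<psi> t" for t
    using d0[of t] eq[of t] mass_plus[OF \<phi> \<psi>, of t] by (auto simp: abs_if split: if_splits)
  then have "\<phi> f = \<psi> f" if "f \<in> C0 T" for f
    using dual_representation[OF \<phi> that] dual_representation[OF \<psi> that] by simp
  moreover have "\<phi> f = \<psi> f" if "f \<notin> C0 T" for f
    using that \<phi> \<psi> by (simp add: dual_space_def)
  ultimately show ?thesis by blast
qed

proposition strictly_convex_dual_norm:
  assumes K_wo: "\<And>t. t \<in> T \<Longrightarrow> compact_wo (K t)"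
    and K_less: "\<And>s t. s \<in> T \<Longrightarrow> t \<in> T \<Longrightarrow> s < t \<Longrightarrow> lex_less (K s) (K t)"
  shows "\<exists>N. equivalent_norm_on (C0 T) sup_norm N \<and> lattice_norm (C0 T) N \<and>
    strictly_convex (dual_space (C0 T) N) (dual_norm (C0 T) N)"
proof -
  let ?f = "cut_feat K"
  let ?I = "\<rat> \<times> \<rat> :: (real \<times> real) set"
  let ?cells = "\<lambda>\<sigma>. {cell ?f \<sigma> c | c. root ?f \<sigma> c}"
  let ?Fin = "{\<sigma>. finite \<sigma> \<and> \<sigma> \<subseteq> ?I}"
  \<comment> \<open>The indices are restricted to rational pairs to keep the collection countable.
    The entry with \<open>{{}}\<close> and the last block make every first component occur alone, as
    \<open>single\<close> in \<open>norm_for_families\<close> demands.\<close>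
  let ?QQ = "{({}, {T}), ({}, {{}}), ({}, {{x} | x. isolated x})} \<union> (\<lambda>\<sigma>. ({}, ?cells \<sigma>)) ` ?Fin \<union>
    (\<lambda>i. (tame ?f i, {{x} | x. x \<in> exits ?f i})) ` ?I \<union> (\<lambda>i. ({}, {tame ?f i})) ` ?I"
  have "countable (\<rat> :: real set)" unfolding Rats_def by simp
  then have cI: "countable ?I" by (intro countable_SIGMA)
  then have "countable ?Fin" by (rule countable_Collect_finite_subset)
  then have cQQ: "countable ?QQ" using cI by (intro countable_Un countable_image) auto
  \<comment> \<open>Index 0 is reserved for the family \<open>({}, {T})\<close>, as
    \<open>Q0\<close> prescribes.\<close>
  define Q where "Q n = (case n of 0 \<Rightarrow> ({}, {T}) | Suc k \<Rightarrow> from_nat_into ?QQ k)" for n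
  have ran: "Q n \<in> ?QQ" for n
  proof (cases n)
    case (Suc k)
    then show ?thesis using from_nat_into[of ?QQ k] by (simp add: Q_def)
  qed (simp add: Q_def)
  have surj: "\<exists>n. Q n = z" if z: "z \<in> ?QQ" for z
  proof -
    obtain k where "from_nat_into ?QQ k = z" using from_nat_into_surj[OF cQQ z] by blast
    then have "Q (Suc k) = z" by (simp add: Q_def)
    then show ?thesis by blast
  qed
  have T: "opn T" using openin_topspace[of "interval_topology T"] by simp
  have opn_iso: "opn {x}" if x: "isolated x" for x
  proof -
    obtain A where "A \<in> lowers x" "seg x - A = {x}" "x \<in> T" using x unfolding isolated_def by blast
    then show ?thesis unfolding openin_interval_iff by (metis empty_subsetI insert_subset order_refl singletonD)
  qed
  have adm: "admissible (fst z) (snd z)" if "z \<in> ?QQ" for z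
    using that
  proof (elim UnE imageE insertE emptyE)
    fix \<sigma> assume z: "z = ({}, ?cells \<sigma>)"
    have "P = P'" if P: "P \<in> ?cells \<sigma>" "P' \<in> ?cells \<sigma>" "P \<inter> P' \<noteq> {}" for P P'
    proof -
      obtain c d where "P = cell ?f \<sigma> c" "P' = cell ?f \<sigma> d" "root ?f \<sigma> c" "root ?f \<sigma> d" using P(1,2) by blast
      then show ?thesis using cells_disjoint P(3) by metis
    qed
    moreover have "opn P" if "P \<in> ?cells \<sigma>" for P using that opn_cell unfolding root_def by blast
    ultimately show ?thesis unfolding z admissible_def fst_conv snd_conv Un_empty_left Int_empty_right
      by (intro conjI ballI impI openin_empty refl) blast+
  next
    fix i assume "z = (tame ?f i, {{x} | x. x \<in> exits ?f i})"
    then show ?thesis using opn_tame[of ?f i] by (auto simp: admissible_def exits_def)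
  next
    fix i assume "z = ({}, {tame ?f i})"
    then show ?thesis using opn_tame by (simp add: admissible_def)
  qed (use T opn_iso in \<open>auto simp: admissible_def\<close>)
  have single: "\<exists>m. Q m = ({}, {fst (Q n)})" for n
  proof (rule surj)
    show "({}, {fst (Q n)}) \<in> ?QQ" using ran[of n] by auto
  qed
  have Q0: "Q 0 = ({}, {T})" by (simp add: Q_def)
  obtain N where N: "equivalent_norm_on (C0 T) sup_norm N" "lattice_norm (C0 T) N"
    "\<And>\<phi> \<psi> n P. \<phi> \<in> dual \<Longrightarrow> \<psi> \<in> dual \<Longrightarrow>
      dual_norm (C0 T) N \<phi> = dual_norm (C0 T) N (\<lambda>f. \<phi> f + \<psi> f) / 2 \<Longrightarrow>
      dual_norm (C0 T) N (\<lambda>f. \<phi> f + \<psi> f) / 2 = dual_norm (C0 T) N \<psi> \<Longrightarrow>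
      P \<in> snd (Q n) \<Longrightarrow> vol \<phi> P = vol \<psi> P \<and> vol (\<lambda>f. \<phi> f + \<psi> f) P = vol \<phi> P + vol \<psi> P"
    using norm_for_families[of Q, OF adm[OF ran] Q0 single] by blast
  have "strictly_convex (dual_space (C0 T) N) (dual_norm (C0 T) N)"
    unfolding strictly_convex_def dual_space_equiv[OF N(1)]
  proof (intro ballI impI, elim conjE)
    fix \<phi> \<psi> assume \<phi>: "\<phi> \<in> dual" and \<psi>: "\<psi> \<in> dual"
      and eq: "dual_norm (C0 T) N \<phi> = dual_norm (C0 T) N (\<lambda>f. \<phi> f + \<psi> f) / 2"
        "dual_norm (C0 T) N (\<lambda>f. \<phi> f + \<psi> f) / 2 = dual_norm (C0 T) N \<psi>"
    have vol: "vol \<phi> P = vol \<psi> P" "vol (\<lambda>f. \<phi> f + \<psi> f) P = vol \<phi> P + vol \<psi> P"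
      if z: "z \<in> ?QQ" and P: "P \<in> snd z" for z P
    proof -
      obtain n where "Q n = z" using surj[OF z] by blast
      then have "P \<in> snd (Q n)" using P by simp
      from N(3)[OF \<phi> \<psi> eq this] show "vol \<phi> P = vol \<psi> P" "vol (\<lambda>f. \<phi> f + \<psi> f) P = vol \<phi> P + vol \<psi> P"
        by blast+
    qed
    have volT: "vol \<phi> T = vol \<psi> T" "vol (\<lambda>f. \<phi> f + \<psi> f) T = vol \<phi> T + vol \<psi> T"
      using vol[of "({}, {T})" T] by auto
    let ?\<delta> = "\<lambda>t. \<bar>mass \<phi> t\<bar> - \<bar>mass \<psi> t\<bar>"
    note sm = mass_summable_on[OF \<phi>] mass_summable_on[OF \<psi>]
    have sum: "(\<lambda>t. \<bar>?\<delta> t\<bar>) summable_on UNIV"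
      by (rule summable_on_comparison_test[OF summable_on_add[OF sm]]) auto
    have diff: "(\<Sum>\<^sub>\<infinity>t\<in>S. ?\<delta> t) = vol \<phi> S - vol \<psi> S" for S
    proof -
      have "(\<Sum>\<^sub>\<infinity>t\<in>S. ?\<delta> t) + (\<Sum>\<^sub>\<infinity>t\<in>S. \<bar>mass \<psi> t\<bar>) = (\<Sum>\<^sub>\<infinity>t\<in>S. \<bar>mass \<phi> t\<bar>)"
        using infsum_add[OF abs_summable_real[OF summable_on_subset_banach[OF sum, of S]] sm(2)[of S]] by simp
      then show ?thesis by (simp add: vol_infsum)
    qed
    \<comment> \<open>Singletons of special points belong to the families, so the separation below
      concerns only the other points.\<close>
    have special: "?\<delta> x = 0" if x: "special K x" for x
    proof -
      have "vol \<phi> {x} = vol \<psi> {x}"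
        using K_wo K_less x
      proof (simp only: special_def, elim disjE bexE)
        assume "isolated x"
        then show ?thesis by (intro vol(1)[of "({}, {{x} | x. isolated x})"]) auto
      next
        fix p q assume "p \<in> \<rat>" "q \<in> \<rat>" "x \<in> exits ?f (p, q)"
        then show ?thesis by (intro vol(1)[of "(tame ?f (p, q), {{x} | x. x \<in> exits ?f (p, q)})"]) auto
      qed
      then show ?thesis by (simp add: vol_singleton)
    qed
    have "?\<delta> t = 0" for t
    proof (rule separated_zero[OF sum, of "\<Union>\<sigma>\<in>?Fin. ?cells \<sigma>"])
      fix G assume "G \<in> (\<Union>\<sigma>\<in>?Fin. ?cells \<sigma>)"
      then obtain \<sigma> where \<sigma>: "\<sigma> \<in> ?Fin" "G \<in> ?cells \<sigma>" by blast
      have "({}, ?cells \<sigma>) \<in> ?QQ" using \<sigma>(1) by blast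
      then show "(\<Sum>\<^sub>\<infinity>t\<in>G. ?\<delta> t) = 0" using vol(1)[of "({}, ?cells \<sigma>)" G] \<sigma>(2) diff by simp
    next
      have "(\<Sum>\<^sub>\<infinity>t. ?\<delta> t) = (\<Sum>\<^sub>\<infinity>t\<in>T. ?\<delta> t)" by (rule infsum_cong_neutral) (auto simp: mass_def)
      then show "(\<Sum>\<^sub>\<infinity>t. ?\<delta> t) = 0" using diff volT(1) by simp
    next
      fix G H assume GH: "G \<in> (\<Union>\<sigma>\<in>?Fin. ?cells \<sigma>)" "H \<in> (\<Union>\<sigma>\<in>?Fin. ?cells \<sigma>)" "G \<inter> H \<noteq> {}"
      obtain \<sigma> c where c: "\<sigma> \<in> ?Fin" "root ?f \<sigma> c" "G = cell ?f \<sigma> c" using GH(1) by blast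
      obtain \<tau> d where d: "\<tau> \<in> ?Fin" "root ?f \<tau> d" "H = cell ?f \<tau> d" using GH(2) by blast
      obtain e where e: "root ?f (\<sigma> \<union> \<tau>) e" "G \<inter> H = cell ?f (\<sigma> \<union> \<tau>) e"
        using cell_Int[OF c(2) d(2)] GH(3) c(3) d(3) by blast
      moreover have "\<sigma> \<union> \<tau> \<in> ?Fin" using c(1) d(1) by blast
      ultimately show "G \<inter> H \<in> (\<Union>\<sigma>\<in>?Fin. ?cells \<sigma>)" by blast
    next
      fix x y assume xy: "?\<delta> x \<noteq> 0" "?\<delta> y \<noteq> 0" "x \<noteq> y"
      have "x \<in> T" "y \<in> T" using xy(1,2) by (auto simp: mass_def split: if_splits)
      moreover have "\<not> special K x" "\<not> special K y" using special xy by blast+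
      ultimately obtain p q c where "p \<in> \<rat>" "q \<in> \<rat>" "root ?f {(p, q)} c"
        "x \<in> cell ?f {(p, q)} c \<longleftrightarrow> y \<notin> cell ?f {(p, q)} c"
        using cells_separate[of K x y] K_wo K_less xy(3) by metis
      moreover have "{(p, q)} \<in> ?Fin" using \<open>p \<in> \<rat>\<close> \<open>q \<in> \<rat>\<close> by simp
      ultimately show "\<exists>G\<in>(\<Union>\<sigma>\<in>?Fin. ?cells \<sigma>). x \<in> G \<longleftrightarrow> y \<notin> G" by blast
    qed
    then show "\<phi> = \<psi>" by (intro dual_eqI[OF \<phi> \<psi> _ volT(2)]) simp
  qed
  then show ?thesis using N(1,2) by blast
qed

end

theorem corollary2:
  fixes T :: "'a::order set"
  assumes "tree T"
    and "\<exists>N. equivalent_norm_on (C0 T) sup_norm N \<and> lattice_norm (C0 T) N \<and>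
             gateaux_smooth (C0 T) N"
  shows "(\<exists>\<rho> :: 'a \<Rightarrow> Y. strict_mono_on T \<rho>) \<and>
         (\<exists>N. equivalent_norm_on (C0 T) sup_norm N \<and> lattice_norm (C0 T) N \<and>
              strictly_convex (dual_space (C0 T) N) (dual_norm (C0 T) N))"
proof -
  obtain N where "equivalent_norm_on (C0 T) sup_norm N" "lattice_norm (C0 T) N" "gateaux_smooth (C0 T) N"
    using assms(2) by blast
  then interpret smooth_normed_tree T N
    using assms(1) by unfold_locales
  show ?thesis
    using strict_mono_to_Y strictly_convex_dual_norm[of profile, OF compact_wo_profile profile_lex_less] by blast
qed

end
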